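(* Let $k\ge 1$, let $\Lambda$ be a row-finite $k$-graph with no sources, and let $G_\Lambda$ be the corresponding $k$-graph groupoid. Then the algebra $A(G_\Lambda)$ is isomorphic to the Kumjian-Pask algebra $\mathrm{KP}(\Lambda,\mathbb{C})$.
   Context: $\mathbb{N}$ includes $0$. A $k$-graph is a countable small category $\Lambda$ with a functor $d:\Lambda\to\mathbb{N}^k$ (the degree) having the factorisation property: if $d(\lambda)=m+n$ there are unique $\mu,\nu\in\Lambda$ with $d(\mu)=m$, $d(\nu)=n$ and $\lambda=\mu\nu$. Write $\Lambda^n:=d^{-1}(n)$; $\Lambda^0$ is identified with the objects (vertices), and $r,s:\Lambda\to\Lambda^0$ are codomain and domain, so $\lambda\mu$ is defined iff $s(\lambda)=r(\mu)$. $v\Lambda^n:=\{\lambda\in\Lambda^n:r(\lambda)=v\}$. $\Lambda$ is row-finite if every $v\Lambda^n$ is finite, and has no sources if every $v\Lambda^n$ ($v\in\Lambda^0,n\in\mathbb{N}^k$) is nonempty. Groupoid: let $\Omega_k$ be the $k$-graph $\{(p,q)\in\mathbb{N}^k\times\mathbb{N}^k:p\le q\}$ with $r(p,q)=(p,p)$, $s(p,q)=(q,q)$, $(p,q)(q,t)=(p,t)$, $d(p,q)=q-p$. An infinite path is a degree-preserving functor $x:\Omega_k\to\Lambda$; $\Lambda^\infty$ is the set of these, $r(x):=x(0,0)$, and for $p\in\mathbb{N}^k$, $\sigma^p(x)(m,n):=x(m+p,n+p)$. For $\lambda\in\Lambda$ and $x\in\Lambda^\infty$ with $r(x)=s(\lambda)$,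 $\lambda x$ is the unique $y\in\Lambda^\infty$ with $y(0,d(\lambda))=\lambda$ and $\sigma^{d(\lambda)}(y)=x$. Then $G_\Lambda:=\{(x,n,y)\in\Lambda^\infty\times\mathbb{Z}^k\times\Lambda^\infty:\ \exists\, l,m\in\mathbb{N}^k,\ n=l-m,\ \sigma^l(x)=\sigma^m(y)\}$, with $r(x,n,y)=x$, $s(x,n,y)=y$ (identifying $x$ with $(x,0,x)$), $(x,n,y)(y,m,z)=(x,n+m,z)$, $(x,n,y)^{-1}=(y,-n,x)$, and the topology with basis the sets $Z(\mu,\nu):=\{(\mu x,d(\mu)-d(\nu),\nu x):x\in\Lambda^\infty,r(x)=s(\mu)\}$, for $\mu,\nu\in\Lambda$ with $s(\mu)=s(\nu)$. This is a locally compact Hausdorff groupoid with totally disconnected unit space and source map a local homeomorphism, and $c(x,n,y):=n$ is a continuous cocycle into $\mathbb{Z}^k$. $A(G)$: for $G=G_\Lambda$, with $\operatorname{supp}(f):=\{\gamma:f(\gamma)\ne0\}$, let $A_n:=\{f\in C_c(G):\operatorname{supp}(f)\subseteq c^{-1}(n),\ f\text{ locally constant}\}$ for $n\in\mathbb{Z}^k$ and $A(G):=\operatorname{span}\{A_n:n\in\mathbb{Z}^k\}\subseteq C_c(G)$, a complex algebra under $(f*g)(\gamma)=\sum_{r(\alpha)=r(\gamma)}f(\alpha)g(\alpha^{-1}\gamma)$. Kumjian-Pask algebra: let $\Lambda^{\ne0}:=\{\lambda:d(\lambda)\ne0\}$ and for each $\lambda\in\Lambda^{\neq 0}$ let $\lambda^*$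 be a formal symbol (ghost path). A Kumjian-Pask $\Lambda$-family in a complex algebra consists of elements $P_v$ ($v\in\Lambda^0$), $S_\lambda$, $S_{\lambda^*}$ ($\lambda\in\Lambda^{\ne0}$) such that: (KP1) the $P_v$ are mutually orthogonal idempotents; (KP2) for $\lambda,\mu\in\Lambda^{\ne0}$ with $s(\lambda)=r(\mu)$, $S_\lambda S_\mu=S_{\lambda\mu}$, $S_{\mu^*}S_{\lambda^*}=S_{(\lambda\mu)^*}$, and for $\lambda\in\Lambda^{\neq 0}$, $P_{r(\lambda)}S_\lambda=S_\lambda=S_\lambda P_{s(\lambda)}$ and $P_{s(\lambda)}S_{\lambda^*}=S_{\lambda^*}=S_{\lambda^*}P_{r(\lambda)}$; (KP3) for $\lambda,\mu\in\Lambda^{\ne0}$ with $d(\lambda)=d(\mu)$, $S_{\lambda^*}S_\mu=\delta_{\lambda,\mu}P_{s(\lambda)}$; (KP4) for $v\in\Lambda^0$ and $n\in\mathbb{N}^k\setminus\{0\}$, $P_v=\sum_{\lambda\in v\Lambda^n}S_\lambda S_{\lambda^*}$. $\mathrm{KP}(\Lambda,\mathbb{C})$ is the universal complex algebra generated by a Kumjian-Pask $\Lambda$-family. "Isomorphic" means isomorphic as complex algebras. *)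

theory Defs
  imports
    "HOL-Analysis.Analysis"
    "HOL-Algebra.Module"
    "HOL-Algebra.QuotRing"
begin

section \<open>Higher-rank graphs\<close>

text \<open>
  Small categories are given by their morphisms only: an object is identified with its
  identity morphism, so \<^term>\<open>rng\<close> (codomain) and \<^term>\<open>src\<close> (domain) are maps from
  morphisms to morphisms.  Composition is written as in the k-graph literature:
  \<open>comp \<Lambda> \<lambda> \<mu>\<close> is \<open>\<lambda>\<mu>\<close>, meaningful when \<open>src \<lambda> = rng \<mu>\<close>.
  The rank \<open>k\<close> is the cardinality of the finite index type \<open>'k\<close>, hence at least 1,
  and \<^typ>\<open>nat^'k\<close> carries the componentwise addition, subtraction and order.
\<close>

record ('a, 'k) kgraph =
  mor :: "'a set"
  rng :: "'a \<Rightarrow> 'a"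
  src :: "'a \<Rightarrow> 'a"
  comp :: "'a \<Rightarrow> 'a \<Rightarrow> 'a"
  deg :: "'a \<Rightarrow> nat^'k"

locale k_graph =
  fixes \<Lambda> :: "('a, 'k::finite) kgraph"
  assumes countable_mor: "countable (mor \<Lambda>)"
    and rng_mor: "a \<in> mor \<Lambda> \<Longrightarrow> rng \<Lambda> a \<in> mor \<Lambda>"
    and src_mor: "a \<in> mor \<Lambda> \<Longrightarrow> src \<Lambda> a \<in> mor \<Lambda>"
    and rng_rng: "a \<in> mor \<Lambda> \<Longrightarrow> rng \<Lambda> (rng \<Lambda> a) = rng \<Lambda> a"
    and src_rng: "a \<in> mor \<Lambda> \<Longrightarrow> src \<Lambda> (rng \<Lambda> a) = rng \<Lambda> a"
    and rng_src: "a \<in> mor \<Lambda> \<Longrightarrow> rng \<Lambda> (src \<Lambda> a) = src \<Lambda> a"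
    and src_src: "a \<in> mor \<Lambda> \<Longrightarrow> src \<Lambda> (src \<Lambda> a) = src \<Lambda> a"
    and comp_mor: "\<lbrakk>a \<in> mor \<Lambda>; b \<in> mor \<Lambda>; src \<Lambda> a = rng \<Lambda> b\<rbrakk> \<Longrightarrow> comp \<Lambda> a b \<in> mor \<Lambda>"
    and rng_comp: "\<lbrakk>a \<in> mor \<Lambda>; b \<in> mor \<Lambda>; src \<Lambda> a = rng \<Lambda> b\<rbrakk> \<Longrightarrow> rng \<Lambda> (comp \<Lambda> a b) = rng \<Lambda> a"
    and src_comp: "\<lbrakk>a \<in> mor \<Lambda>; b \<in> mor \<Lambda>; src \<Lambda> a = rng \<Lambda> b\<rbrakk> \<Longrightarrow> src \<Lambda> (comp \<Lambda> a b) = src \<Lambda> b"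
    and comp_rng: "a \<in> mor \<Lambda> \<Longrightarrow> comp \<Lambda> (rng \<Lambda> a) a = a"
    and comp_src: "a \<in> mor \<Lambda> \<Longrightarrow> comp \<Lambda> a (src \<Lambda> a) = a"
    and comp_assoc: "\<lbrakk>a \<in> mor \<Lambda>; b \<in> mor \<Lambda>; c \<in> mor \<Lambda>; src \<Lambda> a = rng \<Lambda> b; src \<Lambda> b = rng \<Lambda> c\<rbrakk>
          \<Longrightarrow> comp \<Lambda> (comp \<Lambda> a b) c = comp \<Lambda> a (comp \<Lambda> b c)"
    and deg_rng: "a \<in> mor \<Lambda> \<Longrightarrow> deg \<Lambda> (rng \<Lambda> a) = 0"
    and deg_comp: "\<lbrakk>a \<in> mor \<Lambda>; b \<in> mor \<Lambda>; src \<Lambda> a = rng \<Lambda> b\<rbrakk>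
          \<Longrightarrow> deg \<Lambda> (comp \<Lambda> a b) = deg \<Lambda> a + deg \<Lambda> b"
    and factorisation: "\<lbrakk>a \<in> mor \<Lambda>; deg \<Lambda> a = m + n\<rbrakk> \<Longrightarrow>
          \<exists>!p. fst p \<in> mor \<Lambda> \<and> snd p \<in> mor \<Lambda> \<and> deg \<Lambda> (fst p) = m \<and> deg \<Lambda> (snd p) = n \<and>
               src \<Lambda> (fst p) = rng \<Lambda> (snd p) \<and> a = comp \<Lambda> (fst p) (snd p)"

definition verts :: "('a, 'k::finite) kgraph \<Rightarrow> 'a set" where
  "verts \<Lambda> = {v \<in> mor \<Lambda>. deg \<Lambda> v = 0}"

definition paths_from :: "('a, 'k::finite) kgraph \<Rightarrow> 'a \<Rightarrow> nat^'k \<Rightarrow> 'a set" where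
  "paths_from \<Lambda> v n = {a \<in> mor \<Lambda>. deg \<Lambda> a = n \<and> rng \<Lambda> a = v}"

definition row_finite :: "('a, 'k::finite) kgraph \<Rightarrow> bool" where
  "row_finite \<Lambda> \<longleftrightarrow> (\<forall>v\<in>verts \<Lambda>. \<forall>n. finite (paths_from \<Lambda> v n))"

definition no_sources :: "('a, 'k::finite) kgraph \<Rightarrow> bool" where
  "no_sources \<Lambda> \<longleftrightarrow> (\<forall>v\<in>verts \<Lambda>. \<forall>n. paths_from \<Lambda> v n \<noteq> {})"

text \<open>The identification of objects (identity morphisms) with morphisms of degree 0.\<close>

lemma (in k_graph) verts_eq_identities: "verts \<Lambda> = {a \<in> mor \<Lambda>. rng \<Lambda> a = a}"
proof -
  have "rng \<Lambda> a = a" if a: "a \<in> mor \<Lambda>" "deg \<Lambda> a = 0" for a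
  proof -
    have s: "deg \<Lambda> (src \<Lambda> a) = 0"
      using deg_rng[OF src_mor[OF a(1)]] rng_src[OF a(1)] by simp
    have "deg \<Lambda> a = 0 + 0" using a(2) by simp
    from factorisation[OF a(1) this]
    obtain p where
      "\<And>q. fst q \<in> mor \<Lambda> \<and> snd q \<in> mor \<Lambda> \<and> deg \<Lambda> (fst q) = 0 \<and> deg \<Lambda> (snd q) = 0 \<and>
         src \<Lambda> (fst q) = rng \<Lambda> (snd q) \<and> a = comp \<Lambda> (fst q) (snd q) \<Longrightarrow> q = p"
      by blast
    from this[of "(rng \<Lambda> a, a)"] this[of "(a, src \<Lambda> a)"] have "(rng \<Lambda> a, a) = (a, src \<Lambda> a)"
      by (simp add: a s rng_mor src_mor deg_rng src_rng rng_src comp_rng comp_src)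
    then show ?thesis by simp
  qed
  then show ?thesis
    unfolding verts_def using deg_rng by fastforce
qed


section \<open>Infinite paths and the path groupoid\<close>

definition Omega :: "((nat^'k) \<times> (nat^'k), 'k::finite) kgraph" where
  "Omega = \<lparr>mor = {(p, q). p \<le> q},
            rng = (\<lambda>(p, q). (p, p)),
            src = (\<lambda>(p, q). (q, q)),
            comp = (\<lambda>(p, q) (q', t). (p, t)),
            deg = (\<lambda>(p, q). q - p)\<rparr>"

lemma k_graph_Omega: "k_graph (Omega :: (_, 'k::finite) kgraph)"
proof
  fix a :: "(nat^'k) \<times> (nat^'k)" and m n
  assume "a \<in> mor Omega" "deg Omega a = m + n"
  then obtain p q where a: "a = (p, q)" "p \<le> q" "q - p = m + n"
    by (auto simp: Omega_def)
  have q: "q = p + m + n"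
    using a(2,3) by (auto simp: vec_eq_iff less_eq_vec_def) (metis add.assoc le_add_diff_inverse)
  show "\<exists>!z. fst z \<in> mor Omega \<and> snd z \<in> mor Omega \<and> deg Omega (fst z) = m \<and>
          deg Omega (snd z) = n \<and> src Omega (fst z) = rng Omega (snd z) \<and>
          a = comp Omega (fst z) (snd z)"
  proof (rule ex1I[of _ "((p, p + m), (p + m, q))"])
    fix z assume "fst z \<in> mor Omega \<and> snd z \<in> mor Omega \<and> deg Omega (fst z) = m \<and>
          deg Omega (snd z) = n \<and> src Omega (fst z) = rng Omega (snd z) \<and>
          a = comp Omega (fst z) (snd z)"
    then obtain t where "z = ((p, t), (t, q))" "p \<le> t" "t - p = m"
      by (cases z) (auto simp: Omega_def a(1))
    moreover from this have "t = p + m"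
      by (auto simp: vec_eq_iff less_eq_vec_def) (metis le_add_diff_inverse)
    ultimately show "z = ((p, p + m), (p + m, q))" by simp
  qed (auto simp: Omega_def a(1) q less_eq_vec_def vec_eq_iff)
next
  show "countable (mor (Omega :: (_, 'k) kgraph))" by (rule countableI_type)
next
  fix a b :: "(nat^'k) \<times> (nat^'k)"
  assume "a \<in> mor Omega" "b \<in> mor Omega" "src Omega a = rng Omega b"
  then show "deg Omega (comp Omega a b) = deg Omega a + deg Omega b"
    by (auto simp: Omega_def less_eq_vec_def vec_eq_iff)
qed (auto simp: Omega_def less_eq_vec_def intro: order_trans)

text \<open>Since objects are identity morphisms, preservation of \<^term>\<open>rng\<close> and \<^term>\<open>src\<close>
  includes preservation of identities.\<close>

definition degree_functor ::
  "('a, 'k::finite) kgraph \<Rightarrow> ('b, 'k) kgraph \<Rightarrow> ('a \<Rightarrow> 'b) \<Rightarrow> bool" where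
  "degree_functor \<Gamma> \<Lambda> x \<longleftrightarrow>
     (\<forall>a\<in>mor \<Gamma>. x a \<in> mor \<Lambda> \<and> rng \<Lambda> (x a) = x (rng \<Gamma> a) \<and> src \<Lambda> (x a) = x (src \<Gamma> a) \<and>
        deg \<Lambda> (x a) = deg \<Gamma> a) \<and>
     (\<forall>a\<in>mor \<Gamma>. \<forall>b\<in>mor \<Gamma>. src \<Gamma> a = rng \<Gamma> b \<longrightarrow> x (comp \<Gamma> a b) = comp \<Lambda> (x a) (x b))"

type_synonym ('a, 'k) ipath = "(nat^'k) \<times> (nat^'k) \<Rightarrow> 'a"

text \<open>Infinite paths take the value \<^term>\<open>undefined\<close> off \<^term>\<open>Omega\<close>, so that equality
  of HOL functions is equality of functors.\<close>

definition inf_paths :: "('a, 'k::finite) kgraph \<Rightarrow> ('a, 'k) ipath set" where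
  "inf_paths \<Lambda> = {x \<in> extensional (mor Omega). degree_functor Omega \<Lambda> x}"

definition ip_rng :: "('a, 'k::finite) ipath \<Rightarrow> 'a" where
  "ip_rng x = x (0, 0)"

definition shift :: "nat^'k \<Rightarrow> ('a, 'k::finite) ipath \<Rightarrow> ('a, 'k) ipath" where
  "shift p x = (\<lambda>(m, n). x (m + p, n + p))"

definition prepend ::
  "('a, 'k::finite) kgraph \<Rightarrow> 'a \<Rightarrow> ('a, 'k) ipath \<Rightarrow> ('a, 'k) ipath" where
  "prepend \<Lambda> a x = (THE y. y \<in> inf_paths \<Lambda> \<and> y (0, deg \<Lambda> a) = a \<and> shift (deg \<Lambda> a) y = x)"

definition zdiff :: "nat^'k \<Rightarrow> nat^'k \<Rightarrow> int^'k::finite" where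
  "zdiff l m = (\<chi> i. int (l $ i) - int (m $ i))"

type_synonym ('a, 'k) gpd = "('a, 'k) ipath \<times> (int^'k) \<times> ('a, 'k) ipath"

definition kgroupoid :: "('a, 'k::finite) kgraph \<Rightarrow> ('a, 'k) gpd set" where
  "kgroupoid \<Lambda> = {(x, n, y). x \<in> inf_paths \<Lambda> \<and> y \<in> inf_paths \<Lambda> \<and>
                     (\<exists>l m. n = zdiff l m \<and> shift l x = shift m y)}"

definition g_rng :: "('a, 'k::finite) gpd \<Rightarrow> ('a, 'k) ipath" where
  "g_rng = (\<lambda>(x, n, y). x)"

definition g_mult :: "('a, 'k::finite) gpd \<Rightarrow> ('a, 'k) gpd \<Rightarrow> ('a, 'k) gpd" where
  "g_mult = (\<lambda>(x, n, y) (y', m, z). (x, n + m, z))"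

definition g_inv :: "('a, 'k::finite) gpd \<Rightarrow> ('a, 'k) gpd" where
  "g_inv = (\<lambda>(x, n, y). (y, - n, x))"

definition g_cocycle :: "('a, 'k::finite) gpd \<Rightarrow> int^'k" where
  "g_cocycle = (\<lambda>(x, n, y). n)"

definition cylinder :: "('a, 'k::finite) kgraph \<Rightarrow> 'a \<Rightarrow> 'a \<Rightarrow> ('a, 'k) gpd set" where
  "cylinder \<Lambda> a b = {(prepend \<Lambda> a x, zdiff (deg \<Lambda> a) (deg \<Lambda> b), prepend \<Lambda> b x) | x.
                       x \<in> inf_paths \<Lambda> \<and> ip_rng x = src \<Lambda> a}"

text \<open>For row-finite graphs without sources the cylinder sets are a basis, not just a subbasis,
  of this topology, and they cover \<^term>\<open>kgroupoid \<Lambda>\<close>.\<close>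

definition kgroupoid_top :: "('a, 'k::finite) kgraph \<Rightarrow> ('a, 'k) gpd topology" where
  "kgroupoid_top \<Lambda> = topology_generated_by
     {cylinder \<Lambda> a b | a b. a \<in> mor \<Lambda> \<and> b \<in> mor \<Lambda> \<and> src \<Lambda> a = src \<Lambda> b}"


section \<open>Complex algebras\<close>

text \<open>
  Complex algebras here are associative but need not have a unit.  They are represented by
  records of type \<^typ>\<open>(complex, 'b) module\<close>; the field \<^const>\<open>one\<close> of such a record is
  never used.
\<close>

definition complex_ring :: "complex ring" where
  "complex_ring = \<lparr>carrier = UNIV, mult = (*), one = 1, zero = 0, add = (+)\<rparr>"

locale complex_algebra = Module.module complex_ring A for A :: "(complex, 'b) module" (structure) +
  assumes mult_closed: "\<lbrakk>x \<in> carrier A; y \<in> carrier A\<rbrakk> \<Longrightarrow> x \<otimes> y \<in> carrier A"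
    and mult_assoc: "\<lbrakk>x \<in> carrier A; y \<in> carrier A; z \<in> carrier A\<rbrakk>
          \<Longrightarrow> (x \<otimes> y) \<otimes> z = x \<otimes> (y \<otimes> z)"
    and mult_distr_left: "\<lbrakk>x \<in> carrier A; y \<in> carrier A; z \<in> carrier A\<rbrakk>
          \<Longrightarrow> (x \<oplus> y) \<otimes> z = x \<otimes> z \<oplus> y \<otimes> z"
    and mult_distr_right: "\<lbrakk>x \<in> carrier A; y \<in> carrier A; z \<in> carrier A\<rbrakk>
          \<Longrightarrow> z \<otimes> (x \<oplus> y) = z \<otimes> x \<oplus> z \<otimes> y"
    and smult_mult_left: "\<lbrakk>x \<in> carrier A; y \<in> carrier A\<rbrakk>
          \<Longrightarrow> (c \<odot> x) \<otimes> y = c \<odot> (x \<otimes> y)"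
    and smult_mult_right: "\<lbrakk>x \<in> carrier A; y \<in> carrier A\<rbrakk>
          \<Longrightarrow> x \<otimes> (c \<odot> y) = c \<odot> (x \<otimes> y)"

definition calg_hom :: "(complex, 'a) module \<Rightarrow> (complex, 'b) module \<Rightarrow> ('a \<Rightarrow> 'b) set" where
  "calg_hom A B = {h \<in> carrier A \<rightarrow> carrier B.
     (\<forall>x\<in>carrier A. \<forall>y\<in>carrier A. h (x \<oplus>\<^bsub>A\<^esub> y) = h x \<oplus>\<^bsub>B\<^esub> h y) \<and>
     (\<forall>x\<in>carrier A. \<forall>y\<in>carrier A. h (x \<otimes>\<^bsub>A\<^esub> y) = h x \<otimes>\<^bsub>B\<^esub> h y) \<and>
     (\<forall>c. \<forall>x\<in>carrier A. h (c \<odot>\<^bsub>A\<^esub> x) = c \<odot>\<^bsub>B\<^esub> h x)}"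

definition calg_isomorphic :: "(complex, 'a) module \<Rightarrow> (complex, 'b) module \<Rightarrow> bool" where
  "calg_isomorphic A B \<longleftrightarrow> (\<exists>h\<in>calg_hom A B. bij_betw h (carrier A) (carrier B))"

definition calg_ideal :: "'b set \<Rightarrow> (complex, 'b) module \<Rightarrow> bool" where
  "calg_ideal I A \<longleftrightarrow> submodule I complex_ring A \<and>
     (\<forall>x\<in>carrier A. \<forall>i\<in>I. x \<otimes>\<^bsub>A\<^esub> i \<in> I \<and> i \<otimes>\<^bsub>A\<^esub> x \<in> I)"

definition calg_quot :: "(complex, 'b) module \<Rightarrow> 'b set \<Rightarrow> (complex, 'b set) module" where
  "calg_quot A I = ring.extend (A Quot I)
     (module.fields (\<lambda>c X. \<Union>x\<in>X. I +>\<^bsub>A\<^esub> (c \<odot>\<^bsub>A\<^esub> x)))"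

text \<open>The free algebra on a set \<open>X\<close>: finitely supported functions on the nonempty words
  over \<open>X\<close>, i.e. formal linear combinations of words, multiplied by concatenation.\<close>

definition free_calg :: "'x set \<Rightarrow> (complex, 'x list \<Rightarrow> complex) module" where
  "free_calg X = \<lparr>carrier = {f. finite {w. f w \<noteq> 0} \<and> {w. f w \<noteq> 0} \<subseteq> lists X - {[]}},
     mult = (\<lambda>f g w. \<Sum>(u, v)\<in>{(u, v). u @ v = w}. f u * g v),
     one = undefined,
     zero = (\<lambda>w. 0),
     add = (\<lambda>f g w. f w + g w),
     smult = (\<lambda>c f w. c * f w)\<rparr>"

definition free_gen :: "'x \<Rightarrow> 'x list \<Rightarrow> complex" where
  "free_gen x = (\<lambda>w. if w = [x] then 1 else 0)"


section \<open>The algebra of the path groupoid\<close>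

definition kg_conv :: "('a, 'k::finite) kgraph \<Rightarrow> (('a, 'k) gpd \<Rightarrow> complex) \<Rightarrow>
    (('a, 'k) gpd \<Rightarrow> complex) \<Rightarrow> (('a, 'k) gpd \<Rightarrow> complex)" where
  "kg_conv \<Lambda> f g = (\<lambda>\<gamma>. if \<gamma> \<in> kgroupoid \<Lambda> then
       (\<Sum>\<^sub>\<infinity>\<alpha>\<in>{\<alpha> \<in> kgroupoid \<Lambda>. g_rng \<alpha> = g_rng \<gamma>}. f \<alpha> * g (g_mult (g_inv \<alpha>) \<gamma>))
     else 0)"

text \<open>Functions on the groupoid are represented by functions that vanish off it.  The sum in
  \<^const>\<open>kg_conv\<close> has only finitely many nonzero terms for \<open>f\<close>, \<open>g\<close> in the algebra.\<close>

definition Cc :: "('a, 'k::finite) kgraph \<Rightarrow> (('a, 'k) gpd \<Rightarrow> complex) set" where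
  "Cc \<Lambda> = {f. {\<gamma>. f \<gamma> \<noteq> 0} \<subseteq> kgroupoid \<Lambda> \<and> continuous_map (kgroupoid_top \<Lambda>) euclidean f \<and>
              compactin (kgroupoid_top \<Lambda>) (kgroupoid_top \<Lambda> closure_of {\<gamma>. f \<gamma> \<noteq> 0})}"

definition locally_constant_map :: "'t topology \<Rightarrow> ('t \<Rightarrow> 'b) \<Rightarrow> bool" where
  "locally_constant_map T f \<longleftrightarrow>
     (\<forall>x\<in>topspace T. \<exists>U. openin T U \<and> x \<in> U \<and> (\<forall>y\<in>U. f y = f x))"

definition A_homog :: "('a, 'k::finite) kgraph \<Rightarrow> int^'k \<Rightarrow> (('a, 'k) gpd \<Rightarrow> complex) set" where
  "A_homog \<Lambda> n = {f \<in> Cc \<Lambda>. {\<gamma>. f \<gamma> \<noteq> 0} \<subseteq> {\<gamma>. g_cocycle \<gamma> = n} \<and>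
                    locally_constant_map (kgroupoid_top \<Lambda>) f}"

definition groupoid_algebra ::
    "('a, 'k::finite) kgraph \<Rightarrow> (complex, ('a, 'k) gpd \<Rightarrow> complex) module" where
  "groupoid_algebra \<Lambda> = \<lparr>
     carrier = {(\<lambda>\<gamma>. \<Sum>f\<in>F. c f * f \<gamma>) | F c. finite F \<and> F \<subseteq> (\<Union>n. A_homog \<Lambda> n)},
     mult = kg_conv \<Lambda>,
     one = undefined,
     zero = (\<lambda>\<gamma>. 0),
     add = (\<lambda>f g \<gamma>. f \<gamma> + g \<gamma>),
     smult = (\<lambda>c f \<gamma>. c * f \<gamma>)\<rparr>"


section \<open>The Kumjian--Pask algebra\<close>

definition pos_paths :: "('a, 'k::finite) kgraph \<Rightarrow> 'a set" where
  "pos_paths \<Lambda> = {a \<in> mor \<Lambda>. deg \<Lambda> a \<noteq> 0}"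

text \<open>\<open>P v\<close>, \<open>S a\<close> and \<open>T a\<close> stand for \<open>P\<^sub>v\<close>, \<open>S\<^sub>a\<close> and \<open>S\<close> of the ghost path of \<open>a\<close>.\<close>

definition KP_family :: "('a, 'k::finite) kgraph \<Rightarrow> (complex, 'b) module \<Rightarrow>
    ('a \<Rightarrow> 'b) \<Rightarrow> ('a \<Rightarrow> 'b) \<Rightarrow> ('a \<Rightarrow> 'b) \<Rightarrow> bool" where
  "KP_family \<Lambda> B P S T \<longleftrightarrow>
     P \<in> verts \<Lambda> \<rightarrow> carrier B \<and> S \<in> pos_paths \<Lambda> \<rightarrow> carrier B \<and> T \<in> pos_paths \<Lambda> \<rightarrow> carrier B \<and>
     \<comment> \<open>KP1\<close>
     (\<forall>v\<in>verts \<Lambda>. \<forall>w\<in>verts \<Lambda>. P v \<otimes>\<^bsub>B\<^esub> P w = (if v = w then P v else \<zero>\<^bsub>B\<^esub>)) \<and>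
     \<comment> \<open>KP2\<close>
     (\<forall>a\<in>pos_paths \<Lambda>. \<forall>b\<in>pos_paths \<Lambda>. src \<Lambda> a = rng \<Lambda> b \<longrightarrow>
        S a \<otimes>\<^bsub>B\<^esub> S b = S (comp \<Lambda> a b) \<and> T b \<otimes>\<^bsub>B\<^esub> T a = T (comp \<Lambda> a b)) \<and>
     (\<forall>a\<in>pos_paths \<Lambda>.
        P (rng \<Lambda> a) \<otimes>\<^bsub>B\<^esub> S a = S a \<and> S a \<otimes>\<^bsub>B\<^esub> P (src \<Lambda> a) = S a \<and>
        P (src \<Lambda> a) \<otimes>\<^bsub>B\<^esub> T a = T a \<and> T a \<otimes>\<^bsub>B\<^esub> P (rng \<Lambda> a) = T a) \<and>
     \<comment> \<open>KP3\<close>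
     (\<forall>a\<in>pos_paths \<Lambda>. \<forall>b\<in>pos_paths \<Lambda>. deg \<Lambda> a = deg \<Lambda> b \<longrightarrow>
        T a \<otimes>\<^bsub>B\<^esub> S b = (if a = b then P (src \<Lambda> a) else \<zero>\<^bsub>B\<^esub>)) \<and>
     \<comment> \<open>KP4\<close>
     (\<forall>v\<in>verts \<Lambda>. \<forall>n. n \<noteq> 0 \<longrightarrow>
        P v = (\<Oplus>\<^bsub>B\<^esub>a\<in>paths_from \<Lambda> v n. S a \<otimes>\<^bsub>B\<^esub> T a))"

datatype 'a kp_symbol = Vertex 'a | Path 'a | Ghost 'a

definition kp_symbols :: "('a, 'k::finite) kgraph \<Rightarrow> 'a kp_symbol set" where
  "kp_symbols \<Lambda> = Vertex ` verts \<Lambda> \<union> Path ` pos_paths \<Lambda> \<union> Ghost ` pos_paths \<Lambda>"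

abbreviation kp_free :: "('a, 'k::finite) kgraph \<Rightarrow> (complex, 'a kp_symbol list \<Rightarrow> complex) module"
  where "kp_free \<Lambda> \<equiv> free_calg (kp_symbols \<Lambda>)"

text \<open>The quotient of the free algebra on the symbols by the smallest ideal modulo which the
  generators satisfy the Kumjian--Pask relations, i.e. by the ideal generated by these
  relations.\<close>

definition kp_ideal :: "('a, 'k::finite) kgraph \<Rightarrow> ('a kp_symbol list \<Rightarrow> complex) set" where
  "kp_ideal \<Lambda> = \<Inter>{I. calg_ideal I (kp_free \<Lambda>) \<and>
     KP_family \<Lambda> (calg_quot (kp_free \<Lambda>) I)
       (\<lambda>v. I +>\<^bsub>kp_free \<Lambda>\<^esub> free_gen (Vertex v))
       (\<lambda>a. I +>\<^bsub>kp_free \<Lambda>\<^esub> free_gen (Path a))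
       (\<lambda>a. I +>\<^bsub>kp_free \<Lambda>\<^esub> free_gen (Ghost a))}"

definition kumjian_pask ::
    "('a, 'k::finite) kgraph \<Rightarrow> (complex, ('a kp_symbol list \<Rightarrow> complex) set) module" where
  "kumjian_pask \<Lambda> = calg_quot (kp_free \<Lambda>) (kp_ideal \<Lambda>)"


section \<open>Universal property of the Kumjian--Pask algebra\<close>

text \<open>
  The rest of this theory justifies the construction above: the Kumjian--Pask algebra is a
  complex algebra, it contains a Kumjian--Pask family (\<open>kumjian_pask_family\<close>), and every such
  family in a complex algebra factors uniquely through it (\<open>kumjian_pask_universal\<close>).
\<close>

lemma cring_complex_ring: "cring complex_ring"
proof (rule cringI)
  show "abelian_group complex_ring"
    by (rule abelian_groupI) (auto simp: complex_ring_def intro: exI[of _ "- x" for x])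
  show "Group.comm_monoid complex_ring"
    by (rule comm_monoidI) (auto simp: complex_ring_def)
qed (auto simp: complex_ring_def algebra_simps)

lemma complex_ring_simps [simp]:
  "carrier complex_ring = UNIV" "mult complex_ring = (*)" "one complex_ring = 1"
  "zero complex_ring = 0" "add complex_ring = (+)"
  by (simp_all add: complex_ring_def)

lemma complex_algebraI:
  fixes A :: "(complex, 'b) module" (structure)
  assumes "abelian_group A"
    and "\<And>c x. x \<in> carrier A \<Longrightarrow> c \<odot> x \<in> carrier A"
    and "\<And>c d x. x \<in> carrier A \<Longrightarrow> (c + d) \<odot> x = c \<odot> x \<oplus> d \<odot> x"
    and "\<And>c x y. \<lbrakk>x \<in> carrier A; y \<in> carrier A\<rbrakk> \<Longrightarrow> c \<odot> (x \<oplus> y) = c \<odot> x \<oplus> c \<odot> y"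
    and "\<And>c d x. x \<in> carrier A \<Longrightarrow> (c * d) \<odot> x = c \<odot> (d \<odot> x)"
    and "\<And>x. x \<in> carrier A \<Longrightarrow> 1 \<odot> x = x"
    and "complex_algebra_axioms A"
  shows "complex_algebra A"
  by (intro complex_algebra.intro moduleI cring_complex_ring) (use assms in auto)

lemma free_conv_finite: "finite {(u, v). u @ v = (w :: 'x list)}"
proof -
  have "(a, b) \<in> (\<lambda>i. (take i w, drop i w)) ` {..length w}" if "a @ b = w" for a b
    by (rule image_eqI[where x = "length a"]) (use that in auto)
  then have "{(u, v). u @ v = w} \<subseteq> (\<lambda>i. (take i w, drop i w)) ` {..length w}"
    by auto
  then show ?thesis using finite_subset by blast
qed

lemma complex_algebra_free: "complex_algebra (free_calg X)"
proof (rule complex_algebraI)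
  let ?F = "free_calg X"
  show "abelian_group ?F"
  proof (rule abelian_groupI)
    fix f g assume "f \<in> carrier ?F" "g \<in> carrier ?F"
    then have "finite ({w. f w \<noteq> 0} \<union> {w. g w \<noteq> 0})" 
         "{w. f w \<noteq> 0} \<union> {w. g w \<noteq> 0} \<subseteq> lists X - {[]}"
      by (auto simp: free_calg_def)
    moreover have "{w. f w + g w \<noteq> 0} \<subseteq> {w. f w \<noteq> 0} \<union> {w. g w \<noteq> 0}" by auto
    ultimately show "f \<oplus>\<^bsub>?F\<^esub> g \<in> carrier ?F"
      by (auto simp: free_calg_def intro: finite_subset)
  next
    fix f assume f: "f \<in> carrier ?F"
    show "\<exists>g\<in>carrier ?F. g \<oplus>\<^bsub>?F\<^esub> f = \<zero>\<^bsub>?F\<^esub>"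
      by (rule bexI[of _ "\<lambda>w. - f w"]) (use f in \<open>auto simp: free_calg_def\<close>)
  qed (auto simp: free_calg_def algebra_simps)
  show "c \<odot>\<^bsub>?F\<^esub> f \<in> carrier ?F" if "f \<in> carrier ?F" for c f
  proof -
    have "{w. c * f w \<noteq> 0} \<subseteq> {w. f w \<noteq> 0}" by auto
    with that show ?thesis by (auto simp: free_calg_def intro: finite_subset)
  qed
  show "complex_algebra_axioms ?F"
  proof
    fix f g assume fg: "f \<in> carrier ?F" "g \<in> carrier ?F"
    have sub: "{w. (f \<otimes>\<^bsub>?F\<^esub> g) w \<noteq> 0} \<subseteq> (\<lambda>(u, v). u @ v) ` ({w. f w \<noteq> 0} \<times> {w. g w \<noteq> 0})"
    proof
      fix w assume "w \<in> {w. (f \<otimes>\<^bsub>?F\<^esub> g) w \<noteq> 0}"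
      then have "(\<Sum>(u, v)\<in>{(u, v). u @ v = w}. f u * g v) \<noteq> 0" by (simp add: free_calg_def)
      then obtain p where "p \<in> {(u, v). u @ v = w}" "(case p of (u, v) \<Rightarrow> f u * g v) \<noteq> 0"
        by (rule sum.not_neutral_contains_not_neutral)
      then show "w \<in> (\<lambda>(u, v). u @ v) ` ({w. f w \<noteq> 0} \<times> {w. g w \<noteq> 0})" by force
    qed
    also have "\<dots> \<subseteq> lists X - {[]}"
    proof
      fix w assume "w \<in> (\<lambda>(u, v). u @ v) ` ({w. f w \<noteq> 0} \<times> {w. g w \<noteq> 0})"
      then obtain a b where "w = a @ b" "f a \<noteq> 0" "g b \<noteq> 0" by auto
      moreover from this have "a \<in> lists X - {[]}" "b \<in> lists X - {[]}"
        using fg by (auto simp: free_calg_def)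
      ultimately show "w \<in> lists X - {[]}" by auto
    qed
    finally have "{w. (f \<otimes>\<^bsub>?F\<^esub> g) w \<noteq> 0} \<subseteq> lists X - {[]}" .
    moreover have "finite {w. (f \<otimes>\<^bsub>?F\<^esub> g) w \<noteq> 0}"
      by (rule finite_subset[OF sub]) (use fg in \<open>auto simp: free_calg_def\<close>)
    ultimately show "f \<otimes>\<^bsub>?F\<^esub> g \<in> carrier ?F" by (simp add: free_calg_def)
  next
    fix f g h :: "'a list \<Rightarrow> complex"
    have "(\<Sum>(x, c)\<in>{(x, c). x @ c = w}. (\<Sum>(a, b)\<in>{(a, b). a @ b = x}. f a * g b) * h c) =
          (\<Sum>(a, y)\<in>{(a, y). a @ y = w}. f a * (\<Sum>(b, c)\<in>{(b, c). b @ c = y}. g b * h c))" for w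
    proof -
      have "(\<Sum>(x, c)\<in>{(x, c). x @ c = w}. (\<Sum>(a, b)\<in>{(a, b). a @ b = x}. f a * g b) * h c) =
        (\<Sum>p\<in>{(x, c). x @ c = w}. \<Sum>q\<in>{(a, b). a @ b = fst p}. f (fst q) * g (snd q) * h (snd p))"
        by (simp add: case_prod_unfold sum_distrib_right)
      also have "\<dots> = (\<Sum>(p, q)\<in>(SIGMA p:{(x, c). x @ c = w}. {(a, b). a @ b = fst p}).
           f (fst q) * g (snd q) * h (snd p))"
        by (subst sum.Sigma) (auto simp: free_conv_finite)
      also have "\<dots> = (\<Sum>(p, q)\<in>(SIGMA p:{(a, y). a @ y = w}. {(b, c). b @ c = snd p}).
           f (fst p) * (g (fst q) * h (snd q)))"
        by (rule sum.reindex_bij_witness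
              [where i = "\<lambda>((a, y), (b, c)). ((a @ b, c), (a, b))"
                 and j = "\<lambda>((x, c), (a, b)). ((a, b @ c), (b, c))"])
           (auto simp: mult.assoc)
      also have "\<dots> = (\<Sum>p\<in>{(a, y). a @ y = w}. \<Sum>q\<in>{(b, c). b @ c = snd p}.
           f (fst p) * (g (fst q) * h (snd q)))"
        by (subst sum.Sigma) (auto simp: free_conv_finite)
      finally show ?thesis
        by (simp add: case_prod_unfold sum_distrib_left)
    qed
    then show "f \<otimes>\<^bsub>?F\<^esub> g \<otimes>\<^bsub>?F\<^esub> h = f \<otimes>\<^bsub>?F\<^esub> (g \<otimes>\<^bsub>?F\<^esub> h)"
      by (simp add: free_calg_def)
  next
    fix f g h :: "'a list \<Rightarrow> complex" and c :: complex
    show "(f \<oplus>\<^bsub>?F\<^esub> g) \<otimes>\<^bsub>?F\<^esub> h = f \<otimes>\<^bsub>?F\<^esub> h \<oplus>\<^bsub>?F\<^esub> g \<otimes>\<^bsub>?F\<^esub> h"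
      "h \<otimes>\<^bsub>?F\<^esub> (f \<oplus>\<^bsub>?F\<^esub> g) = h \<otimes>\<^bsub>?F\<^esub> f \<oplus>\<^bsub>?F\<^esub> h \<otimes>\<^bsub>?F\<^esub> g"
      by (simp_all add: free_calg_def case_prod_unfold ring_distribs sum.distrib)
    show "(c \<odot>\<^bsub>?F\<^esub> f) \<otimes>\<^bsub>?F\<^esub> g = c \<odot>\<^bsub>?F\<^esub> (f \<otimes>\<^bsub>?F\<^esub> g)"
      "f \<otimes>\<^bsub>?F\<^esub> (c \<odot>\<^bsub>?F\<^esub> g) = c \<odot>\<^bsub>?F\<^esub> (f \<otimes>\<^bsub>?F\<^esub> g)"
      by (simp_all add: free_calg_def case_prod_unfold sum_distrib_left mult_ac)
  qed
qed (auto simp: free_calg_def algebra_simps)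

locale calg_quotient = complex_algebra +
  fixes I
  assumes ideal: "calg_ideal I A"
begin

sublocale abelian_subgroup I A
  by (rule abelian_subgroupI2)
     (use ideal a_comm_group in \<open>auto simp: calg_ideal_def submodule_def\<close>)

lemma mult_ideal: "\<lbrakk>x \<in> carrier A; i \<in> I\<rbrakk> \<Longrightarrow> x \<otimes> i \<in> I \<and> i \<otimes> x \<in> I"
  using ideal by (auto simp: calg_ideal_def)

lemma smult_ideal: "i \<in> I \<Longrightarrow> c \<odot> i \<in> I"
  using ideal by (auto simp: calg_ideal_def submodule_def submodule_axioms_def)

lemma coset_self: "x \<in> carrier A \<Longrightarrow> x \<in> I +> x"
  by (rule a_rcos_self)

lemma mem_coset: "y \<in> I +> x \<longleftrightarrow> (\<exists>i\<in>I. y = i \<oplus> x)"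
  by (simp add: a_r_coset_def r_coset_def) 

lemma coset_eqI:
  assumes "x \<in> carrier A" "i \<in> I"
  shows "I +> (i \<oplus> x) = I +> x"
  using a_repr_independence[of "i \<oplus> x" I x] a_subgroup assms by (auto simp: mem_coset)

lemma quot_simps:
  "carrier (calg_quot A I) = {I +> x | x. x \<in> carrier A}"
  "\<zero>\<^bsub>calg_quot A I\<^esub> = I +> \<zero>"
  "\<lbrakk>x \<in> carrier A; y \<in> carrier A\<rbrakk> \<Longrightarrow> (I +> x) \<oplus>\<^bsub>calg_quot A I\<^esub> (I +> y) = I +> (x \<oplus> y)"
  "\<lbrakk>x \<in> carrier A; y \<in> carrier A\<rbrakk> \<Longrightarrow> (I +> x) \<otimes>\<^bsub>calg_quot A I\<^esub> (I +> y) = I +> (x \<otimes> y)"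
  "x \<in> carrier A \<Longrightarrow> c \<odot>\<^bsub>calg_quot A I\<^esub> (I +> x) = I +> (c \<odot> x)"
proof -
  have simps: "carrier (calg_quot A I) = a_rcosets I" "\<zero>\<^bsub>calg_quot A I\<^esub> = I"
    "add (calg_quot A I) = set_add A" "mult (calg_quot A I) = rcoset_mult A I"
    "smult (calg_quot A I) = (\<lambda>c X. \<Union>x\<in>X. I +> (c \<odot> x))"
    by (simp_all add: calg_quot_def FactRing_def ring.defs module.defs)
  show "carrier (calg_quot A I) = {I +> x | x. x \<in> carrier A}"
    by (auto simp: simps A_RCOSETS_def RCOSETS_def a_r_coset_def)
  show "\<zero>\<^bsub>calg_quot A I\<^esub> = I +> \<zero>"
    using a_subset by (auto simp: simps mem_coset)
  assume x: "x \<in> carrier A"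
  have "I +> (c \<odot> (i \<oplus> x)) = I +> (c \<odot> x)" if i: "i \<in> I" for i
    using x i a_subset by (subst smult_r_distr) (auto intro!: coset_eqI simp: smult_ideal)
  then have "(\<Union>y\<in>I +> x. I +> (c \<odot> y)) = I +> (c \<odot> x)"
    by (intro SUP_eq_const) (use coset_self[OF x] in blast, auto simp: mem_coset)
  then show "c \<odot>\<^bsub>calg_quot A I\<^esub> (I +> x) = I +> (c \<odot> x)"
    by (simp add: simps)
  assume y: "y \<in> carrier A"
  show "(I +> x) \<oplus>\<^bsub>calg_quot A I\<^esub> (I +> y) = I +> (x \<oplus> y)"
    using x y by (simp add: simps a_rcos_sum)
  have "I +> ((i \<oplus> x) \<otimes> (j \<oplus> y)) = I +> (x \<otimes> y)" if ij: "i \<in> I" "j \<in> I" for i j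
  proof -
    have c: "i \<in> carrier A" "j \<in> carrier A" using ij by auto
    have "(i \<oplus> x) \<otimes> (j \<oplus> y) = (i \<otimes> (j \<oplus> y)) \<oplus> (x \<otimes> j \<oplus> x \<otimes> y)"
      using c x y by (simp add: mult_distr_left mult_distr_right mult_closed a_ac)
    also have "\<dots> = ((i \<otimes> (j \<oplus> y)) \<oplus> x \<otimes> j) \<oplus> x \<otimes> y"
      using c x y by (simp add: a_assoc mult_closed)
    finally show ?thesis
      using c x y ij by (simp only:, intro coset_eqI) (auto simp: mult_closed mult_ideal)
  qed
  then have "I +> (x' \<otimes> y') = I +> (x \<otimes> y)" if "x' \<in> I +> x" "y' \<in> I +> y" for x' y'
    using that by (auto simp: mem_coset)
  moreover have "I +> x \<noteq> {}" "I +> y \<noteq> {}"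
    using coset_self[OF x] coset_self[OF y] by blast+
  ultimately have "(\<Union>x'\<in>I +> x. \<Union>y'\<in>I +> y. I +> (x' \<otimes> y')) = I +> (x \<otimes> y)"
    by (intro SUP_eq_const)
  then show "(I +> x) \<otimes>\<^bsub>calg_quot A I\<^esub> (I +> y) = I +> (x \<otimes> y)"
    by (simp add: simps rcoset_mult_def)
qed

lemma coset_eq_iff:
  assumes "x \<in> carrier A" "y \<in> carrier A"
  shows "I +> x = I +> y \<longleftrightarrow> x \<ominus> y \<in> I"
proof
  assume "I +> x = I +> y"
  then obtain i where "i \<in> I" "x = i \<oplus> y"
    using coset_self[OF assms(1)] by (auto simp: mem_coset)
  then show "x \<ominus> y \<in> I" using assms by (simp add: minus_eq a_assoc r_neg)
next
  assume "x \<ominus> y \<in> I"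
  moreover have "x = (x \<ominus> y) \<oplus> y" using assms by (simp add: minus_eq a_assoc l_neg)
  ultimately show "I +> x = I +> y" using coset_eqI assms by metis
qed

lemma complex_algebra_quot: "complex_algebra (calg_quot A I)"
proof (rule complex_algebraI)
  let ?Q = "calg_quot A I"
  note q = quot_simps
  show "abelian_group ?Q"
  proof (rule abelian_groupI)
    fix X assume "X \<in> carrier ?Q"
    then obtain x where "X = I +> x" "x \<in> carrier A" by (auto simp: q)
    then show "\<exists>Y\<in>carrier ?Q. Y \<oplus>\<^bsub>?Q\<^esub> X = \<zero>\<^bsub>?Q\<^esub>"
      by (intro bexI[of _ "I +> (\<ominus> x)"]) (auto simp: q l_neg)
  qed (auto simp: q a_ac)
  show "complex_algebra_axioms ?Q"
    by standard
       (auto simp: q mult_closed mult_assoc mult_distr_left mult_distr_right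
          smult_mult_left smult_mult_right)
qed (use smult_l_distr smult_r_distr smult_assoc1 smult_one in \<open>auto simp: quot_simps\<close>)

lemma coset_hom: "(\<lambda>x. I +> x) \<in> calg_hom A (calg_quot A I)"
  by (auto simp: calg_hom_def quot_simps)

end

lemma hom_zero:
  assumes "complex_algebra A" "complex_algebra B" "h \<in> calg_hom A B"
  shows "h \<zero>\<^bsub>A\<^esub> = \<zero>\<^bsub>B\<^esub>"
proof -
  interpret A: complex_algebra A by fact
  interpret B: complex_algebra B by fact
  have z: "h \<zero>\<^bsub>A\<^esub> \<in> carrier B"
    using assms(3) A.zero_closed by (auto simp: calg_hom_def)
  have "h \<zero>\<^bsub>A\<^esub> = h (0 \<odot>\<^bsub>A\<^esub> \<zero>\<^bsub>A\<^esub>)"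
    using A.smult_l_null[of "\<zero>\<^bsub>A\<^esub>"] A.zero_closed by simp
  also have "\<dots> = 0 \<odot>\<^bsub>B\<^esub> h \<zero>\<^bsub>A\<^esub>"
    using assms(3) A.zero_closed unfolding calg_hom_def by blast
  finally show ?thesis using B.smult_l_null[OF z] by simp
qed

lemma hom_finsum:
  assumes "complex_algebra A" "complex_algebra B" "h \<in> calg_hom A B" "f \<in> S \<rightarrow> carrier A"
  shows "h (\<Oplus>\<^bsub>A\<^esub>s\<in>S. f s) = (\<Oplus>\<^bsub>B\<^esub>s\<in>S. h (f s))"
proof -
  interpret A: complex_algebra A by fact
  interpret B: complex_algebra B by fact
  show ?thesis
  proof (cases "finite S")
    case True
    then show ?thesis using assms(4)
    proof (induction S)
      case (insert s S)
      have "h \<in> carrier A \<rightarrow> carrier B" using assms(3) by (auto simp: calg_hom_def)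
      with insert have "(\<lambda>s. h (f s)) \<in> insert s S \<rightarrow> carrier B" by auto
      with insert show ?case
        using assms(3) by (auto simp: calg_hom_def Pi_def)
    qed (simp add: hom_zero[OF assms(1-3)])
  qed (simp add: hom_zero[OF assms(1-3)] A.finsum_infinite B.finsum_infinite)
qed

text \<open>The pairs of elements which have to be equal in a Kumjian--Pask family.\<close>

inductive_set KP_rels for \<Lambda> :: "('a, 'k::finite) kgraph" and A :: "(complex, 'b) module" and P S T where
  "\<lbrakk>v \<in> verts \<Lambda>; w \<in> verts \<Lambda>\<rbrakk> \<Longrightarrow>
     (P v \<otimes>\<^bsub>A\<^esub> P w, if v = w then P v else \<zero>\<^bsub>A\<^esub>) \<in> KP_rels \<Lambda> A P S T"
| "\<lbrakk>a \<in> pos_paths \<Lambda>; b \<in> pos_paths \<Lambda>; src \<Lambda> a = rng \<Lambda> b\<rbrakk> \<Longrightarrow>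
     (S a \<otimes>\<^bsub>A\<^esub> S b, S (comp \<Lambda> a b)) \<in> KP_rels \<Lambda> A P S T"
| "\<lbrakk>a \<in> pos_paths \<Lambda>; b \<in> pos_paths \<Lambda>; src \<Lambda> a = rng \<Lambda> b\<rbrakk> \<Longrightarrow>
     (T b \<otimes>\<^bsub>A\<^esub> T a, T (comp \<Lambda> a b)) \<in> KP_rels \<Lambda> A P S T"
| "a \<in> pos_paths \<Lambda> \<Longrightarrow> (P (rng \<Lambda> a) \<otimes>\<^bsub>A\<^esub> S a, S a) \<in> KP_rels \<Lambda> A P S T"
| "a \<in> pos_paths \<Lambda> \<Longrightarrow> (S a \<otimes>\<^bsub>A\<^esub> P (src \<Lambda> a), S a) \<in> KP_rels \<Lambda> A P S T"
| "a \<in> pos_paths \<Lambda> \<Longrightarrow> (P (src \<Lambda> a) \<otimes>\<^bsub>A\<^esub> T a, T a) \<in> KP_rels \<Lambda> A P S T"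
| "a \<in> pos_paths \<Lambda> \<Longrightarrow> (T a \<otimes>\<^bsub>A\<^esub> P (rng \<Lambda> a), T a) \<in> KP_rels \<Lambda> A P S T"
| "\<lbrakk>a \<in> pos_paths \<Lambda>; b \<in> pos_paths \<Lambda>; deg \<Lambda> a = deg \<Lambda> b\<rbrakk> \<Longrightarrow>
     (T a \<otimes>\<^bsub>A\<^esub> S b, if a = b then P (src \<Lambda> a) else \<zero>\<^bsub>A\<^esub>) \<in> KP_rels \<Lambda> A P S T"
| "\<lbrakk>v \<in> verts \<Lambda>; n \<noteq> 0\<rbrakk> \<Longrightarrow>
     (P v, \<Oplus>\<^bsub>A\<^esub>a\<in>paths_from \<Lambda> v n. S a \<otimes>\<^bsub>A\<^esub> T a) \<in> KP_rels \<Lambda> A P S T"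

lemma (in k_graph) pos_paths_closed:
  assumes "a \<in> pos_paths \<Lambda>"
  shows "rng \<Lambda> a \<in> verts \<Lambda>" "src \<Lambda> a \<in> verts \<Lambda>"
    "b \<in> pos_paths \<Lambda> \<Longrightarrow> src \<Lambda> a = rng \<Lambda> b \<Longrightarrow> comp \<Lambda> a b \<in> pos_paths \<Lambda>"
  using assms unfolding verts_eq_identities pos_paths_def
  by (auto simp: rng_mor src_mor rng_rng rng_src comp_mor deg_comp vec_eq_iff)

lemma (in k_graph) KP_rels_carrier:
  assumes "complex_algebra A" 
    and "P \<in> verts \<Lambda> \<rightarrow> carrier A" "S \<in> pos_paths \<Lambda> \<rightarrow> carrier A" "T \<in> pos_paths \<Lambda> \<rightarrow> carrier A"
    and "(x, y) \<in> KP_rels \<Lambda> A P S T"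
  shows "x \<in> carrier A" "y \<in> carrier A"
proof -
  interpret complex_algebra A by fact
  have "x \<in> carrier A \<and> y \<in> carrier A"
    using assms(5)
  proof cases
    case (9 v n)
    then have "paths_from \<Lambda> v n \<subseteq> pos_paths \<Lambda>" by (auto simp: paths_from_def pos_paths_def)
    then have "(\<lambda>a. S a \<otimes>\<^bsub>A\<^esub> T a) \<in> paths_from \<Lambda> v n \<rightarrow> carrier A"
      using assms(3,4) by (auto intro!: mult_closed)
    then show ?thesis using 9 assms(2) by (auto intro: finsum_closed)
  qed (use assms(2-4) pos_paths_closed in \<open>auto simp: Pi_def mult_closed\<close>)
  then show "x \<in> carrier A" "y \<in> carrier A" by auto
qed

lemma KP_family_iff:
  fixes \<Lambda> :: "('a, 'b::finite) kgraph"
  assumes "k_graph \<Lambda>" "complex_algebra A" "complex_algebra B" "h \<in> calg_hom A B"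
    and c: "P \<in> verts \<Lambda> \<rightarrow> carrier A" "S \<in> pos_paths \<Lambda> \<rightarrow> carrier A" "T \<in> pos_paths \<Lambda> \<rightarrow> carrier A"
  shows "KP_family \<Lambda> B (\<lambda>v. h (P v)) (\<lambda>a. h (S a)) (\<lambda>a. h (T a)) \<longleftrightarrow>
    (\<forall>(x, y)\<in>KP_rels \<Lambda> A P S T. h x = h y)"
proof -
  interpret k_graph \<Lambda> by fact
  interpret A: complex_algebra A by fact
  interpret B: complex_algebra B by fact
  have hm: "h (x \<otimes>\<^bsub>A\<^esub> y) = h x \<otimes>\<^bsub>B\<^esub> h y" if "x \<in> carrier A" "y \<in> carrier A" for x y
    using assms(4) that by (auto simp: calg_hom_def)
  have hc: "h x \<in> carrier B" if "x \<in> carrier A" for x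
    using assms(4) that by (auto simp: calg_hom_def)
  have h0: "h \<zero>\<^bsub>A\<^esub> = \<zero>\<^bsub>B\<^esub>" by (rule hom_zero) fact+
  have cP: "P v \<in> carrier A" if "v \<in> verts \<Lambda>" for v using c that by auto
  have cS: "S v \<in> carrier A" "T v \<in> carrier A" if "v \<in> pos_paths \<Lambda>" for v using c that by auto
  note simps = hm hc cP cS pos_paths_closed
  have fs: "h (\<Oplus>\<^bsub>A\<^esub>a\<in>paths_from \<Lambda> v n. S a \<otimes>\<^bsub>A\<^esub> T a) = (\<Oplus>\<^bsub>B\<^esub>a\<in>paths_from \<Lambda> v n. h (S a) \<otimes>\<^bsub>B\<^esub> h (T a))"
    if "n \<noteq> 0" for v n
  proof -
    have sub: "paths_from \<Lambda> v n \<subseteq> pos_paths \<Lambda>" using that by (auto simp: paths_from_def pos_paths_def)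
    have "h (\<Oplus>\<^bsub>A\<^esub>a\<in>paths_from \<Lambda> v n. S a \<otimes>\<^bsub>A\<^esub> T a) = (\<Oplus>\<^bsub>B\<^esub>a\<in>paths_from \<Lambda> v n. h (S a \<otimes>\<^bsub>A\<^esub> T a))"
      by (rule hom_finsum) (use assms sub cS in \<open>auto intro!: A.mult_closed\<close>)
    also have "\<dots> = (\<Oplus>\<^bsub>B\<^esub>a\<in>paths_from \<Lambda> v n. h (S a) \<otimes>\<^bsub>B\<^esub> h (T a))"
      by (rule B.finsum_cong') (use sub in \<open>auto simp: simps subsetD intro!: B.mult_closed\<close>)
    finally show ?thesis .
  qed
  show ?thesis
  proof
    assume fam: "KP_family \<Lambda> B (\<lambda>v. h (P v)) (\<lambda>a. h (S a)) (\<lambda>a. h (T a))"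
    have "h x = h y" if "(x, y) \<in> KP_rels \<Lambda> A P S T" for x y
      using that by cases (use fam in \<open>auto simp: KP_family_def simps h0 fs\<close>)
    then show "\<forall>(x, y)\<in>KP_rels \<Lambda> A P S T. h x = h y" by auto
  next
    assume "\<forall>(x, y)\<in>KP_rels \<Lambda> A P S T. h x = h y"
    then have eq: "h x = h y" if "(x, y) \<in> KP_rels \<Lambda> A P S T" for x y using that by auto
    note e = KP_rels.intros[where \<Lambda> = \<Lambda> and A = A and P = P and S = S and T = T, THEN eq]
    show "KP_family \<Lambda> B (\<lambda>v. h (P v)) (\<lambda>a. h (S a)) (\<lambda>a. h (T a))"
      unfolding KP_family_def
    proof (intro conjI ballI allI impI)
      fix v w assume "v \<in> verts \<Lambda>" "w \<in> verts \<Lambda>"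
      with e(1)[OF this] show "h (P v) \<otimes>\<^bsub>B\<^esub> h (P w) = (if v = w then h (P v) else \<zero>\<^bsub>B\<^esub>)"
        by (simp add: simps h0 split: if_splits)
    next
      fix a b assume "a \<in> pos_paths \<Lambda>" "b \<in> pos_paths \<Lambda>" "deg \<Lambda> a = deg \<Lambda> b"
      with e(8)[OF this] show "h (T a) \<otimes>\<^bsub>B\<^esub> h (S b) = (if a = b then h (P (src \<Lambda> a)) else \<zero>\<^bsub>B\<^esub>)"
        by (simp add: simps h0 split: if_splits)
    next
      fix v and n :: "nat^'b" assume "v \<in> verts \<Lambda>" "n \<noteq> 0"
      from trans[OF e(9)[OF this] fs[OF this(2)]]
      show "h (P v) = (\<Oplus>\<^bsub>B\<^esub>a\<in>paths_from \<Lambda> v n. h (S a) \<otimes>\<^bsub>B\<^esub> h (T a))" .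
    qed (use e(2) e(3) e(4) e(5) e(6) e(7) in \<open>auto simp: simps\<close>)
  qed
qed

lemma KP_family_cong:
  fixes \<Lambda> :: "('a, 'b::finite) kgraph"
  assumes "k_graph \<Lambda>" "complex_algebra B" "KP_family \<Lambda> B P S T"
    and "\<And>v. v \<in> verts \<Lambda> \<Longrightarrow> P v = P' v"
    and "\<And>v. v \<in> pos_paths \<Lambda> \<Longrightarrow> S v = S' v" "\<And>v. v \<in> pos_paths \<Lambda> \<Longrightarrow> T v = T' v"
  shows "KP_family \<Lambda> B P' S' T'"
proof -
  interpret k_graph \<Lambda> by fact
  interpret B: complex_algebra B by fact
  have c: "P \<in> verts \<Lambda> \<rightarrow> carrier B" "S \<in> pos_paths \<Lambda> \<rightarrow> carrier B" "T \<in> pos_paths \<Lambda> \<rightarrow> carrier B"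
    using assms(3) unfolding KP_family_def by auto
  have "(\<Oplus>\<^bsub>B\<^esub>a\<in>paths_from \<Lambda> v n. S' a \<otimes>\<^bsub>B\<^esub> T' a) = (\<Oplus>\<^bsub>B\<^esub>a\<in>paths_from \<Lambda> v n. S a \<otimes>\<^bsub>B\<^esub> T a)"
    if "n \<noteq> 0" for v n
  proof -
    have sub: "paths_from \<Lambda> v n \<subseteq> pos_paths \<Lambda>" using that by (auto simp: paths_from_def pos_paths_def)
    show ?thesis by (rule B.finsum_cong') (use sub assms c in \<open>auto intro!: B.mult_closed\<close>)
  qed
  note sums = this
  show ?thesis
    unfolding KP_family_def
  proof (intro conjI allI ballI impI)
    fix v and n :: "nat^'b" assume v: "v \<in> verts \<Lambda>" "n \<noteq> 0"
    have "P v = (\<Oplus>\<^bsub>B\<^esub>a\<in>paths_from \<Lambda> v n. S a \<otimes>\<^bsub>B\<^esub> T a)"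
      using assms(3) v unfolding KP_family_def by blast
    then show "P' v = (\<Oplus>\<^bsub>B\<^esub>a\<in>paths_from \<Lambda> v n. S' a \<otimes>\<^bsub>B\<^esub> T' a)"
      using sums[OF v(2)] assms(4)[OF v(1)] by metis
  qed (use c assms(3) in \<open>simp_all add: KP_family_def assms(4-6)[symmetric] pos_paths_closed Pi_def cong: conj_cong\<close>)
qed

definition word :: "'x list \<Rightarrow> 'x list \<Rightarrow> complex" where
  "word w = (\<lambda>u. if u = w then 1 else 0)"

lemma word_carrier: "w \<in> lists X - {[]} \<Longrightarrow> word w \<in> carrier (free_calg X)"
  by (auto simp: word_def free_calg_def)

lemma word_mult: "word u \<otimes>\<^bsub>free_calg X\<^esub> word v = word (u @ v)"
proof
  fix w
  have "(\<Sum>(a, b)\<in>{(a, b). a @ b = w}. word u a * word v b) =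
        (\<Sum>p\<in>{(a, b). a @ b = w}. if p = (u, v) then 1 else 0)"
    by (rule sum.cong) (auto simp: word_def split: if_splits)
  also have "\<dots> = word (u @ v) w"
    by (subst sum.delta) (auto simp: free_conv_finite word_def)
  finally show "(word u \<otimes>\<^bsub>free_calg X\<^esub> word v) w = word (u @ v) w"
    by (simp add: free_calg_def)
qed

lemma free_gen_word: "free_gen x = word [x]"
  by (simp add: free_gen_def word_def)

lemma free_gen_carrier: "x \<in> X \<Longrightarrow> free_gen x \<in> carrier (free_calg X)"
  unfolding free_gen_word by (rule word_carrier) auto

lemma free_lin_induct [consumes 1, case_names zero word add]:
  assumes f: "f \<in> carrier (free_calg X)"
    and zero: "Q \<zero>\<^bsub>free_calg X\<^esub>"
    and word: "\<And>c w. w \<in> lists X - {[]} \<Longrightarrow> Q (c \<odot>\<^bsub>free_calg X\<^esub> word w)"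
    and add: "\<And>f g. \<lbrakk>f \<in> carrier (free_calg X); g \<in> carrier (free_calg X); Q f; Q g\<rbrakk> \<Longrightarrow> Q (f \<oplus>\<^bsub>free_calg X\<^esub> g)"
  shows "Q f"
proof -
  interpret F: complex_algebra "free_calg X" by (rule complex_algebra_free)
  have "\<forall>f\<in>carrier (free_calg X). {w. f w \<noteq> 0} \<subseteq> S \<longrightarrow> Q f" if "finite S" for S
    using that
  proof (induction S)
    case empty
    have "f = \<zero>\<^bsub>free_calg X\<^esub>" if "{w. f w \<noteq> 0} \<subseteq> {}" for f
      using that by (auto simp: free_calg_def)
    then show ?case using zero by blast
  next
    case (insert u S)
    show ?case
    proof (intro ballI impI)
      fix f assume f: "f \<in> carrier (free_calg X)" "{w. f w \<noteq> 0} \<subseteq> insert u S"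
      let ?f = "f(u := 0)"
      have "{w. ?f w \<noteq> 0} \<subseteq> {w. f w \<noteq> 0}" by auto
      then have f': "?f \<in> carrier (free_calg X)"
        using f(1) by (auto simp: free_calg_def intro: finite_subset)
      have "{w. ?f w \<noteq> 0} \<subseteq> S" using f(2) by auto
      then have Q: "Q ?f" using insert.IH f' by blast
      show "Q f"
      proof (cases "f u = 0")
        case True
        then have "?f = f" by auto
        then show ?thesis using Q by simp
      next
        case False
        then have u: "u \<in> lists X - {[]}" using f(1) by (auto simp: free_calg_def)
        have "f = (f u \<odot>\<^bsub>free_calg X\<^esub> word u) \<oplus>\<^bsub>free_calg X\<^esub> ?f"
          by (auto simp: free_calg_def word_def)
        moreover have "f u \<odot>\<^bsub>free_calg X\<^esub> word u \<in> carrier (free_calg X)"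
          using word_carrier[OF u] by (intro F.smult_closed) auto
        ultimately show ?thesis using add[OF _ f' word[OF u] Q] by metis
      qed
    qed
  qed
  moreover have "finite {w. f w \<noteq> 0}" using f by (simp add: free_calg_def)
  ultimately show ?thesis using f by blast
qed

lemma free_hom_unique:
  assumes B: "complex_algebra B" and h: "h \<in> calg_hom (free_calg X) B" "h' \<in> calg_hom (free_calg X) B"
    and gen: "\<And>x. x \<in> X \<Longrightarrow> h (free_gen x) = h' (free_gen x)"
    and f: "f \<in> carrier (free_calg X)"
  shows "h f = h' f"
proof -
  have w: "h (word w) = h' (word w)" if "w \<in> lists X - {[]}" for w
    using that
  proof (induction w)
    case (Cons x w)
    show ?case
    proof (cases "w = []")
      case True
      then show ?thesis using gen Cons.prems by (simp add: free_gen_word)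
    next
      case False
      with Cons.prems have c: "x \<in> X" "w \<in> lists X - {[]}" by auto
      have "word (x # w) = free_gen x \<otimes>\<^bsub>free_calg X\<^esub> word w"
        by (simp add: free_gen_word word_mult)
      then show ?thesis
        using h gen[OF c(1)] Cons.IH[OF c(2)] free_gen_carrier[OF c(1)] word_carrier[OF c(2)]
        by (simp add: calg_hom_def)
    qed
  qed simp
  show ?thesis using f
  proof (induction rule: free_lin_induct)
    case zero
    show ?case
      using hom_zero[OF complex_algebra_free B h(1)] hom_zero[OF complex_algebra_free B h(2)] by simp
  next
    case (word c u)
    then show ?case using h w[OF word] word_carrier[OF word] by (simp add: calg_hom_def)
  next
    case (add f g)
    then show ?case using h by (simp add: calg_hom_def)
  qed
qed

fun eval_word :: "(complex, 'b) module \<Rightarrow> ('x \<Rightarrow> 'b) \<Rightarrow> 'x list \<Rightarrow> 'b" where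
  "eval_word B g [] = undefined"
| "eval_word B g [x] = g x"
| "eval_word B g (x # y # w) = g x \<otimes>\<^bsub>B\<^esub> eval_word B g (y # w)"

lemma free_hom_exists:
  assumes B: "complex_algebra B" and g: "g \<in> X \<rightarrow> carrier B"
  shows "\<exists>h\<in>calg_hom (free_calg X) B. \<forall>x\<in>X. h (free_gen x) = g x"
proof -
  interpret F: complex_algebra "free_calg X" by (rule complex_algebra_free)
  interpret B: complex_algebra B by fact
  let ?F = "free_calg X"
  define e where "e = eval_word B g"
  have e_Cons: "e (x # w) = g x \<otimes>\<^bsub>B\<^esub> e w" if "w \<noteq> []" for x w
    using that by (cases w) (auto simp: e_def)
  have e_closed: "e w \<in> carrier B" if "w \<in> lists X - {[]}" for w
    using that
  proof (induction w)
    case (Cons x w)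
    then show ?case
      using g B.mult_closed[of "g x" "e w"] by (cases "w = []") (auto simp: e_Cons Pi_def, simp add: e_def)
  qed simp
  have e_append: "e (u @ v) = e u \<otimes>\<^bsub>B\<^esub> e v" if "u \<in> lists X - {[]}" "v \<in> lists X - {[]}" for u v
    using that(1)
  proof (induction u)
    case (Cons x u)
    show ?case
    proof (cases "u = []")
      case True
      have "e [x] = g x" by (simp add: e_def)
      then show ?thesis using True that(2) e_Cons[of v x] by simp
    next
      case False
      with Cons.prems have u: "x \<in> X" "u \<in> lists X - {[]}" by auto
      have "e ((x # u) @ v) = g x \<otimes>\<^bsub>B\<^esub> (e u \<otimes>\<^bsub>B\<^esub> e v)"
        using Cons.IH[OF u(2)] e_Cons[of "u @ v" x] False by simp
      also have "\<dots> = (g x \<otimes>\<^bsub>B\<^esub> e u) \<otimes>\<^bsub>B\<^esub> e v"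
        using B.mult_assoc[of "g x" "e u" "e v"] e_closed[OF u(2)] e_closed[OF that(2)] g u(1) by (auto simp: Pi_def)
      finally show ?thesis using e_Cons[OF False, of x] by simp
    qed
  qed simp
  define h where "h f = (\<Oplus>\<^bsub>B\<^esub>w\<in>{w. f w \<noteq> 0}. f w \<odot>\<^bsub>B\<^esub> e w)" for f
  have h_sup: "h f = (\<Oplus>\<^bsub>B\<^esub>w\<in>S. f w \<odot>\<^bsub>B\<^esub> e w)"
    if "finite S" "{w. f w \<noteq> 0} \<subseteq> S" "S \<subseteq> lists X - {[]}" for f S
    unfolding h_def
  proof (rule B.add.finprod_mono_neutral_cong_left)
    show "f w \<odot>\<^bsub>B\<^esub> e w = \<zero>\<^bsub>B\<^esub>" if "w \<in> S - {w. f w \<noteq> 0}" for w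
      using that \<open>S \<subseteq> _\<close> B.smult_l_null[of "e w"] e_closed[of w] by auto
    show "(\<lambda>w. f w \<odot>\<^bsub>B\<^esub> e w) \<in> S \<rightarrow> carrier B"
      using \<open>S \<subseteq> _\<close> e_closed by (auto intro!: B.smult_closed)
  qed (use that in auto)
  have supp: "finite {w. f w \<noteq> 0}" "{w. f w \<noteq> 0} \<subseteq> lists X - {[]}" if "f \<in> carrier ?F" for f
    using that by (auto simp: free_calg_def)
  have h_closed: "h f \<in> carrier B" if "f \<in> carrier ?F" for f
    unfolding h_def using supp[OF that] e_closed by (intro B.finsum_closed) (auto intro!: B.smult_closed)
  have h_add: "h (f \<oplus>\<^bsub>?F\<^esub> f') = h f \<oplus>\<^bsub>B\<^esub> h f'" if f: "f \<in> carrier ?F" "f' \<in> carrier ?F" for f f'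
  proof -
    let ?S = "{w. f w \<noteq> 0} \<union> {w. f' w \<noteq> 0}"
    have S: "finite ?S" "?S \<subseteq> lists X - {[]}" using supp[OF f(1)] supp[OF f(2)] by blast+
    have "h (f \<oplus>\<^bsub>?F\<^esub> f') = (\<Oplus>\<^bsub>B\<^esub>w\<in>?S. (f \<oplus>\<^bsub>?F\<^esub> f') w \<odot>\<^bsub>B\<^esub> e w)"
      by (rule h_sup[OF S(1) _ S(2)]) (auto simp: free_calg_def)
    also have "\<dots> = (\<Oplus>\<^bsub>B\<^esub>w\<in>?S. f w \<odot>\<^bsub>B\<^esub> e w \<oplus>\<^bsub>B\<^esub> f' w \<odot>\<^bsub>B\<^esub> e w)"
    proof (rule B.finsum_cong')
      fix w assume "w \<in> ?S"
      then have "e w \<in> carrier B" using S(2) e_closed by blast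
      then show "(f \<oplus>\<^bsub>?F\<^esub> f') w \<odot>\<^bsub>B\<^esub> e w = f w \<odot>\<^bsub>B\<^esub> e w \<oplus>\<^bsub>B\<^esub> f' w \<odot>\<^bsub>B\<^esub> e w"
        using B.smult_l_distr[of "f w" "f' w" "e w"] by (simp add: free_calg_def)
    qed (use S(2) e_closed in \<open>auto intro!: B.smult_closed B.a_closed\<close>)
    also have "\<dots> = (\<Oplus>\<^bsub>B\<^esub>w\<in>?S. f w \<odot>\<^bsub>B\<^esub> e w) \<oplus>\<^bsub>B\<^esub> (\<Oplus>\<^bsub>B\<^esub>w\<in>?S. f' w \<odot>\<^bsub>B\<^esub> e w)"
      by (rule B.finsum_addf) (use S(2) e_closed in \<open>auto intro!: B.smult_closed\<close>)
    also have "\<dots> = h f \<oplus>\<^bsub>B\<^esub> h f'"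
      using h_sup[OF S(1) _ S(2), of f] h_sup[OF S(1) _ S(2), of f'] by simp
    finally show ?thesis .
  qed
  have h_smult: "h (c \<odot>\<^bsub>?F\<^esub> f) = c \<odot>\<^bsub>B\<^esub> h f" if f: "f \<in> carrier ?F" for c f
  proof -
    let ?S = "{w. f w \<noteq> 0}"
    note S = supp[OF f]
    have "h (c \<odot>\<^bsub>?F\<^esub> f) = (\<Oplus>\<^bsub>B\<^esub>w\<in>?S. (c \<odot>\<^bsub>?F\<^esub> f) w \<odot>\<^bsub>B\<^esub> e w)"
      by (rule h_sup[OF S(1) _ S(2)]) (auto simp: free_calg_def)
    also have "\<dots> = (\<Oplus>\<^bsub>B\<^esub>w\<in>?S. c \<odot>\<^bsub>B\<^esub> (f w \<odot>\<^bsub>B\<^esub> e w))"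
    proof (rule B.finsum_cong')
      fix w assume "w \<in> ?S"
      then have "e w \<in> carrier B" using S(2) e_closed by blast
      then show "(c \<odot>\<^bsub>?F\<^esub> f) w \<odot>\<^bsub>B\<^esub> e w = c \<odot>\<^bsub>B\<^esub> (f w \<odot>\<^bsub>B\<^esub> e w)"
        using B.smult_assoc1[of c "f w" "e w"] by (simp add: free_calg_def)
    qed (use S(2) e_closed in \<open>auto intro!: B.smult_closed\<close>)
    also have "\<dots> = c \<odot>\<^bsub>B\<^esub> h f"
      unfolding h_def 
      by (rule B.finsum_smult_ldistr[symmetric]) (use S e_closed in \<open>auto intro!: B.smult_closed\<close>)
    finally show ?thesis .
  qed
  have h_word: "h (word w) = e w" if "w \<in> lists X - {[]}" for w
  proof -
    have "h (word w) = (\<Oplus>\<^bsub>B\<^esub>u\<in>{w}. word w u \<odot>\<^bsub>B\<^esub> e u)"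
      by (rule h_sup) (use that in \<open>auto simp: word_def\<close>)
    also have "\<dots> = e w"
      using e_closed[OF that] B.smult_one[of "e w"] by (simp add: word_def)
    finally show ?thesis .
  qed
  have h0: "h \<zero>\<^bsub>?F\<^esub> = \<zero>\<^bsub>B\<^esub>" by (simp add: h_def free_calg_def)
  have h_mult1: "h (word w \<otimes>\<^bsub>?F\<^esub> f) = h (word w) \<otimes>\<^bsub>B\<^esub> h f"
    if w: "w \<in> lists X - {[]}" and f: "f \<in> carrier ?F" for w f
    using f
  proof (induction rule: free_lin_induct)
    case zero
    have "word w \<otimes>\<^bsub>?F\<^esub> \<zero>\<^bsub>?F\<^esub> = \<zero>\<^bsub>?F\<^esub>" by (simp add: free_calg_def)
    moreover have "b \<otimes>\<^bsub>B\<^esub> \<zero>\<^bsub>B\<^esub> = \<zero>\<^bsub>B\<^esub>" if "b \<in> carrier B" for b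
      using B.smult_mult_right[OF that B.zero_closed, of 0] B.mult_closed[OF that B.zero_closed]
        B.smult_l_null[of "b \<otimes>\<^bsub>B\<^esub> \<zero>\<^bsub>B\<^esub>"] B.smult_l_null[OF B.zero_closed] by simp
    ultimately show ?case using h0 h_closed word_carrier[OF w] by simp
  next
    case (word c u)
    have "word w \<otimes>\<^bsub>?F\<^esub> (c \<odot>\<^bsub>?F\<^esub> word u) = c \<odot>\<^bsub>?F\<^esub> word (w @ u)"
      using F.smult_mult_right[OF word_carrier[OF w] word_carrier[OF word]] by (simp add: word_mult)
    moreover have wu: "w @ u \<in> lists X - {[]}" using w word by auto
    moreover have "h (word w) \<otimes>\<^bsub>B\<^esub> (c \<odot>\<^bsub>B\<^esub> h (word u)) = c \<odot>\<^bsub>B\<^esub> (h (word w) \<otimes>\<^bsub>B\<^esub> h (word u))"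
      by (intro B.smult_mult_right h_closed word_carrier w word)
    ultimately show ?case
      using h_word[OF wu] h_word[OF w] h_word[OF word] e_append[OF w word] h_smult[OF word_carrier[OF word], of c] h_smult[OF word_carrier[OF wu], of c]
      by simp
  next
    case (add f g)
    have c: "word w \<otimes>\<^bsub>?F\<^esub> f \<in> carrier ?F" "word w \<otimes>\<^bsub>?F\<^esub> g \<in> carrier ?F"
      using add word_carrier[OF w] F.mult_closed by auto
    show ?case
      using add F.mult_distr_right[OF add(1,2) word_carrier[OF w]] h_add[OF c] h_add[OF add(1,2)]
        B.mult_distr_right[OF h_closed[OF add(1)] h_closed[OF add(2)] h_closed[OF word_carrier[OF w]]]
      by simp
  qed
  have h_mult: "h (f \<otimes>\<^bsub>?F\<^esub> f') = h f \<otimes>\<^bsub>B\<^esub> h f'"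
    if f: "f \<in> carrier ?F" and f': "f' \<in> carrier ?F" for f f'
    using f
  proof (induction rule: free_lin_induct)
    case zero
    have "\<zero>\<^bsub>?F\<^esub> \<otimes>\<^bsub>?F\<^esub> f' = \<zero>\<^bsub>?F\<^esub>" by (simp add: free_calg_def)
    moreover have "\<zero>\<^bsub>B\<^esub> \<otimes>\<^bsub>B\<^esub> b = \<zero>\<^bsub>B\<^esub>" if "b \<in> carrier B" for b
      using B.smult_mult_left[OF B.zero_closed that, of 0] B.mult_closed[OF B.zero_closed that]
        B.smult_l_null[of "\<zero>\<^bsub>B\<^esub> \<otimes>\<^bsub>B\<^esub> b"] B.smult_l_null[OF B.zero_closed] by simp
    ultimately show ?case using h0 h_closed f' by simp
  next
    case (word c u)
    have c: "word u \<in> carrier ?F" "word u \<otimes>\<^bsub>?F\<^esub> f' \<in> carrier ?F"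
      using word_carrier[OF word] F.mult_closed f' by auto
    show ?case
      using F.smult_mult_left[OF c(1) f', of c] h_smult[OF c(1), of c] h_smult[OF c(2), of c]
        h_mult1[OF word f'] B.smult_mult_left[OF h_closed[OF c(1)] h_closed[OF f'], of c]
      by simp
  next
    case (add f g)
    have c: "f \<otimes>\<^bsub>?F\<^esub> f' \<in> carrier ?F" "g \<otimes>\<^bsub>?F\<^esub> f' \<in> carrier ?F"
      using add f' F.mult_closed by auto
    show ?case
      using add F.mult_distr_left[OF add(1,2) f'] h_add[OF c] h_add[OF add(1,2)]
        B.mult_distr_left[OF h_closed[OF add(1)] h_closed[OF add(2)] h_closed[OF f']]
      by simp
  qed
  have "h (free_gen x) = g x" if "x \<in> X" for x
    using h_word[of "[x]"] that by (simp add: free_gen_word e_def)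
  moreover have "h \<in> calg_hom ?F B"
    using h_closed h_add h_smult h_mult by (auto simp: calg_hom_def)
  ultimately show ?thesis by blast
qed

lemma (in complex_algebra) calg_idealI:
  assumes "I \<subseteq> carrier A" "\<zero> \<in> I" "\<And>i j. \<lbrakk>i \<in> I; j \<in> I\<rbrakk> \<Longrightarrow> i \<oplus> j \<in> I"
    and sm: "\<And>c i. i \<in> I \<Longrightarrow> c \<odot> i \<in> I"
    and "\<And>x i. \<lbrakk>x \<in> carrier A; i \<in> I\<rbrakk> \<Longrightarrow> x \<otimes> i \<in> I \<and> i \<otimes> x \<in> I"
  shows "calg_ideal I A"
proof -
  have "\<ominus> i \<in> I" if i: "i \<in> I" for i
  proof -
    have c: "i \<in> carrier A" using assms(1) i by blast
    have "(-1) \<odot> i \<oplus> i = ((-1) + 1) \<odot> i"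
      using c smult_l_distr[of "-1" 1 i] smult_one[OF c] by simp
    also have "\<dots> = \<zero>" using smult_l_null[OF c] by simp
    finally have "\<ominus> i = (-1) \<odot> i"
      using c assms(1) sm[OF i] by (intro minus_equality) auto
    then show ?thesis using sm[OF i] by simp
  qed
  then have "submodule I complex_ring A"
    using assms by (intro submoduleI) auto
  then show ?thesis using assms(5) by (auto simp: calg_ideal_def)
qed

lemma (in complex_algebra) calg_idealD:
  assumes "calg_ideal I A"
  shows "I \<subseteq> carrier A" "\<zero> \<in> I" "\<And>i j. \<lbrakk>i \<in> I; j \<in> I\<rbrakk> \<Longrightarrow> i \<oplus> j \<in> I"
    "\<And>c i. i \<in> I \<Longrightarrow> c \<odot> i \<in> I"
    "\<And>x i. \<lbrakk>x \<in> carrier A; i \<in> I\<rbrakk> \<Longrightarrow> x \<otimes> i \<in> I \<and> i \<otimes> x \<in> I"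
proof -
  interpret calg_quotient A I by (intro calg_quotient.intro complex_algebra_axioms calg_quotient_axioms.intro assms)
  show "I \<subseteq> carrier A" by (rule a_subset)
  show "\<zero> \<in> I" using additive_subgroup.zero_closed[OF is_additive_subgroup] .
  show "i \<oplus> j \<in> I" if "i \<in> I" "j \<in> I" for i j
    using additive_subgroup.a_closed[OF is_additive_subgroup that] .
  show "c \<odot> i \<in> I" if "i \<in> I" for c i using that by (rule smult_ideal)
  show "x \<otimes> i \<in> I \<and> i \<otimes> x \<in> I" if "x \<in> carrier A" "i \<in> I" for x i
    using that by (rule mult_ideal)
qed

lemma (in complex_algebra) calg_ideal_Inter:
  assumes "\<I> \<noteq> {}" "\<And>I. I \<in> \<I> \<Longrightarrow> calg_ideal I A"
  shows "calg_ideal (\<Inter>\<I>) A"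
proof (rule calg_idealI)
  show "\<Inter>\<I> \<subseteq> carrier A" using calg_idealD(1)[OF assms(2)] assms(1) by blast
  show "\<zero> \<in> \<Inter>\<I>" using calg_idealD(2)[OF assms(2)] by blast
  show "i \<oplus> j \<in> \<Inter>\<I>" if "i \<in> \<Inter>\<I>" "j \<in> \<Inter>\<I>" for i j
    using calg_idealD(3)[OF assms(2)] that by simp
  show "c \<odot> i \<in> \<Inter>\<I>" if "i \<in> \<Inter>\<I>" for c i
    using calg_idealD(4)[OF assms(2)] that by simp
  show "x \<otimes> i \<in> \<Inter>\<I> \<and> i \<otimes> x \<in> \<Inter>\<I>" if "x \<in> carrier A" "i \<in> \<Inter>\<I>" for x i
    using calg_idealD(5)[OF assms(2)] that by simp
qed

context k_graph
begin

definition "kp_rels = KP_rels \<Lambda> (kp_free \<Lambda>)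
  (\<lambda>v. free_gen (Vertex v)) (\<lambda>a. free_gen (Path a)) (\<lambda>a. free_gen (Ghost a))"

lemma gens_carrier:
  "(\<lambda>v. free_gen (Vertex v)) \<in> verts \<Lambda> \<rightarrow> carrier (kp_free \<Lambda>)"
  "(\<lambda>v. free_gen (Path v)) \<in> pos_paths \<Lambda> \<rightarrow> carrier (kp_free \<Lambda>)"
  "(\<lambda>v. free_gen (Ghost v)) \<in> pos_paths \<Lambda> \<rightarrow> carrier (kp_free \<Lambda>)"
  by (auto intro!: free_gen_carrier simp: kp_symbols_def)

lemma quot_family_iff:
  assumes "calg_ideal I (kp_free \<Lambda>)"
  shows "KP_family \<Lambda> (calg_quot (kp_free \<Lambda>) I)
       (\<lambda>v. I +>\<^bsub>kp_free \<Lambda>\<^esub> free_gen (Vertex v))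
       (\<lambda>a. I +>\<^bsub>kp_free \<Lambda>\<^esub> free_gen (Path a))
       (\<lambda>a. I +>\<^bsub>kp_free \<Lambda>\<^esub> free_gen (Ghost a)) \<longleftrightarrow>
     (\<forall>(x, y)\<in>kp_rels. x \<ominus>\<^bsub>kp_free \<Lambda>\<^esub> y \<in> I)"
proof -
  interpret calg_quotient "kp_free \<Lambda>" I
    by (intro calg_quotient.intro complex_algebra_free calg_quotient_axioms.intro assms)
  note KP_family_iff[OF k_graph_axioms complex_algebra_free complex_algebra_quot coset_hom gens_carrier,
      folded kp_rels_def]
  moreover have "I +>\<^bsub>kp_free \<Lambda>\<^esub> x = I +>\<^bsub>kp_free \<Lambda>\<^esub> y \<longleftrightarrow> x \<ominus>\<^bsub>kp_free \<Lambda>\<^esub> y \<in> I"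
    if "(x, y) \<in> kp_rels" for x y
    using KP_rels_carrier[OF complex_algebra_free gens_carrier that[unfolded kp_rels_def]]
    by (rule coset_eq_iff)
  ultimately show ?thesis by fast
qed

lemma kp_ideal_eq:
  "kp_ideal \<Lambda> = \<Inter>{I. calg_ideal I (kp_free \<Lambda>) \<and> (\<forall>(x, y)\<in>kp_rels. x \<ominus>\<^bsub>kp_free \<Lambda>\<^esub> y \<in> I)}"
  unfolding kp_ideal_def
  by (intro arg_cong[where f = Inter] Collect_cong conj_cong refl quot_family_iff)

lemma kp_ideal_ideal: "calg_ideal (kp_ideal \<Lambda>) (kp_free \<Lambda>)"
proof -
  interpret F: complex_algebra "kp_free \<Lambda>" by (rule complex_algebra_free)
  have "calg_ideal (carrier (kp_free \<Lambda>)) (kp_free \<Lambda>)"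
    by (rule F.calg_idealI) (auto intro: F.mult_closed F.smult_closed)
  moreover have "x \<ominus>\<^bsub>kp_free \<Lambda>\<^esub> y \<in> carrier (kp_free \<Lambda>)" if "(x, y) \<in> kp_rels" for x y
    using KP_rels_carrier[OF complex_algebra_free gens_carrier that[unfolded kp_rels_def]]
    by (rule F.minus_closed)
  ultimately show ?thesis
    unfolding kp_ideal_eq
    by (intro F.calg_ideal_Inter) (auto intro!: exI[of _ "carrier (kp_free \<Lambda>)"])
qed

lemma complex_algebra_kumjian_pask: "complex_algebra (kumjian_pask \<Lambda>)"
  unfolding kumjian_pask_def
  by (intro calg_quotient.complex_algebra_quot calg_quotient.intro complex_algebra_free
      calg_quotient_axioms.intro kp_ideal_ideal)

theorem kumjian_pask_family:
  "KP_family \<Lambda> (kumjian_pask \<Lambda>)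
     (\<lambda>v. kp_ideal \<Lambda> +>\<^bsub>kp_free \<Lambda>\<^esub> free_gen (Vertex v))
     (\<lambda>a. kp_ideal \<Lambda> +>\<^bsub>kp_free \<Lambda>\<^esub> free_gen (Path a))
     (\<lambda>a. kp_ideal \<Lambda> +>\<^bsub>kp_free \<Lambda>\<^esub> free_gen (Ghost a))"
  unfolding kumjian_pask_def quot_family_iff[OF kp_ideal_ideal] unfolding kp_ideal_eq by auto

theorem kumjian_pask_universal:
  assumes B: "complex_algebra B" and fam: "KP_family \<Lambda> B P S T"
  shows "\<exists>!h. h \<in> extensional (carrier (kumjian_pask \<Lambda>)) \<and> h \<in> calg_hom (kumjian_pask \<Lambda>) B \<and>
    (\<forall>v\<in>verts \<Lambda>. h (kp_ideal \<Lambda> +>\<^bsub>kp_free \<Lambda>\<^esub> free_gen (Vertex v)) = P v) \<and>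
    (\<forall>a\<in>pos_paths \<Lambda>. h (kp_ideal \<Lambda> +>\<^bsub>kp_free \<Lambda>\<^esub> free_gen (Path a)) = S a) \<and>
    (\<forall>a\<in>pos_paths \<Lambda>. h (kp_ideal \<Lambda> +>\<^bsub>kp_free \<Lambda>\<^esub> free_gen (Ghost a)) = T a)"
    (is "\<exists>!h. ?U h")
proof -
  let ?F = "kp_free \<Lambda>" and ?I = "kp_ideal \<Lambda>"
  interpret Q: calg_quotient ?F ?I
    by (intro calg_quotient.intro complex_algebra_free calg_quotient_axioms.intro kp_ideal_ideal)
  interpret B: complex_algebra B by fact
  note quot = Q.quot_simps[folded kumjian_pask_def]
  have fc: "P \<in> verts \<Lambda> \<rightarrow> carrier B" "S \<in> pos_paths \<Lambda> \<rightarrow> carrier B" "T \<in> pos_paths \<Lambda> \<rightarrow> carrier B"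
    by (use fam in \<open>simp_all only: KP_family_def\<close>)
  define g where "g = case_kp_symbol P S T"
  have "g \<in> kp_symbols \<Lambda> \<rightarrow> carrier B"
    using fc by (auto simp: g_def kp_symbols_def)
  from free_hom_exists[OF B this] obtain f where f: "f \<in> calg_hom ?F B"
    and fg: "\<And>x. x \<in> kp_symbols \<Lambda> \<Longrightarrow> f (free_gen x) = g x" by blast
  have fsimps: "x \<in> carrier ?F \<Longrightarrow> f x \<in> carrier B"
    "\<lbrakk>x \<in> carrier ?F; y \<in> carrier ?F\<rbrakk> \<Longrightarrow> f (x \<oplus>\<^bsub>?F\<^esub> y) = f x \<oplus>\<^bsub>B\<^esub> f y"
    "\<lbrakk>x \<in> carrier ?F; y \<in> carrier ?F\<rbrakk> \<Longrightarrow> f (x \<otimes>\<^bsub>?F\<^esub> y) = f x \<otimes>\<^bsub>B\<^esub> f y"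
    "x \<in> carrier ?F \<Longrightarrow> f (c \<odot>\<^bsub>?F\<^esub> x) = c \<odot>\<^bsub>B\<^esub> f x" for x y c
    using f by (auto simp: calg_hom_def)
  have f0: "f \<zero>\<^bsub>?F\<^esub> = \<zero>\<^bsub>B\<^esub>" by (rule hom_zero[OF complex_algebra_free B f])
  have fdiff: "f (x \<ominus>\<^bsub>?F\<^esub> y) = \<zero>\<^bsub>B\<^esub> \<longleftrightarrow> f x = f y" if c: "x \<in> carrier ?F" "y \<in> carrier ?F" for x y
  proof -
    have "x = (x \<ominus>\<^bsub>?F\<^esub> y) \<oplus>\<^bsub>?F\<^esub> y"
      using c by (simp add: Q.minus_eq Q.a_assoc Q.l_neg)
    then have "f x = f (x \<ominus>\<^bsub>?F\<^esub> y) \<oplus>\<^bsub>B\<^esub> f y"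
      using c fsimps(2)[of "x \<ominus>\<^bsub>?F\<^esub> y" y] by simp
    then show ?thesis using c fsimps(1) B.add.r_cancel_one[of "f y" "f (x \<ominus>\<^bsub>?F\<^esub> y)"] by auto
  qed
  let ?K = "{x \<in> carrier ?F. f x = \<zero>\<^bsub>B\<^esub>}"
  have z: "b \<otimes>\<^bsub>B\<^esub> \<zero>\<^bsub>B\<^esub> = \<zero>\<^bsub>B\<^esub>" "\<zero>\<^bsub>B\<^esub> \<otimes>\<^bsub>B\<^esub> b = \<zero>\<^bsub>B\<^esub>" if "b \<in> carrier B" for b
    using B.smult_mult_right[OF that B.zero_closed, of 0] B.mult_closed[OF that B.zero_closed]
      B.smult_l_null[of "b \<otimes>\<^bsub>B\<^esub> \<zero>\<^bsub>B\<^esub>"] B.smult_l_null[OF B.zero_closed]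
      B.smult_mult_left[OF B.zero_closed that, of 0] B.mult_closed[OF B.zero_closed that]
      B.smult_l_null[of "\<zero>\<^bsub>B\<^esub> \<otimes>\<^bsub>B\<^esub> b"] by auto
  have K: "calg_ideal ?K ?F"
  proof (rule Q.calg_idealI)
    fix c i assume "i \<in> ?K"
    then show "c \<odot>\<^bsub>?F\<^esub> i \<in> ?K" using B.smult_r_null[of c] by (simp add: fsimps)
  qed (auto simp: f0 fsimps z Q.mult_closed)
  have cong: "KP_family \<Lambda> B (\<lambda>v. f (free_gen (Vertex v))) (\<lambda>a. f (free_gen (Path a))) (\<lambda>a. f (free_gen (Ghost a)))"
    by (rule KP_family_cong[OF k_graph_axioms B fam]) (auto simp: fg kp_symbols_def g_def)
  have eq: "f x = f y" if "(x, y) \<in> kp_rels" for x y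
    using KP_family_iff[OF k_graph_axioms complex_algebra_free B f gens_carrier] cong that
    unfolding kp_rels_def by blast
  have "x \<ominus>\<^bsub>?F\<^esub> y \<in> ?K" if r: "(x, y) \<in> kp_rels" for x y
    using KP_rels_carrier[OF complex_algebra_free gens_carrier r[unfolded kp_rels_def]]
      fdiff[of x y] eq[OF r] by auto
  with K have IK: "?I \<subseteq> ?K" unfolding kp_ideal_eq by blast
  define h where "h = restrict (\<lambda>X. f (SOME x. x \<in> X)) (carrier (kumjian_pask \<Lambda>))"
  have h: "h (?I +>\<^bsub>?F\<^esub> x) = f x" if x: "x \<in> carrier ?F" for x
  proof -
    have "(SOME y. y \<in> ?I +>\<^bsub>?F\<^esub> x) \<in> ?I +>\<^bsub>?F\<^esub> x" 
      using Q.coset_self[OF x] by (rule someI[of "\<lambda>y. y \<in> _"])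
    then obtain i where i: "i \<in> ?I" "(SOME y. y \<in> ?I +>\<^bsub>?F\<^esub> x) = i \<oplus>\<^bsub>?F\<^esub> x"
      by (auto simp: Q.mem_coset)
    have ic: "i \<in> carrier ?F" "f i = \<zero>\<^bsub>B\<^esub>" using i(1) IK by blast+
    have "h (?I +>\<^bsub>?F\<^esub> x) = f (i \<oplus>\<^bsub>?F\<^esub> x)"
      using x i(2) by (auto simp: h_def quot)
    then show ?thesis using fsimps(1)[OF x] fsimps(2)[OF ic(1) x] ic by simp
  qed
  have hU: "?U h"
  proof (intro conjI)
    show "h \<in> extensional (carrier (kumjian_pask \<Lambda>))" by (simp add: h_def)
    show "h \<in> calg_hom (kumjian_pask \<Lambda>) B"
      by (auto simp: calg_hom_def quot h fsimps Q.mult_closed)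
    have gc: "free_gen x \<in> carrier ?F" if "x \<in> kp_symbols \<Lambda>" for x
      using that by (rule free_gen_carrier)
    show "\<forall>v\<in>verts \<Lambda>. h (?I +>\<^bsub>?F\<^esub> free_gen (Vertex v)) = P v"
      "\<forall>a\<in>pos_paths \<Lambda>. h (?I +>\<^bsub>?F\<^esub> free_gen (Path a)) = S a"
      "\<forall>a\<in>pos_paths \<Lambda>. h (?I +>\<^bsub>?F\<^esub> free_gen (Ghost a)) = T a"
      using h[OF gc] fg by (auto simp: kp_symbols_def g_def)
  qed
  moreover have "h' = h" if U: "?U h'" for h'
  proof (rule extensionalityI[of _ "carrier (kumjian_pask \<Lambda>)"])
    fix X assume "X \<in> carrier (kumjian_pask \<Lambda>)"
    then obtain x where x: "x \<in> carrier ?F" "X = ?I +>\<^bsub>?F\<^esub> x" by (auto simp: quot)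
    have comp: "(\<lambda>x. k (?I +>\<^bsub>?F\<^esub> x)) \<in> calg_hom ?F B" if "k \<in> calg_hom (kumjian_pask \<Lambda>) B" for k
      using that by (auto simp: calg_hom_def quot Pi_def) (metis quot(3-5))+
    have "h' (?I +>\<^bsub>?F\<^esub> x) = h (?I +>\<^bsub>?F\<^esub> x)"
      by (rule free_hom_unique[OF B comp comp _ x(1)])
         (use U hU in \<open>auto simp: kp_symbols_def\<close>)
    then show "h' X = h X" using x by simp
  qed (rule conjunct1[OF U], rule conjunct1[OF hU])
  ultimately show ?thesis by (rule ex1I)
qed

end

end

theory Submission
  imports Defs "HOL-Library.Function_Algebras"
begin

text \<open>
  Every product and every locally constant function is controlled by one observation: if
  \<open>d(\<mu>) = d(\<mu>')\<close>, then \<open>Z(\<mu>,\<nu>)\<close> and \<open>Z(\<mu>',\<nu>')\<close> are equal or disjoint, while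
  \<open>Z(\<mu>,\<nu>)\<close> is the disjoint union of the \<open>Z(\<mu>\<lambda>,\<nu>\<lambda>)\<close> over the finitely many paths
  \<open>\<lambda>\<close> of a given degree that start where \<open>\<mu>\<close> ends. Hence the indicators of
  cylinder sets span \<open>A(G)\<close>, multiply like matrix units once the degrees match, and contain a
  Kumjian--Pask family, which gives a surjection from the Kumjian--Pask algebra. That algebra is
  spanned by the elements \<open>S\<^sub>\<mu> S\<^sub>\<nu>\<^sup>*\<close>, and (KP4) rewrites any element with all \<open>\<mu>\<close> of one
  common degree; its image is then a combination of indicators of disjoint nonempty sets, so
  that the surjection is injective without appeal to a graded uniqueness theorem.
\<close>

text \<open>Only the degrees of the first labels need matching: all points of Z(\<mu>,\<nu>) have
  cocycle value d(\<mu>) - d(\<nu>), so d(\<mu>) determines d(\<nu>). An infinite path is a functor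
  indexed by the partially ordered set N^k, while choices are made one after another; constructions
  therefore follow the diagonal degrees (i,...,i), which are cofinal. Row-finiteness makes
  refinements finite sums and, through Koenig's argument, makes cylinders compact, which places
  their indicators in C_c(G). The absence of sources supplies infinite paths, hence a point in every
  cylinder. Convolution is written as an infinite sum with value 0 when it is not summable, so it is
  not bilinear on all functions; its laws are proved for functions with finitely many nonzero values
  on each range fibre, without any topology.\<close>

section \<open>Arithmetic of degrees in N^k\<close>

lemma vec_nat_le_add: "p \<le> p + (q :: nat^'k::finite)" "q \<le> p + (q :: nat^'k::finite)"
  by (simp_all add: less_eq_vec_def)

lemma vec_nat_le_diff: "p \<le> q \<Longrightarrow> p + (q - p) = (q :: nat^'k::finite)"
  by (simp add: less_eq_vec_def vec_eq_iff)

lemma vec_nat_le_E: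
  assumes "p \<le> (q :: nat^'k::finite)"
  obtains r where "q = p + r"
  using vec_nat_le_diff[OF assms] by metis

lemma vec_nat_zero_le: "0 \<le> (p :: nat^'k::finite)"
  by (simp add: less_eq_vec_def)

lemma vec_nat_add_diff: "p + q - p = (q :: nat^'k::finite)"
  by (simp add: vec_eq_iff)

text \<open>The diagonal is cofinal in N^k, so a sequence of paths with these degrees controls all
  degrees, and choices can be made along the natural numbers.\<close>

definition const_vec :: "nat \<Rightarrow> nat^'k::finite" where
  "const_vec i = (\<chi> _. i)"

lemma const_vec_le: "\<exists>i. (q :: nat^'k::finite) \<le> const_vec i"
  by (rule exI[of _ "Max (range (($) q))"]) (auto simp: less_eq_vec_def const_vec_def)

lemma const_vec_Suc: "const_vec (Suc i) = const_vec i + (const_vec 1 :: nat^'k::finite)"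
  by (simp add: const_vec_def vec_eq_iff)

text \<open>Applied to cocycle values: at a given point, the degree of the first label of a cylinder
  determines the degree of the second.\<close>

lemma zdiff_cancel: "zdiff l m = zdiff l m' \<longleftrightarrow> m = m'"
  by (auto simp: zdiff_def vec_eq_iff)

lemma zdiff_add_right: "zdiff (l + p) (m + p) = zdiff l m"
  by (simp add: zdiff_def vec_eq_iff)

lemma zdiff_add: "zdiff l m + zdiff m p = zdiff l p"
  by (simp add: zdiff_def vec_eq_iff)

lemma zdiff_swap: "- zdiff l m = zdiff m l"
  by (simp add: zdiff_def vec_eq_iff)


section \<open>Finite paths and infinite paths\<close>

context k_graph
begin

abbreviation cat :: "'a \<Rightarrow> 'a \<Rightarrow> 'a" (infixl "\<cdot>" 70) where
  "a \<cdot> b \<equiv> comp \<Lambda> a b"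

lemma deg_src: "a \<in> mor \<Lambda> \<Longrightarrow> deg \<Lambda> (src \<Lambda> a) = 0"
  using deg_rng[OF src_mor] rng_src by metis

lemma rng_vertex: "v \<in> mor \<Lambda> \<Longrightarrow> deg \<Lambda> v = 0 \<Longrightarrow> rng \<Lambda> v = v"
  using verts_eq_identities unfolding verts_def by auto

lemma src_vertex: "v \<in> mor \<Lambda> \<Longrightarrow> deg \<Lambda> v = 0 \<Longrightarrow> src \<Lambda> v = v"
  using rng_vertex src_rng by metis

lemma src_verts: "a \<in> mor \<Lambda> \<Longrightarrow> src \<Lambda> a \<in> verts \<Lambda>"
  by (simp add: verts_def src_mor deg_src)

lemma rng_verts: "a \<in> mor \<Lambda> \<Longrightarrow> rng \<Lambda> a \<in> verts \<Lambda>"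
  by (simp add: verts_def rng_mor deg_rng)

lemma factor_ex:
  assumes "a \<in> mor \<Lambda>" "deg \<Lambda> a = m + n"
  obtains b c where "b \<in> mor \<Lambda>" "c \<in> mor \<Lambda>" "deg \<Lambda> b = m" "deg \<Lambda> c = n"
    "src \<Lambda> b = rng \<Lambda> c" "a = b \<cdot> c"
  using factorisation[OF assms] by blast

text \<open>The uniqueness half of the factorisation property, as cancellation. Comparing the
  degrees of the left factors is enough, since those of the right factors then agree by
  subtraction.\<close>

lemma comp_inject:
  assumes "b \<in> mor \<Lambda>" "c \<in> mor \<Lambda>" "src \<Lambda> b = rng \<Lambda> c"
    and "b' \<in> mor \<Lambda>" "c' \<in> mor \<Lambda>" "src \<Lambda> b' = rng \<Lambda> c'"
    and "deg \<Lambda> b = deg \<Lambda> b'" "b \<cdot> c = b' \<cdot> c'"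
  shows "b = b'" "c = c'"
proof -
  have d: "deg \<Lambda> (b \<cdot> c) = deg \<Lambda> b + deg \<Lambda> c" by (rule deg_comp) fact+
  moreover have "deg \<Lambda> (b' \<cdot> c') = deg \<Lambda> b' + deg \<Lambda> c'" by (rule deg_comp) fact+
  ultimately have "deg \<Lambda> c = deg \<Lambda> c'" using assms(7,8) by (metis add_left_cancel)
  then have "(b, c) = (b', c')"
    using ex1_implies_ex factorisation[OF comp_mor[OF assms(1-3)] d] assms
    by (elim ex1E) (metis fst_conv snd_conv)
  then show "b = b'" "c = c'" by auto
qed

section \<open>Prefixes of finite paths\<close>

definition pfx :: "'a \<Rightarrow> 'a \<Rightarrow> bool" where
  "pfx b a \<longleftrightarrow> b \<in> mor \<Lambda> \<and> (\<exists>c\<in>mor \<Lambda>. src \<Lambda> b = rng \<Lambda> c \<and> a = b \<cdot> c)"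

lemma pfx_mor: "pfx b a \<Longrightarrow> b \<in> mor \<Lambda>" "pfx b a \<Longrightarrow> a \<in> mor \<Lambda>"
  unfolding pfx_def using comp_mor by blast+

lemma pfx_comp: "\<lbrakk>b \<in> mor \<Lambda>; c \<in> mor \<Lambda>; src \<Lambda> b = rng \<Lambda> c\<rbrakk> \<Longrightarrow> pfx b (b \<cdot> c)"
  unfolding pfx_def by blast

lemma pfx_refl: "a \<in> mor \<Lambda> \<Longrightarrow> pfx a a"
  using pfx_comp[of a "src \<Lambda> a"] by (simp add: src_mor rng_src comp_src)

lemma pfx_trans:
  assumes "pfx a b" "pfx b c"
  shows "pfx a c"
proof -
  obtain d e where d: "a \<in> mor \<Lambda>" "d \<in> mor \<Lambda>" "src \<Lambda> a = rng \<Lambda> d" "b = a \<cdot> d"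
    and e: "e \<in> mor \<Lambda>" "src \<Lambda> b = rng \<Lambda> e" "c = b \<cdot> e"
    using assms by (auto simp: pfx_def)
  have s: "src \<Lambda> d = rng \<Lambda> e" using d e by (simp add: src_comp)
  have "c = a \<cdot> (d \<cdot> e)" using d e s by (simp add: comp_assoc)
  then show ?thesis using d e s pfx_comp[of a "d \<cdot> e"] by (simp add: comp_mor rng_comp)
qed

lemma pfx_eqI:
  assumes "pfx b a" "pfx b' a" "deg \<Lambda> b = deg \<Lambda> b'"
  shows "b = b'"
  using assms comp_inject(1) unfolding pfx_def by metis

lemma pfx_ex:
  assumes "a \<in> mor \<Lambda>" "q \<le> deg \<Lambda> a"
  obtains b where "pfx b a" "deg \<Lambda> b = q"
proof -
  obtain r where "deg \<Lambda> a = q + r" using assms(2) by (rule vec_nat_le_E)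
  from factor_ex[OF assms(1) this] that show ?thesis using pfx_comp by metis
qed

text \<open>The prefix of \<open>c\<close> of degree d(b) is also a prefix of \<open>a\<close>, and
  \<open>a\<close> has only one prefix of that degree, namely \<open>b\<close>.\<close>

lemma pfx_linear:
  assumes "pfx b a" "pfx c a" "deg \<Lambda> b \<le> deg \<Lambda> c"
  shows "pfx b c"
proof -
  obtain b' where "pfx b' c" "deg \<Lambda> b' = deg \<Lambda> b"
    using pfx_ex assms(3) pfx_mor[OF assms(2)] by metis
  moreover from this have "b' = b" using pfx_eqI pfx_trans assms by metis
  ultimately show ?thesis by simp
qed

section \<open>Infinite paths as coherent families of initial segments\<close>

lemma Omega_simps:
  "(p, q) \<in> mor Omega \<longleftrightarrow> p \<le> q" "rng Omega (p, q) = (p, p)" "src Omega (p, q) = (q, q)"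
  "comp Omega (p, q) (q', t) = (p, t)" "deg Omega (p, q) = q - p"
  by (simp_all add: Omega_def)

lemma inf_path_mor:
  assumes "x \<in> inf_paths \<Lambda>" "p \<le> q"
  shows "x (p, q) \<in> mor \<Lambda>" "deg \<Lambda> (x (p, q)) = q - p" "rng \<Lambda> (x (p, q)) = x (p, p)"
    "src \<Lambda> (x (p, q)) = x (q, q)"
proof -
  have "\<forall>a\<in>mor Omega. x a \<in> mor \<Lambda> \<and> rng \<Lambda> (x a) = x (rng Omega a) \<and>
      src \<Lambda> (x a) = x (src Omega a) \<and> deg \<Lambda> (x a) = deg Omega a"
    using assms(1) unfolding inf_paths_def degree_functor_def by blast
  from bspec[OF this, of "(p, q)"] assms(2)
  show "x (p, q) \<in> mor \<Lambda>" "deg \<Lambda> (x (p, q)) = q - p" "rng \<Lambda> (x (p, q)) = x (p, p)"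
    "src \<Lambda> (x (p, q)) = x (q, q)"
    by (simp_all add: Omega_simps)
qed

lemma inf_path_comp:
  assumes "x \<in> inf_paths \<Lambda>" "p \<le> q" "q \<le> r"
  shows "x (p, r) = x (p, q) \<cdot> x (q, r)"
proof -
  have "\<forall>a\<in>mor Omega. \<forall>b\<in>mor Omega. src Omega a = rng Omega b \<longrightarrow> x (comp Omega a b) = x a \<cdot> x b"
    using assms(1) unfolding inf_paths_def degree_functor_def by blast
  from this[rule_format, of "(p, q)" "(q, r)"] assms(2,3) show ?thesis by (simp add: Omega_simps)
qed

lemma inf_path_undefined: "x \<in> inf_paths \<Lambda> \<Longrightarrow> \<not> p \<le> q \<Longrightarrow> x (p, q) = undefined"
  by (simp add: inf_paths_def extensional_def Omega_simps)

lemma inf_pathsI: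
  assumes "\<And>p q. \<not> p \<le> q \<Longrightarrow> x (p, q) = undefined"
    and "\<And>p q. p \<le> q \<Longrightarrow> x (p, q) \<in> mor \<Lambda> \<and> deg \<Lambda> (x (p, q)) = q - p \<and>
          rng \<Lambda> (x (p, q)) = x (p, p) \<and> src \<Lambda> (x (p, q)) = x (q, q)"
    and "\<And>p q r. p \<le> q \<Longrightarrow> q \<le> r \<Longrightarrow> x (p, r) = x (p, q) \<cdot> x (q, r)"
  shows "x \<in> inf_paths \<Lambda>"
  unfolding inf_paths_def degree_functor_def extensional_def mem_Collect_eq Ball_def split_paired_All
    Omega_simps using assms by fast

lemma inf_path_init:
  assumes "x \<in> inf_paths \<Lambda>"
  shows "x (0, q) \<in> mor \<Lambda>" "deg \<Lambda> (x (0, q)) = q" "rng \<Lambda> (x (0, q)) = x (0, 0)"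
    "src \<Lambda> (x (0, q)) = x (q, q)"
  using inf_path_mor[OF assms vec_nat_zero_le] by (auto simp: vec_eq_iff)

lemma inf_path_pfx:
  assumes "x \<in> inf_paths \<Lambda>" "p \<le> q"
  shows "pfx (x (0, p)) (x (0, q))"
  unfolding inf_path_comp[OF assms(1) vec_nat_zero_le assms(2)]
  by (rule pfx_comp) (use inf_path_init[OF assms(1)] inf_path_mor[OF assms] in simp_all)

text \<open>Each initial segment is the prefix of known degree of some diagonal one, and x(p,q) is
  recovered by cancelling x(0,p) from x(0,q).\<close>

lemma inf_path_eqI:
  assumes "x \<in> inf_paths \<Lambda>" "y \<in> inf_paths \<Lambda>" "\<And>i. x (0, const_vec i) = y (0, const_vec i)"
  shows "x = y"
proof -
  have init: "x (0, q) = y (0, q)" for q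
  proof -
    obtain i where i: "q \<le> const_vec i" using const_vec_le by metis
    show ?thesis
      by (rule pfx_eqI[OF inf_path_pfx[OF assms(1) i]])
        (use inf_path_pfx[OF assms(2) i] assms inf_path_init in simp_all)
  qed
  show ?thesis
  proof
    fix z :: "(nat^'k) \<times> (nat^'k)"
    obtain p q where z: "z = (p, q)" by (cases z)
    show "x z = y z"
    proof (cases "p \<le> q")
      case True
      have "x (0, p) \<cdot> x (p, q) = y (0, p) \<cdot> y (p, q)"
        using init inf_path_comp[OF _ vec_nat_zero_le True] assms by metis
      then show ?thesis
        unfolding z
        by (rule comp_inject(2)[rotated -1])
          (use inf_path_init[OF assms(1)] inf_path_init[OF assms(2)] inf_path_mor[OF assms(1) True]
             inf_path_mor[OF assms(2) True] in simp_all)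
    qed (simp add: z inf_path_undefined assms)
  qed
qed

lemma shift_inf_path:
  assumes "x \<in> inf_paths \<Lambda>"
  shows "shift p x \<in> inf_paths \<Lambda>"
proof (rule inf_pathsI)
  fix m n assume "\<not> m \<le> (n :: nat^'k)"
  then show "shift p x (m, n) = undefined"
    using inf_path_undefined[OF assms, of "m + p" "n + p"] by (simp add: shift_def less_eq_vec_def)
next
  fix m n assume le: "m \<le> (n :: nat^'k)"
  have "m + p \<le> n + p" using le by (simp add: less_eq_vec_def)
  from inf_path_mor[OF assms this] show "shift p x (m, n) \<in> mor \<Lambda> \<and> deg \<Lambda> (shift p x (m, n)) = n - m \<and>
      rng \<Lambda> (shift p x (m, n)) = shift p x (m, m) \<and> src \<Lambda> (shift p x (m, n)) = shift p x (n, n)"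
    by (simp add: shift_def vec_eq_iff)
next
  fix m n l assume "m \<le> n" "n \<le> (l :: nat^'k)"
  then have "m + p \<le> n + p" "n + p \<le> l + p" by (simp_all add: less_eq_vec_def)
  from inf_path_comp[OF assms this] show "shift p x (m, l) = shift p x (m, n) \<cdot> shift p x (n, l)"
    by (simp add: shift_def)
qed

lemma shift_init: "shift p x (0, q) = x (p, p + q)"
  by (simp add: shift_def add.commute)

lemma shift_shift: "shift p (shift q x) = shift (q + p) x"
  by (auto simp: shift_def fun_eq_iff algebra_simps)

lemma inf_path_init_add:
  assumes "x \<in> inf_paths \<Lambda>"
  shows "x (0, p + q) = x (0, p) \<cdot> shift p x (0, q)"
    "src \<Lambda> (x (0, p)) = rng \<Lambda> (shift p x (0, q))"
  using inf_path_comp[OF assms vec_nat_zero_le vec_nat_le_add(1)] inf_path_init(4)[OF assms, of p]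
    inf_path_init(3)[OF shift_inf_path[OF assms]]
  by (simp_all add: shift_init)

text \<open>An infinite path is its initial segment followed by its tail. This is the uniqueness
  behind the definite description in \<open>prepend\<close>.\<close>

lemma inf_path_eq_shiftI:
  assumes "x \<in> inf_paths \<Lambda>" "y \<in> inf_paths \<Lambda>" "x (0, p) = y (0, p)" "shift p x = shift p y"
  shows "x = y"
proof (rule inf_path_eqI[OF assms(1,2)])
  fix i
  \<comment> \<open>The degree p + (i,...,i) dominates both p, where the path is cut, and (i,...,i),
    where the two paths are to be compared.\<close>
  have "x (0, p + const_vec i) = y (0, p + const_vec i)"
    using inf_path_init_add(1) assms by metis
  moreover note inf_path_pfx[OF assms(1) vec_nat_le_add(2), of "const_vec i" p]
    inf_path_pfx[OF assms(2) vec_nat_le_add(2), of "const_vec i" p]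
  ultimately show "x (0, const_vec i) = y (0, const_vec i)"
    using inf_path_init(2)[OF assms(1)] inf_path_init(2)[OF assms(2)] by (metis pfx_eqI)
qed

text \<open>Some chain member has a prefix of any given degree, and prefixes of one degree taken
  from different members agree because the members are nested. Prepending, the existence of a path
  at each vertex, and the limit point in the compactness proof all rest on this.\<close>

lemma chain_inf_path:
  fixes A :: "nat \<Rightarrow> 'a"
  assumes step: "\<And>i. pfx (A i) (A (Suc i))" and cofinal: "\<And>q. \<exists>i. q \<le> deg \<Lambda> (A i)"
  shows "\<exists>x\<in>inf_paths \<Lambda>. \<forall>i. x (0, deg \<Lambda> (A i)) = A i"
proof -
  have mono: "pfx (A i) (A j)" if "i \<le> j" for i j
    using that by (induction rule: dec_induct) (use step pfx_trans pfx_refl pfx_mor(1) in blast)+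
  have "\<exists>b. deg \<Lambda> b = q \<and> (\<exists>i. pfx b (A i))" for q
    using cofinal[of q] pfx_ex pfx_mor(1)[OF step] by metis
  then obtain b where b: "\<And>q. deg \<Lambda> (b q) = q" "\<And>q. \<exists>i. pfx (b q) (A i)" by metis
  have b_mor: "b q \<in> mor \<Lambda>" for q using b(2) pfx_mor(1) by blast
  have pfx_b: "pfx (b p) (b q)" if "p \<le> q" for p q
  proof -
    obtain i j where ij: "pfx (b p) (A i)" "pfx (b q) (A j)" using b(2) by metis
    have "pfx (b p) (A (max i j))" by (rule pfx_trans[OF ij(1) mono]) simp
    moreover have "pfx (b q) (A (max i j))" by (rule pfx_trans[OF ij(2) mono]) simp
    ultimately show ?thesis by (rule pfx_linear) (simp add: b(1) that)
  qed
  \<comment> \<open>The segment from p to q is what remains of \<open>b q\<close> after removing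
    \<open>b p\<close>. By cancellation (\<open>c_uniq\<close>) each functor law becomes an identity
    between factorisations.\<close>
  define c where "c p q = (SOME c. c \<in> mor \<Lambda> \<and> src \<Lambda> (b p) = rng \<Lambda> c \<and> b q = b p \<cdot> c)" for p q
  have c: "c p q \<in> mor \<Lambda>" "src \<Lambda> (b p) = rng \<Lambda> (c p q)" "b q = b p \<cdot> c p q" if "p \<le> q" for p q
  proof -
    have "\<exists>c. c \<in> mor \<Lambda> \<and> src \<Lambda> (b p) = rng \<Lambda> c \<and> b q = b p \<cdot> c"
      using pfx_b[OF that] by (auto simp: pfx_def)
    from someI_ex[OF this, folded c_def]
    show "c p q \<in> mor \<Lambda>" "src \<Lambda> (b p) = rng \<Lambda> (c p q)" "b q = b p \<cdot> c p q" by auto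
  qed
  have c_uniq: "c p q = d" if "p \<le> q" "d \<in> mor \<Lambda>" "src \<Lambda> (b p) = rng \<Lambda> d" "b q = b p \<cdot> d" for p q d
    using comp_inject(2)[OF b_mor c(1,2)[OF that(1)] b_mor that(2,3)] c(3)[OF that(1)] that(4) by simp
  have c_deg: "deg \<Lambda> (c p q) = q - p" if "p \<le> q" for p q
    using deg_comp[OF b_mor c(1,2)[OF that]] c(3)[OF that] b(1) by (metis vec_nat_add_diff)
  have c_refl: "c p p = src \<Lambda> (b p)" for p
    by (rule c_uniq) (auto simp: b_mor src_mor rng_src comp_src)
  have c_src: "src \<Lambda> (c p q) = src \<Lambda> (b q)" if "p \<le> q" for p q
    using src_comp[OF b_mor c(1,2)[OF that]] c(3)[OF that] by simp
  define x where "x = (\<lambda>(p, q). if p \<le> q then c p q else undefined)"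
  have x: "x \<in> inf_paths \<Lambda>"
  proof (rule inf_pathsI)
    fix p q :: "nat^'k" assume "p \<le> q"
    then show "x (p, q) \<in> mor \<Lambda> \<and> deg \<Lambda> (x (p, q)) = q - p \<and>
          rng \<Lambda> (x (p, q)) = x (p, p) \<and> src \<Lambda> (x (p, q)) = x (q, q)"
      using c c_deg c_refl c_src by (simp add: x_def)
  next
    fix p q r :: "nat^'k" assume pqr: "p \<le> q" "q \<le> r"
    have s: "src \<Lambda> (c p q) = rng \<Lambda> (c q r)" using c_src c pqr by metis
    have "c p r = c p q \<cdot> c q r"
    proof (rule c_uniq)
      show "b r = b p \<cdot> (c p q \<cdot> c q r)"
        using c(3)[OF pqr(1)] c(3)[OF pqr(2)] comp_assoc[OF b_mor c(1)[OF pqr(1)] c(1)[OF pqr(2)]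
            c(2)[OF pqr(1)] s] by simp
    qed (use pqr s c in \<open>auto simp: comp_mor rng_comp\<close>)
    then show "x (p, r) = x (p, q) \<cdot> x (q, r)" using pqr by (auto simp: x_def)
  qed (simp add: x_def)
  have "x (0, deg \<Lambda> (A i)) = A i" for i
  proof -
    obtain j where "pfx (b (deg \<Lambda> (A i))) (A j)" using b(2) by blast
    then have "pfx (b (deg \<Lambda> (A i))) (A (max i j))"
      by (rule pfx_trans) (intro mono, simp)
    then have "b (deg \<Lambda> (A i)) = A i"
      by (rule pfx_eqI) (simp_all add: mono b(1))
    \<comment> \<open>The path \<open>b 0\<close> has degree 0, so it is an identity and removing it
      changes nothing.\<close>
    moreover have "x (0, q) = b q" for q
    proof -
      have "b q = b 0 \<cdot> c 0 q" "rng \<Lambda> (c 0 q) = b 0"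
        using c(2,3)[OF vec_nat_zero_le, of q] src_vertex[OF b_mor b(1)] by auto
      then have "b q = c 0 q" using comp_rng[OF c(1)[OF vec_nat_zero_le]] by metis
      then show ?thesis using vec_nat_zero_le[of q] by (simp add: x_def)
    qed
    ultimately show ?thesis by simp
  qed
  with x show ?thesis by blast
qed

text \<open>Existence comes from the chain of paths \<open>a\<close> followed by x(0,(i,...,i)),
  uniqueness from \<open>inf_path_eq_shiftI\<close>; hence the description in \<open>prepend\<close>
  denotes the intended path.\<close>

lemma prepend:
  assumes a: "a \<in> mor \<Lambda>" and x: "x \<in> inf_paths \<Lambda>" "ip_rng x = src \<Lambda> a"
  shows prepend_inf_path: "prepend \<Lambda> a x \<in> inf_paths \<Lambda>"
    and prepend_init: "prepend \<Lambda> a x (0, deg \<Lambda> a) = a"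
    and shift_prepend: "shift (deg \<Lambda> a) (prepend \<Lambda> a x) = x"
proof -
  define A where "A i = a \<cdot> x (0, const_vec i)" for i
  have s: "src \<Lambda> a = rng \<Lambda> (x (0, q))" for q
    using x inf_path_init(3) by (simp add: ip_rng_def)
  have A_deg: "deg \<Lambda> (A i) = deg \<Lambda> a + const_vec i" for i
    using deg_comp[OF a inf_path_init(1)[OF x(1)] s] inf_path_init(2)[OF x(1)] by (simp add: A_def)
  have "\<exists>y\<in>inf_paths \<Lambda>. \<forall>i. y (0, deg \<Lambda> (A i)) = A i"
  proof (rule chain_inf_path)
    fix i
    let ?p = "const_vec i :: nat^'k"
    have "A (Suc i) = A i \<cdot> shift ?p x (0, const_vec 1)"
      unfolding A_def const_vec_Suc[of i] inf_path_init_add(1)[OF x(1)]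
      by (rule comp_assoc[symmetric])
        (use a inf_path_init(1) shift_inf_path x(1) s inf_path_init_add(2) in auto)
    moreover have "src \<Lambda> (A i) = rng \<Lambda> (shift ?p x (0, const_vec 1))"
      using src_comp[OF a inf_path_init(1)[OF x(1)] s] inf_path_init_add(2)[OF x(1)] by (simp add: A_def)
    moreover have "A i \<in> mor \<Lambda>" using comp_mor[OF a inf_path_init(1)[OF x(1)] s] by (simp add: A_def)
    ultimately show "pfx (A i) (A (Suc i))"
      using inf_path_init(1)[OF shift_inf_path[OF x(1)]] by (auto simp: pfx_def)
  next
    fix q :: "nat^'k"
    obtain i where "q \<le> const_vec i" using const_vec_le by blast
    then show "\<exists>i. q \<le> deg \<Lambda> (A i)"
      unfolding A_deg using order_trans vec_nat_le_add(2) by blast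
  qed
  then obtain y where y: "y \<in> inf_paths \<Lambda>" "\<And>i. y (0, deg \<Lambda> a + const_vec i) = a \<cdot> x (0, const_vec i)"
    unfolding A_deg by (auto simp: A_def)
  have *: "y (0, deg \<Lambda> a) = a \<and> shift (deg \<Lambda> a) y (0, const_vec i) = x (0, const_vec i)" for i
    using comp_inject[OF inf_path_init(1)[OF y(1)] inf_path_init(1)[OF shift_inf_path[OF y(1)]] _
        a inf_path_init(1)[OF x(1)] s, of "deg \<Lambda> a"] inf_path_init(2)[OF y(1)]
      inf_path_init_add[OF y(1)] y(2) by metis
  then have "shift (deg \<Lambda> a) y = x" by (intro inf_path_eqI shift_inf_path x y) auto
  then have "\<exists>!y. y \<in> inf_paths \<Lambda> \<and> y (0, deg \<Lambda> a) = a \<and> shift (deg \<Lambda> a) y = x"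
    using y(1) * inf_path_eq_shiftI by metis
  from theI'[OF this] show "prepend \<Lambda> a x \<in> inf_paths \<Lambda>" "prepend \<Lambda> a x (0, deg \<Lambda> a) = a"
    "shift (deg \<Lambda> a) (prepend \<Lambda> a x) = x"
    by (simp_all add: prepend_def)
qed

lemma prepend_shift:
  assumes "y \<in> inf_paths \<Lambda>" "y (0, deg \<Lambda> a) = a"
  shows "prepend \<Lambda> a (shift (deg \<Lambda> a) y) = y"
proof -
  have a: "a \<in> mor \<Lambda>" using inf_path_init(1)[OF assms(1), of "deg \<Lambda> a"] assms(2) by simp
  have "ip_rng (shift (deg \<Lambda> a) y) = src \<Lambda> a"
    using inf_path_init(4)[OF assms(1), of "deg \<Lambda> a"] assms(2) by (simp add: ip_rng_def shift_init)
  note p = prepend[OF a shift_inf_path[OF assms(1)] this]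
  show ?thesis by (rule inf_path_eq_shiftI[of _ _ "deg \<Lambda> a"]) (use p assms in auto)
qed

end


section \<open>The cylinder sets of the path groupoid\<close>

locale source_free_k_graph = k_graph \<Lambda> for \<Lambda> :: "('a, 'k::finite) kgraph" +
  assumes row_finite: "row_finite \<Lambda>" and no_sources: "no_sources \<Lambda>"
begin

abbreviation Z :: "'a \<times> 'a \<Rightarrow> ('a, 'k) gpd set" where
  "Z p \<equiv> cylinder \<Lambda> (fst p) (snd p)"

definition pairs :: "('a \<times> 'a) set" where
  "pairs = {(a, b). a \<in> mor \<Lambda> \<and> b \<in> mor \<Lambda> \<and> src \<Lambda> a = src \<Lambda> b}"

lemma pairsD: "(a, b) \<in> pairs \<Longrightarrow> a \<in> mor \<Lambda> \<and> b \<in> mor \<Lambda> \<and> src \<Lambda> a = src \<Lambda> b"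
  by (simp add: pairs_def)

text \<open>The existential over tails disappears because the tail is recovered from the point
  itself by shifting x past \<open>a\<close>. Most arguments about cylinders use this form.\<close>

lemma mem_cylinder:
  assumes "(a, b) \<in> pairs"
  shows "(x, n, y) \<in> cylinder \<Lambda> a b \<longleftrightarrow> x \<in> inf_paths \<Lambda> \<and> y \<in> inf_paths \<Lambda> \<and>
    n = zdiff (deg \<Lambda> a) (deg \<Lambda> b) \<and> x (0, deg \<Lambda> a) = a \<and> y (0, deg \<Lambda> b) = b \<and>
    shift (deg \<Lambda> a) x = shift (deg \<Lambda> b) y" (is "?L \<longleftrightarrow> ?R")
proof
  note ab = pairsD[OF assms]
  assume ?L
  then obtain z where z: "z \<in> inf_paths \<Lambda>" "ip_rng z = src \<Lambda> a"
    "x = prepend \<Lambda> a z" "n = zdiff (deg \<Lambda> a) (deg \<Lambda> b)" "y = prepend \<Lambda> b z"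
    by (auto simp: cylinder_def)
  then show ?R using prepend[of a z] prepend[of b z] ab by auto
next
  note ab = pairsD[OF assms]
  assume R: ?R
  let ?z = "shift (deg \<Lambda> a) x"
  have "x \<in> inf_paths \<Lambda>" "x (0, deg \<Lambda> a) = a" using R by auto
  then have "ip_rng ?z = src \<Lambda> a"
    using inf_path_init(4)[of x "deg \<Lambda> a"] by (simp add: ip_rng_def shift_init)
  moreover have "x = prepend \<Lambda> a ?z" using R prepend_shift[of x a] by simp
  moreover have "y = prepend \<Lambda> b ?z" using R prepend_shift[of y b] by simp
  moreover have "?z \<in> inf_paths \<Lambda>" using R shift_inf_path by blast
  ultimately show ?L using R unfolding cylinder_def by blast
qed

text \<open>The common cocycle value makes the second degrees agree as well; then both pairs of
  labels are initial segments, of the same degrees, of the same two infinite paths. This is the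
  equal-or-disjoint dichotomy.\<close>

lemma cylinder_eqI:
  assumes "(a, b) \<in> pairs" "(c, d) \<in> pairs" "deg \<Lambda> a = deg \<Lambda> c"
    and "\<gamma> \<in> cylinder \<Lambda> a b" "\<gamma> \<in> cylinder \<Lambda> c d"
  shows "(a, b) = (c, d)"
proof -
  obtain x n y where g: "\<gamma> = (x, n, y)" by (cases \<gamma>)
  note m = assms(4)[unfolded g mem_cylinder[OF assms(1)]] assms(5)[unfolded g mem_cylinder[OF assms(2)]]
  have "deg \<Lambda> b = deg \<Lambda> d" using m assms(3) zdiff_cancel by metis
  then show ?thesis using m assms(3) by metis
qed

text \<open>The second path is forced: it is \<open>b\<close> followed by the tail of the first path
  after \<open>a\<close>. This makes the range fibres of indicators finite.\<close>

lemma cylinder_inj_rng: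
  assumes "(a, b) \<in> pairs" "\<gamma> \<in> cylinder \<Lambda> a b" "\<gamma>' \<in> cylinder \<Lambda> a b" "g_rng \<gamma> = g_rng \<gamma>'"
  shows "\<gamma> = \<gamma>'"
proof -
  obtain x n y x' n' y' where g: "\<gamma> = (x, n, y)" "\<gamma>' = (x', n', y')" by (cases \<gamma>, cases \<gamma>')
  have "x = x'" using assms(4) by (simp add: g g_rng_def)
  moreover have "y = y'"
    using assms(2,3) \<open>x = x'\<close> inf_path_eq_shiftI[of y y' "deg \<Lambda> b"]
    unfolding g mem_cylinder[OF assms(1)] by simp
  ultimately show ?thesis using assms(2,3) unfolding g mem_cylinder[OF assms(1)] by simp
qed

section \<open>Refinement of cylinder sets\<close>

abbreviation extensions :: "'a \<Rightarrow> nat^'k \<Rightarrow> 'a set" where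
  "extensions a m \<equiv> paths_from \<Lambda> (src \<Lambda> a) m"

lemma finite_extensions: "a \<in> mor \<Lambda> \<Longrightarrow> finite (extensions a m)"
  using row_finite src_verts by (simp add: row_finite_def)

lemma extensionsD:
  assumes "a \<in> mor \<Lambda>" "l \<in> extensions a m"
  shows "l \<in> mor \<Lambda>" "src \<Lambda> a = rng \<Lambda> l" "deg \<Lambda> l = m" "a \<cdot> l \<in> mor \<Lambda>" "src \<Lambda> (a \<cdot> l) = src \<Lambda> l"
    "rng \<Lambda> (a \<cdot> l) = rng \<Lambda> a" "deg \<Lambda> (a \<cdot> l) = deg \<Lambda> a + m"
  using assms by (auto simp: paths_from_def comp_mor src_comp rng_comp deg_comp)

lemma pairs_ext: "\<lbrakk>(a, b) \<in> pairs; l \<in> extensions a m\<rbrakk> \<Longrightarrow> (a \<cdot> l, b \<cdot> l) \<in> pairs"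
  using extensionsD[of a l m] extensionsD[of b l m] by (auto simp: pairs_def)

text \<open>The two paths share a tail after \<open>a\<close> and \<open>b\<close>, so its first
  piece of degree m extends both labels. The piece is named explicitly because the compactness proof
  has to identify it.\<close>

lemma cylinder_refine:
  assumes p: "(a, b) \<in> pairs" and g: "(x, n, y) \<in> cylinder \<Lambda> a b"
  shows "shift (deg \<Lambda> a) x (0, m) \<in> extensions a m"
    and "(x, n, y) \<in> cylinder \<Lambda> (a \<cdot> shift (deg \<Lambda> a) x (0, m)) (b \<cdot> shift (deg \<Lambda> a) x (0, m))"
proof -
  let ?z = "shift (deg \<Lambda> a) x"
  define l where "l = ?z (0, m)"
  note m = g[unfolded mem_cylinder[OF p]]
  have x: "x \<in> inf_paths \<Lambda>" and y: "y \<in> inf_paths \<Lambda>" using m by auto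
  have z: "?z \<in> inf_paths \<Lambda>" by (rule shift_inf_path[OF x])
  have "src \<Lambda> a = rng \<Lambda> l" using inf_path_init_add(2)[OF x, of "deg \<Lambda> a"] m by (simp add: l_def)
  then have l: "l \<in> extensions a m"
    using inf_path_init[OF z] by (simp add: paths_from_def l_def)
  have la: "deg \<Lambda> (a \<cdot> l) = deg \<Lambda> a + m" "deg \<Lambda> (b \<cdot> l) = deg \<Lambda> b + m"
    using extensionsD[of a l m] extensionsD[of b l m] l pairsD[OF p] by auto
  have "l = shift (deg \<Lambda> b) y (0, m)" using m by (simp add: l_def)
  then have "x (0, deg \<Lambda> a + m) = a \<cdot> l" "y (0, deg \<Lambda> b + m) = b \<cdot> l"
    using m inf_path_init_add(1)[OF x, of "deg \<Lambda> a" m] inf_path_init_add(1)[OF y, of "deg \<Lambda> b" m] l_def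
    by metis+
  then have "(x, n, y) \<in> cylinder \<Lambda> (a \<cdot> l) (b \<cdot> l)"
    unfolding mem_cylinder[OF pairs_ext[OF p l]]
    using m by (simp add: la zdiff_add_right shift_shift[symmetric])
  with l show "?z (0, m) \<in> extensions a m" "(x, n, y) \<in> cylinder \<Lambda> (a \<cdot> ?z (0, m)) (b \<cdot> ?z (0, m))"
    unfolding l_def .
qed

text \<open>Cancellation cuts both initial segments at \<open>a\<close> and \<open>b\<close>. The
  tails behind these agree because both start with \<open>l\<close> and coincide after it.\<close>

lemma cylinder_ext_subset:
  assumes p: "(a, b) \<in> pairs" and l: "l \<in> extensions a m"
  shows "cylinder \<Lambda> (a \<cdot> l) (b \<cdot> l) \<subseteq> cylinder \<Lambda> a b"
proof
  fix \<gamma> assume "\<gamma> \<in> cylinder \<Lambda> (a \<cdot> l) (b \<cdot> l)"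
  moreover obtain x n y where g: "\<gamma> = (x, n, y)" by (cases \<gamma>)
  ultimately have mm: "(x, n, y) \<in> cylinder \<Lambda> (a \<cdot> l) (b \<cdot> l)" by simp
  note M = mm[unfolded mem_cylinder[OF pairs_ext[OF p l]]]
  have x: "x \<in> inf_paths \<Lambda>" and y: "y \<in> inf_paths \<Lambda>" using M by auto
  note A = extensionsD[of a l m, OF _ l] 
  have lb: "l \<in> extensions b m" using l pairsD[OF p] by simp
  note B = extensionsD[of b l m, OF _ lb]
  have ab: "a \<in> mor \<Lambda>" "b \<in> mor \<Lambda>" using pairsD[OF p] by auto
  have xa: "x (0, deg \<Lambda> a) = a \<and> shift (deg \<Lambda> a) x (0, m) = l"
  proof -
    have "x (0, deg \<Lambda> a) \<cdot> shift (deg \<Lambda> a) x (0, m) = a \<cdot> l"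
      using M inf_path_init_add(1)[OF x, of "deg \<Lambda> a" m] A(7)[OF ab(1)] by simp
    with comp_inject[OF inf_path_init(1)[OF x] inf_path_init(1)[OF shift_inf_path[OF x]]
        inf_path_init_add(2)[OF x] ab(1) A(1)[OF ab(1)] A(2)[OF ab(1)] inf_path_init(2)[OF x]]
    show ?thesis by blast
  qed
  have yb: "y (0, deg \<Lambda> b) = b \<and> shift (deg \<Lambda> b) y (0, m) = l"
  proof -
    have "y (0, deg \<Lambda> b) \<cdot> shift (deg \<Lambda> b) y (0, m) = b \<cdot> l"
      using M inf_path_init_add(1)[OF y, of "deg \<Lambda> b" m] B(7)[OF ab(2)] by simp
    with comp_inject[OF inf_path_init(1)[OF y] inf_path_init(1)[OF shift_inf_path[OF y]]
        inf_path_init_add(2)[OF y] ab(2) B(1)[OF ab(2)] B(2)[OF ab(2)] inf_path_init(2)[OF y]]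
    show ?thesis by blast
  qed
  have "shift m (shift (deg \<Lambda> a) x) = shift m (shift (deg \<Lambda> b) y)"
    using M A(7)[OF ab(1)] B(7)[OF ab(2)] by (simp add: shift_shift)
  then have "shift (deg \<Lambda> a) x = shift (deg \<Lambda> b) y"
    using inf_path_eq_shiftI[OF shift_inf_path[OF x, of "deg \<Lambda> a"] shift_inf_path[OF y, of "deg \<Lambda> b"], of m]
      conjunct2[OF xa] conjunct2[OF yb] by metis
  then show "\<gamma> \<in> cylinder \<Lambda> a b"
    unfolding g mem_cylinder[OF p] using M xa yb A(7)[OF ab(1)] B(7)[OF ab(2)]
    by (simp add: zdiff_add_right)
qed

lemma cylinder_refine_ex:
  assumes "(a, b) \<in> pairs" "\<gamma> \<in> cylinder \<Lambda> a b"
  shows "\<exists>l\<in>extensions a m. \<gamma> \<in> cylinder \<Lambda> (a \<cdot> l) (b \<cdot> l)"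
proof -
  obtain x n y where "\<gamma> = (x, n, y)" by (cases \<gamma>)
  then show ?thesis using cylinder_refine[OF assms(1)] assms(2) by blast
qed

text \<open>Refine the coarser cylinder around the common point until its first degree is d(a); the
  piece obtained equals Z(a,b) by \<open>cylinder_eqI\<close>. So cylinders with comparable first
  degrees are nested or disjoint.\<close>

lemma cylinder_subsetI:
  assumes "(a, b) \<in> pairs" "(c, d) \<in> pairs" "deg \<Lambda> c \<le> deg \<Lambda> a"
    and "\<gamma> \<in> cylinder \<Lambda> a b" "\<gamma> \<in> cylinder \<Lambda> c d"
  shows "cylinder \<Lambda> a b \<subseteq> cylinder \<Lambda> c d"
proof -
  obtain m where m: "deg \<Lambda> a = deg \<Lambda> c + m" using assms(3) by (rule vec_nat_le_E)
  obtain l where l: "l \<in> extensions c m" "\<gamma> \<in> cylinder \<Lambda> (c \<cdot> l) (d \<cdot> l)"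
    using cylinder_refine_ex[OF assms(2,5)] by blast
  have "deg \<Lambda> (c \<cdot> l) = deg \<Lambda> a" using extensionsD(7)[OF _ l(1)] pairsD[OF assms(2)] m by simp
  then have "(c \<cdot> l, d \<cdot> l) = (a, b)"
    using cylinder_eqI[OF pairs_ext[OF assms(2) l(1)] assms(1) _ l(2) assms(4)] by simp
  then show ?thesis using cylinder_ext_subset[OF assms(2) l(1)] by simp
qed

lemma cylinder_subset_kgroupoid:
  assumes "(a, b) \<in> pairs"
  shows "cylinder \<Lambda> a b \<subseteq> kgroupoid \<Lambda>"
proof
  fix \<gamma> assume "\<gamma> \<in> cylinder \<Lambda> a b"
  moreover obtain x n y where "\<gamma> = (x, n, y)" by (cases \<gamma>)
  ultimately show "\<gamma> \<in> kgroupoid \<Lambda>"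
    using mem_cylinder[OF assms, of x n y] unfolding kgroupoid_def by blast
qed

text \<open>Shifts l, m that witness tail equivalence provide the labels x(0,l) and y(0,m); both end
  at the vertex where the common tail begins.\<close>

lemma kgroupoid_cylinderE:
  assumes "\<gamma> \<in> kgroupoid \<Lambda>"
  obtains a b where "(a, b) \<in> pairs" "\<gamma> \<in> cylinder \<Lambda> a b"
proof -
  obtain x n y l m where g: "\<gamma> = (x, n, y)" "x \<in> inf_paths \<Lambda>" "y \<in> inf_paths \<Lambda>"
    "n = zdiff l m" "shift l x = shift m y" using assms by (auto simp: kgroupoid_def)
  have "x (l, l) = y (m, m)" using g(5) shift_init[of l x 0] shift_init[of m y 0] by simp
  then have p: "(x (0, l), y (0, m)) \<in> pairs"
    using inf_path_init[OF g(2)] inf_path_init[OF g(3)] by (simp add: pairs_def)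
  then have "\<gamma> \<in> cylinder \<Lambda> (x (0, l)) (y (0, m))"
    using g inf_path_init(2) by (simp add: mem_cylinder)
  with p that show ?thesis by blast
qed

text \<open>Without sources a path can be extended by degree (1,...,1) indefinitely, which yields a
  chain of cofinal degrees. The resulting points in cylinders later separate coefficients.\<close>

lemma inf_path_ex:
  assumes "v \<in> verts \<Lambda>"
  shows "\<exists>x\<in>inf_paths \<Lambda>. x (0, 0) = v"
proof -
  have "\<exists>A. \<forall>i. (A i \<in> mor \<Lambda> \<and> deg \<Lambda> (A i) = const_vec i \<and> rng \<Lambda> (A i) = v) \<and> pfx (A i) (A (Suc i))"
  proof (rule dependent_nat_choice)
    have "const_vec 0 = (0 :: nat^'k)" by (simp add: const_vec_def vec_eq_iff)
    then show "\<exists>a. a \<in> mor \<Lambda> \<and> deg \<Lambda> a = const_vec 0 \<and> rng \<Lambda> a = v"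
      using assms by (intro exI[of _ v]) (simp add: verts_def rng_vertex)
  next
    fix a i assume a: "a \<in> mor \<Lambda> \<and> deg \<Lambda> a = const_vec i \<and> rng \<Lambda> a = v"
    then obtain l where l: "l \<in> extensions a (const_vec 1)"
      using no_sources src_verts by (fastforce simp: no_sources_def)
    then show "\<exists>b. (b \<in> mor \<Lambda> \<and> deg \<Lambda> b = const_vec (Suc i) \<and> rng \<Lambda> b = v) \<and> pfx a b"
      using a extensionsD[OF _ l] const_vec_Suc[where 'k = 'k, of i] by (intro exI[of _ "a \<cdot> l"]) (simp add: pfx_comp)
  qed
  then obtain A where A: "\<And>i. A i \<in> mor \<Lambda> \<and> deg \<Lambda> (A i) = const_vec i \<and> rng \<Lambda> (A i) = v"
    "\<And>i. pfx (A i) (A (Suc i))" by blast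
  have "\<exists>x\<in>inf_paths \<Lambda>. \<forall>i. x (0, deg \<Lambda> (A i)) = A i"
    by (rule chain_inf_path) (use A const_vec_le in simp_all)
  then obtain x where "x \<in> inf_paths \<Lambda>" "x (0, const_vec 0) = A 0" using A by metis
  then show ?thesis using A inf_path_init(3) by metis
qed

lemma cylinder_nonempty:
  assumes "(a, b) \<in> pairs"
  shows "cylinder \<Lambda> a b \<noteq> {}"
  using inf_path_ex[OF src_verts] pairsD[OF assms] unfolding cylinder_def ip_rng_def by blast

section \<open>The topology: cylinders are a basis of compact open and closed sets\<close>

abbreviation top_G :: "('a, 'k) gpd topology" where
  "top_G \<equiv> kgroupoid_top \<Lambda>"

lemma kgroupoid_top_eq: "kgroupoid_top \<Lambda> = topology_generated_by (Z ` pairs)"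
  unfolding kgroupoid_top_def
  by (rule arg_cong[where f = topology_generated_by]) (force simp: pairs_def)

lemma topspace_kgroupoid: "topspace top_G = kgroupoid \<Lambda>"
  unfolding kgroupoid_top_eq topology_generated_by_topspace
proof
  show "\<Union>(Z ` pairs) \<subseteq> kgroupoid \<Lambda>"
    using cylinder_subset_kgroupoid[of "fst p" "snd p" for p] by (simp add: UN_subset_iff)
  show "kgroupoid \<Lambda> \<subseteq> \<Union>(Z ` pairs)"
  proof
    fix \<gamma> assume "\<gamma> \<in> kgroupoid \<Lambda>"
    then obtain a b where "(a, b) \<in> pairs" "\<gamma> \<in> cylinder \<Lambda> a b" by (rule kgroupoid_cylinderE)
    then show "\<gamma> \<in> \<Union>(Z ` pairs)" by (intro UN_I[of "(a, b)"]) simp_all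
  qed
qed

lemma openin_cylinder: "p \<in> pairs \<Longrightarrow> openin top_G (Z p)"
  unfolding kgroupoid_top_eq by (rule topology_generated_by_Basis) blast

text \<open>The definition only makes the cylinders a subbasis. For an intersection, refining the
  first cylinder by d(c) around the point brings its degree above d(c), whence it lies inside the
  second one as well.\<close>

lemma open_contains_cylinder:
  assumes "openin top_G U" "\<gamma> \<in> U"
  obtains a b where "(a, b) \<in> pairs" "\<gamma> \<in> cylinder \<Lambda> a b" "cylinder \<Lambda> a b \<subseteq> U"
proof -
  have "generate_topology_on (Z ` pairs) U"
    using assms(1) unfolding kgroupoid_top_eq openin_topology_generated_by_iff .
  then have "\<exists>p\<in>pairs. \<gamma> \<in> Z p \<and> Z p \<subseteq> U" using assms(2)
  proof (induction arbitrary: \<gamma>)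
    case (Int U V)
    obtain p q where p: "p \<in> pairs" "\<gamma> \<in> Z p" "Z p \<subseteq> U" and q: "q \<in> pairs" "\<gamma> \<in> Z q" "Z q \<subseteq> V"
      using Int by blast
    obtain a b where ab: "p = (a, b)" by (cases p)
    obtain c d where cd: "q = (c, d)" by (cases q)
    obtain l where l: "l \<in> extensions a (deg \<Lambda> c)" "\<gamma> \<in> cylinder \<Lambda> (a \<cdot> l) (b \<cdot> l)"
      using cylinder_refine_ex[of a b \<gamma>] p(1,2) unfolding ab by auto
    have al: "(a \<cdot> l, b \<cdot> l) \<in> pairs" using p(1) l(1) unfolding ab by (rule pairs_ext)
    have "deg \<Lambda> c \<le> deg \<Lambda> (a \<cdot> l)"
      using extensionsD(7)[OF _ l(1)] pairsD[OF p(1)[unfolded ab]] vec_nat_le_add(2) by simp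
    then have "cylinder \<Lambda> (a \<cdot> l) (b \<cdot> l) \<subseteq> cylinder \<Lambda> c d"
      using cylinder_subsetI[OF al _ _ l(2)] q unfolding cd by simp
    moreover have "cylinder \<Lambda> (a \<cdot> l) (b \<cdot> l) \<subseteq> cylinder \<Lambda> a b"
      using p(1) l(1) unfolding ab by (rule cylinder_ext_subset)
    ultimately show ?case
      using al l(2) p(3) q(3) unfolding ab cd by (intro bexI[of _ "(a \<cdot> l, b \<cdot> l)"]) auto
  next
    case (UN K)
    then obtain k where "k \<in> K" "\<gamma> \<in> k" by blast
    with UN.IH[of k] show ?case by blast
  next
    case (Basis s)
    then show ?case by blast
  qed simp
  with that show ?thesis by force
qed

text \<open>A cylinder around the outside point, refined until its degree dominates d(a), must miss
  Z(a,b), since otherwise it would be contained in it.\<close>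

lemma closed_cylinder:
  assumes p: "(a, b) \<in> pairs" and g: "\<gamma> \<in> kgroupoid \<Lambda>" "\<gamma> \<notin> cylinder \<Lambda> a b"
  obtains U where "openin top_G U" "\<gamma> \<in> U" "U \<inter> cylinder \<Lambda> a b = {}"
proof -
  obtain c d where cd: "(c, d) \<in> pairs" "\<gamma> \<in> cylinder \<Lambda> c d" using g(1) by (rule kgroupoid_cylinderE)
  obtain l where l: "l \<in> extensions c (deg \<Lambda> a)" "\<gamma> \<in> cylinder \<Lambda> (c \<cdot> l) (d \<cdot> l)"
    using cylinder_refine_ex[OF cd] by blast
  have cl: "(c \<cdot> l, d \<cdot> l) \<in> pairs" using cd(1) l(1) by (rule pairs_ext)
  have le: "deg \<Lambda> a \<le> deg \<Lambda> (c \<cdot> l)"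
    using extensionsD(7)[OF _ l(1)] pairsD[OF cd(1)] vec_nat_le_add(2) by simp
  have "cylinder \<Lambda> (c \<cdot> l) (d \<cdot> l) \<inter> cylinder \<Lambda> a b = {}"
    using cylinder_subsetI[OF cl p le] l(2) g(2) by blast
  with that openin_cylinder[OF cl] l(2) show ?thesis by simp
qed

text \<open>Koenig's argument: if \<open>Z(a,b)\<close> has no finite subcover, then neither has
  \<open>Z(al,bl)\<close> for suitable ever longer \<open>l\<close>, whose limit is a point not covered.\<close>

lemma compactin_cylinder:
  assumes p: "(a, b) \<in> pairs"
  shows "compactin top_G (cylinder \<Lambda> a b)"
  unfolding compactin_def topspace_kgroupoid
proof (intro conjI allI impI cylinder_subset_kgroupoid[OF p])
  fix \<U> assume \<U>: "Ball \<U> (openin top_G) \<and> cylinder \<Lambda> a b \<subseteq> \<Union>\<U>"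
  have ab: "a \<in> mor \<Lambda>" "b \<in> mor \<Lambda>" "src \<Lambda> a = src \<Lambda> b" using pairsD[OF p] by auto
  \<comment> \<open>Badness is a property of the extension \<open>l\<close>, not of the pair of
    labels, so that the bad extensions form a prefix chain to which \<open>chain_inf_path\<close>
    applies.\<close>
  define bad where "bad l \<longleftrightarrow> l \<in> mor \<Lambda> \<and> rng \<Lambda> l = src \<Lambda> a \<and>
    \<not> (\<exists>\<F>. finite \<F> \<and> \<F> \<subseteq> \<U> \<and> cylinder \<Lambda> (a \<cdot> l) (b \<cdot> l) \<subseteq> \<Union>\<F>)" for l
  \<comment> \<open>By row-finiteness there are finitely many extensions of degree (1,...,1); finite
    subcovers for all of them would combine to one for the whole cylinder.\<close>
  have bad_step: "\<exists>e\<in>extensions l (const_vec 1). bad (l \<cdot> e)" if "bad l" for l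
  proof (rule ccontr)
    assume neg: "\<not> ?thesis"
    have l: "l \<in> mor \<Lambda>" "rng \<Lambda> l = src \<Lambda> a" using that by (auto simp: bad_def)
    have lx: "l \<in> extensions a (deg \<Lambda> l)" using l by (simp add: paths_from_def)
    have alp: "(a \<cdot> l, b \<cdot> l) \<in> pairs" by (rule pairs_ext[OF p lx])
    have se: "extensions (a \<cdot> l) m = extensions l m" for m
      using extensionsD(5)[OF ab(1) lx] by simp
    have "\<exists>\<F>. finite \<F> \<and> \<F> \<subseteq> \<U> \<and> cylinder \<Lambda> ((a \<cdot> l) \<cdot> e) ((b \<cdot> l) \<cdot> e) \<subseteq> \<Union>\<F>"
      if e: "e \<in> extensions l (const_vec 1)" for e
    proof -
      note E = extensionsD[OF l(1) e]
      have "(a \<cdot> l) \<cdot> e = a \<cdot> (l \<cdot> e)" "(b \<cdot> l) \<cdot> e = b \<cdot> (l \<cdot> e)"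
        using ab l E by (simp_all add: comp_assoc)
      then show ?thesis using neg e E l unfolding bad_def by auto
    qed
    then obtain \<F> where \<F>: "\<And>e. e \<in> extensions l (const_vec 1) \<Longrightarrow>
        finite (\<F> e) \<and> \<F> e \<subseteq> \<U> \<and> cylinder \<Lambda> ((a \<cdot> l) \<cdot> e) ((b \<cdot> l) \<cdot> e) \<subseteq> \<Union>(\<F> e)" by metis
    let ?\<G> = "\<Union>e\<in>extensions l (const_vec 1). \<F> e"
    have "finite ?\<G>" using finite_extensions[OF l(1)] \<F> by blast
    moreover have "?\<G> \<subseteq> \<U>" using \<F> by blast
    moreover have "cylinder \<Lambda> (a \<cdot> l) (b \<cdot> l) \<subseteq> \<Union>?\<G>"
    proof
      fix \<gamma> assume "\<gamma> \<in> cylinder \<Lambda> (a \<cdot> l) (b \<cdot> l)"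
      from cylinder_refine_ex[OF alp this, of "const_vec 1"]
      obtain e where "e \<in> extensions (a \<cdot> l) (const_vec 1)" "\<gamma> \<in> cylinder \<Lambda> ((a \<cdot> l) \<cdot> e) ((b \<cdot> l) \<cdot> e)"
        by (elim bexE)
      then show "\<gamma> \<in> \<Union>?\<G>" using \<F>[of e] by (auto simp only: se)
    qed
    ultimately show False using that unfolding bad_def by blast
  qed
  show "\<exists>\<F>. finite \<F> \<and> \<F> \<subseteq> \<U> \<and> cylinder \<Lambda> a b \<subseteq> \<Union>\<F>"
  proof (rule ccontr)
    assume "\<not> ?thesis"
    then have bad0: "bad (src \<Lambda> a)"
      using ab comp_src[OF ab(1)] comp_src[OF ab(2)] by (simp add: bad_def src_mor rng_src)
    have "\<exists>A. \<forall>i. (bad (A i) \<and> deg \<Lambda> (A i) = const_vec i) \<and> pfx (A i) (A (Suc i))"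
    proof (rule dependent_nat_choice)
      have "const_vec 0 = (0 :: nat^'k)" by (simp add: const_vec_def vec_eq_iff)
      then show "\<exists>l. bad l \<and> deg \<Lambda> l = const_vec 0"
        using bad0 deg_src[OF ab(1)] by (intro exI[of _ "src \<Lambda> a"]) simp
    next
      fix l i assume l: "bad l \<and> deg \<Lambda> l = const_vec i"
      then have lm: "l \<in> mor \<Lambda>" by (simp add: bad_def)
      obtain e where e: "e \<in> extensions l (const_vec 1)" "bad (l \<cdot> e)" using bad_step l by blast
      then show "\<exists>l'. (bad l' \<and> deg \<Lambda> l' = const_vec (Suc i)) \<and> pfx l l'"
        using l extensionsD[OF lm e(1)] lm const_vec_Suc[where 'k = 'k, of i]
        by (intro exI[of _ "l \<cdot> e"]) (simp add: pfx_comp)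
    qed
    then obtain A where A: "\<And>i. bad (A i)" "\<And>i. deg \<Lambda> (A i) = const_vec i"
      "\<And>i. pfx (A i) (A (Suc i))" by blast
    have "\<exists>z\<in>inf_paths \<Lambda>. \<forall>i. z (0, deg \<Lambda> (A i)) = A i"
      by (rule chain_inf_path) (use A const_vec_le in simp_all)
    then obtain z where z: "z \<in> inf_paths \<Lambda>" "\<And>i. z (0, const_vec i) = A i" using A(2) by metis
    have zr: "ip_rng z = src \<Lambda> a"
      using inf_path_init(3)[OF z(1), of "const_vec 0"] z(2) A(1)[of 0] by (simp add: bad_def ip_rng_def)
    let ?x = "prepend \<Lambda> a z" and ?n = "zdiff (deg \<Lambda> a) (deg \<Lambda> b)" and ?y = "prepend \<Lambda> b z"
    have g: "(?x, ?n, ?y) \<in> cylinder \<Lambda> a b" using z(1) zr unfolding cylinder_def by blast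
    have gi: "(?x, ?n, ?y) \<in> cylinder \<Lambda> (a \<cdot> A i) (b \<cdot> A i)" "A i \<in> extensions a (const_vec i)" for i
      using cylinder_refine[OF p g, of "const_vec i"] shift_prepend[OF ab(1) z(1) zr] z(2)[of i] by simp_all
    obtain U where U: "U \<in> \<U>" "(?x, ?n, ?y) \<in> U" using g \<U> by blast
    have "openin top_G U" using U(1) \<U> by blast
    then obtain c d where cd: "(c, d) \<in> pairs" "(?x, ?n, ?y) \<in> cylinder \<Lambda> c d" "cylinder \<Lambda> c d \<subseteq> U"
      using U(2) by (rule open_contains_cylinder)
    \<comment> \<open>Once (i,...,i) dominates d(c), the supposedly bad cylinder around the limit
      point fits into the single cover member \<open>U\<close>.\<close>
    obtain i where i: "deg \<Lambda> c \<le> const_vec i" using const_vec_le by blast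
    have "deg \<Lambda> c \<le> deg \<Lambda> (a \<cdot> A i)"
      using order_trans[OF i vec_nat_le_add(2)] extensionsD(7)[OF ab(1) gi(2)] by simp
    then have "cylinder \<Lambda> (a \<cdot> A i) (b \<cdot> A i) \<subseteq> cylinder \<Lambda> c d"
      using cylinder_subsetI[OF pairs_ext[OF p gi(2)] cd(1) _ gi(1) cd(2)] by blast
    then have "cylinder \<Lambda> (a \<cdot> A i) (b \<cdot> A i) \<subseteq> \<Union>{U}" using cd(3) by simp
    moreover have "finite {U}" "{U} \<subseteq> \<U>" using U by auto
    ultimately show False using A(1)[of i] unfolding bad_def by blast
  qed
qed

end


section \<open>Spans of complex functions\<close>

text \<open>The scaling is the scalar action of \<open>groupoid_algebra\<close>, so that the carrier
  of that algebra is literally a span.\<close>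

interpretation fun_space: vector_space "\<lambda>(c :: complex) (f :: 'x \<Rightarrow> complex) x. c * f x"
  by standard (simp_all add: fun_eq_iff algebra_simps)

lemma sum_fun_eq: "(\<Sum>i\<in>I. f i) = (\<lambda>x. \<Sum>i\<in>I. (f i :: 'x \<Rightarrow> complex) x)"
  by (induction I rule: infinite_finite_induct) (simp_all add: fun_eq_iff)


section \<open>Convolution\<close>

context k_graph
begin

lemma g_mult_inv_kgroupoid:
  assumes "\<alpha> \<in> kgroupoid \<Lambda>" "\<gamma> \<in> kgroupoid \<Lambda>" "g_rng \<alpha> = g_rng \<gamma>"
  shows "g_mult (g_inv \<alpha>) \<gamma> \<in> kgroupoid \<Lambda>"
proof -
  obtain x l p y where a: "\<alpha> = (x, zdiff l p, y)" "x \<in> inf_paths \<Lambda>" "y \<in> inf_paths \<Lambda>"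
    "shift l x = shift p y" using assms(1) by (auto simp: kgroupoid_def)
  obtain l' p' z where g: "\<gamma> = (x, zdiff l' p', z)" "z \<in> inf_paths \<Lambda>" "shift l' x = shift p' z"
    using assms(2,3) a(1) by (auto simp: kgroupoid_def g_rng_def)
  \<comment> \<open>Both sides equal the tail of x at depth l + l', where the two given tail
    equivalences can be compared.\<close>
  have "shift (p + l') y = shift (p' + l) z"
    using a(4) g(3) shift_shift[of l' p y] shift_shift[of l' l x] shift_shift[of l l' x]
      shift_shift[of l p' z] by (simp add: add.commute)
  moreover have "- zdiff l p + zdiff l' p' = zdiff (p + l') (p' + l)"
    by (simp add: zdiff_def vec_eq_iff)
  ultimately show ?thesis
    using a g unfolding kgroupoid_def by (auto simp: g_mult_def g_inv_def)
qed

lemma g_mult_kgroupoid: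
  assumes "\<alpha> \<in> kgroupoid \<Lambda>" "\<beta> \<in> kgroupoid \<Lambda>" "g_rng \<beta> = snd (snd \<alpha>)"
  shows "g_mult \<alpha> \<beta> \<in> kgroupoid \<Lambda>"
proof -
  have "g_inv \<alpha> \<in> kgroupoid \<Lambda>" using assms(1)
    by (force simp: kgroupoid_def g_inv_def zdiff_swap)
  moreover have "g_rng (g_inv \<alpha>) = g_rng \<beta>"
    using assms(3) by (simp add: g_inv_def g_rng_def split: prod.splits)
  ultimately have "g_mult (g_inv (g_inv \<alpha>)) \<beta> \<in> kgroupoid \<Lambda>"
    using g_mult_inv_kgroupoid assms(2) by blast
  moreover have "g_inv (g_inv \<alpha>) = \<alpha>" by (cases \<alpha>) (simp add: g_inv_def)
  ultimately show ?thesis by simp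
qed

text \<open>The class on which the sum in \<open>kg_conv\<close> is finite. It is purely algebraic,
  contains all indicators of cylinders and is a subspace, which suffices for all elements of
  A(G).\<close>

definition fibre_finite :: "(('a, 'k) gpd \<Rightarrow> complex) set" where
  "fibre_finite = {f. (\<forall>\<gamma>. f \<gamma> \<noteq> 0 \<longrightarrow> \<gamma> \<in> kgroupoid \<Lambda>) \<and> (\<forall>x. finite {\<alpha>. g_rng \<alpha> = x \<and> f \<alpha> \<noteq> 0})}"

text \<open>The set S may exceed the support, so that convolutions by several functions can be
  summed over one common set.\<close>

lemma kg_conv_eq_sum:
  assumes "f \<in> fibre_finite" "\<gamma> \<in> kgroupoid \<Lambda>" "finite S"
    and "{\<alpha>. g_rng \<alpha> = g_rng \<gamma> \<and> f \<alpha> \<noteq> 0} \<subseteq> S" "\<And>\<alpha>. \<alpha> \<in> S \<Longrightarrow> g_rng \<alpha> = g_rng \<gamma>"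
  shows "kg_conv \<Lambda> f g \<gamma> = (\<Sum>\<alpha>\<in>S. f \<alpha> * g (g_mult (g_inv \<alpha>) \<gamma>))"
proof -
  have "(\<Sum>\<^sub>\<infinity>\<alpha>\<in>{\<alpha> \<in> kgroupoid \<Lambda>. g_rng \<alpha> = g_rng \<gamma>}. f \<alpha> * g (g_mult (g_inv \<alpha>) \<gamma>)) =
      (\<Sum>\<^sub>\<infinity>\<alpha>\<in>S. f \<alpha> * g (g_mult (g_inv \<alpha>) \<gamma>))"
    by (rule infsum_cong_neutral) (use assms in \<open>auto simp: fibre_finite_def simp del: split_paired_All\<close>)
  then show ?thesis using assms(2,3) by (simp add: kg_conv_def)
qed

lemma kg_conv_outside: "\<gamma> \<notin> kgroupoid \<Lambda> \<Longrightarrow> kg_conv \<Lambda> f g \<gamma> = 0"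
  by (simp add: kg_conv_def)

lemma fibre_finite_fibre: "f \<in> fibre_finite \<Longrightarrow> finite {\<alpha>. g_rng \<alpha> = x \<and> f \<alpha> \<noteq> 0}"
  by (simp add: fibre_finite_def)

lemma fibre_finite_mem: "f \<in> fibre_finite \<Longrightarrow> f \<gamma> \<noteq> 0 \<Longrightarrow> \<gamma> \<in> kgroupoid \<Lambda>"
  unfolding fibre_finite_def by blast

lemma subspace_fibre_finite: "fun_space.subspace fibre_finite"
proof (rule fun_space.subspaceI)
  show "0 \<in> fibre_finite" by (simp add: fibre_finite_def)
next
  fix f g assume fg: "f \<in> fibre_finite" "g \<in> fibre_finite"
  have "finite {\<alpha>. g_rng \<alpha> = x \<and> (f + g) \<alpha> \<noteq> 0}" for x
    by (rule finite_subset[OF _ finite_UnI[OF fg[THEN fibre_finite_fibre, of x]]]) auto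
  moreover have "\<gamma> \<in> kgroupoid \<Lambda>" if "(f + g) \<gamma> \<noteq> 0" for \<gamma>
    using that fg[THEN fibre_finite_mem, of \<gamma>] by fastforce
  ultimately show "f + g \<in> fibre_finite" by (simp add: fibre_finite_def)
next
  fix c f assume f: "f \<in> fibre_finite"
  have "finite {\<alpha>. g_rng \<alpha> = x \<and> c * f \<alpha> \<noteq> 0}" for x
    by (rule finite_subset[OF _ fibre_finite_fibre[OF f, of x]]) auto
  then show "(\<lambda>x. c * f x) \<in> fibre_finite" using f by (simp add: fibre_finite_def)
qed

lemma kg_conv_add_left:
  assumes "f \<in> fibre_finite" "g \<in> fibre_finite"
  shows "kg_conv \<Lambda> (f + g) h = kg_conv \<Lambda> f h + kg_conv \<Lambda> g h"
proof
  fix \<gamma>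
  show "kg_conv \<Lambda> (f + g) h \<gamma> = (kg_conv \<Lambda> f h + kg_conv \<Lambda> g h) \<gamma>"
  proof (cases "\<gamma> \<in> kgroupoid \<Lambda>")
    case True
    let ?S = "{\<alpha>. g_rng \<alpha> = g_rng \<gamma> \<and> f \<alpha> \<noteq> 0} \<union> {\<alpha>. g_rng \<alpha> = g_rng \<gamma> \<and> g \<alpha> \<noteq> 0}"
    have S: "finite ?S" using assms[THEN fibre_finite_fibre] by blast
    have "f + g \<in> fibre_finite" by (rule fun_space.subspace_add[OF subspace_fibre_finite assms])
    note conv = this[THEN kg_conv_eq_sum[OF _ True S]] assms[THEN kg_conv_eq_sum[OF _ True S]]
    show ?thesis
      by (subst conv, force, force, simp, subst conv, force, force, subst conv, force, force)
        (simp add: sum.distrib[symmetric] distrib_right)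
  qed (simp add: kg_conv_outside)
qed

lemma kg_conv_scale_left:
  assumes "f \<in> fibre_finite"
  shows "kg_conv \<Lambda> (\<lambda>x. c * f x) h = (\<lambda>x. c * kg_conv \<Lambda> f h x)"
proof
  fix \<gamma>
  show "kg_conv \<Lambda> (\<lambda>x. c * f x) h \<gamma> = c * kg_conv \<Lambda> f h \<gamma>"
  proof (cases "\<gamma> \<in> kgroupoid \<Lambda>")
    case True
    let ?S = "{\<alpha>. g_rng \<alpha> = g_rng \<gamma> \<and> f \<alpha> \<noteq> 0}"
    have S: "finite ?S" using assms by (rule fibre_finite_fibre)
    have "(\<lambda>x. c * f x) \<in> fibre_finite" by (rule fun_space.subspace_scale[OF subspace_fibre_finite assms])
    note conv = this[THEN kg_conv_eq_sum[OF _ True S]] assms[THEN kg_conv_eq_sum[OF _ True S]]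
    show ?thesis
      by (subst conv, force, force, subst conv, force, force)
        (simp add: sum_distrib_left mult.assoc)
  qed (simp add: kg_conv_outside)
qed

text \<open>Every term carries a factor f \<alpha>, so the fibres of f alone bound the sum and the
  right factor may be arbitrary.\<close>

lemma kg_conv_right:
  assumes "f \<in> fibre_finite"
  shows kg_conv_add_right: "kg_conv \<Lambda> f (g + h) = kg_conv \<Lambda> f g + kg_conv \<Lambda> f h"
    and kg_conv_scale_right: "kg_conv \<Lambda> f (\<lambda>x. c * g x) = (\<lambda>x. c * kg_conv \<Lambda> f g x)"
proof -
  have eq: "kg_conv \<Lambda> f g \<gamma> = (if \<gamma> \<in> kgroupoid \<Lambda> then
      \<Sum>\<alpha> | g_rng \<alpha> = g_rng \<gamma> \<and> f \<alpha> \<noteq> 0. f \<alpha> * g (g_mult (g_inv \<alpha>) \<gamma>) else 0)" for g \<gamma>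
    by (auto simp: kg_conv_outside intro: kg_conv_eq_sum[OF assms _ fibre_finite_fibre[OF assms]])
  show "kg_conv \<Lambda> f (g + h) = kg_conv \<Lambda> f g + kg_conv \<Lambda> f h"
    by (rule ext) (simp add: eq sum.distrib distrib_left)
  show "kg_conv \<Lambda> f (\<lambda>x. c * g x) = (\<lambda>x. c * kg_conv \<Lambda> f g x)"
    by (rule ext) (simp add: eq sum_distrib_left mult_ac)
qed

lemma kg_conv_zero: "kg_conv \<Lambda> 0 f = 0" "kg_conv \<Lambda> f 0 = 0"
  by (auto simp: kg_conv_def fun_eq_iff)

lemma kg_conv_sum_left:
  assumes "\<And>i. i \<in> I \<Longrightarrow> f i \<in> fibre_finite"
  shows "kg_conv \<Lambda> (\<Sum>i\<in>I. f i) h = (\<Sum>i\<in>I. kg_conv \<Lambda> (f i) h)"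
  using assms
  by (induction I rule: infinite_finite_induct)
    (simp_all add: kg_conv_zero kg_conv_add_left fun_space.subspace_sum[OF subspace_fibre_finite])

lemma kg_conv_sum_right:
  assumes "f \<in> fibre_finite"
  shows "kg_conv \<Lambda> f (\<Sum>i\<in>I. g i) = (\<Sum>i\<in>I. kg_conv \<Lambda> f (g i))"
  by (induction I rule: infinite_finite_induct) (simp_all only: sum.infinite sum.empty sum.insert kg_conv_zero kg_conv_add_right[OF assms] not_False_eq_True)

text \<open>After exchanging the order of summation, the inner sum over \<delta> = \<alpha>\<beta>
  for fixed \<alpha> is a convolution of g and h, reindexed by left translation.\<close>

lemma kg_conv_assoc:
  assumes f: "f \<in> fibre_finite" and g: "g \<in> fibre_finite"
  shows "kg_conv \<Lambda> (kg_conv \<Lambda> f g) h = kg_conv \<Lambda> f (kg_conv \<Lambda> g h)"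
proof
  fix \<gamma>
  show "kg_conv \<Lambda> (kg_conv \<Lambda> f g) h \<gamma> = kg_conv \<Lambda> f (kg_conv \<Lambda> g h) \<gamma>"
  proof (cases "\<gamma> \<in> kgroupoid \<Lambda>")
    case \<gamma>: True
    define F where "F x = {\<alpha>. g_rng \<alpha> = x \<and> f \<alpha> \<noteq> 0}" for x
    define G where "G \<alpha> = {\<beta>. g_rng \<beta> = snd (snd \<alpha>) \<and> g \<beta> \<noteq> 0}" for \<alpha> :: "('a, 'k) gpd"
    \<comment> \<open>A finite set containing the support of the product of f and g over x: all
      products of an \<alpha> from the support of f with a composable \<beta> from that of
      g.\<close>
    define S where "S x = (\<lambda>(\<alpha>, \<beta>). g_mult \<alpha> \<beta>) ` Sigma (F x) G" for x
    have fin: "finite (F x)" "finite (G \<alpha>)" for x \<alpha>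
      using f g by (simp_all add: F_def G_def fibre_finite_fibre)
    then have finS: "finite (S x)" for x by (simp add: S_def)
    have FG: "\<alpha> \<in> F x \<Longrightarrow> \<alpha> \<in> kgroupoid \<Lambda>" "\<beta> \<in> G \<alpha> \<Longrightarrow> \<beta> \<in> kgroupoid \<Lambda>" for x \<alpha> \<beta>
      using f g by (auto simp: F_def G_def fibre_finite_mem)
    have grp: "g_rng (g_mult \<alpha> \<beta>) = g_rng \<alpha>" "g_rng (g_mult (g_inv \<alpha>) \<beta>) = snd (snd \<alpha>)"
      for \<alpha> \<beta> :: "('a, 'k) gpd"
      by (simp_all add: g_mult_def g_inv_def g_rng_def split: prod.splits)
    have inv_mult: "g_mult (g_inv (g_mult \<alpha> \<beta>)) \<gamma> = g_mult (g_inv \<beta>) (g_mult (g_inv \<alpha>) \<gamma>)"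
      for \<alpha> \<beta> \<gamma> :: "('a, 'k) gpd"
      by (simp add: g_mult_def g_inv_def split: prod.splits)
    have mult_inv: "g_mult \<alpha> (g_mult (g_inv \<alpha>) \<delta>) = \<delta>" if "g_rng \<alpha> = g_rng \<delta>"
      for \<alpha> \<delta> :: "('a, 'k) gpd"
      using that by (simp add: g_mult_def g_inv_def g_rng_def split: prod.splits)
    have inv_mult': "g_mult (g_inv \<alpha>) (g_mult \<alpha> \<beta>) = \<beta>" if "g_rng \<beta> = snd (snd \<alpha>)"
      for \<alpha> \<beta> :: "('a, 'k) gpd"
      using that by (simp add: g_mult_def g_inv_def g_rng_def split: prod.splits)
    have conv_f: "kg_conv \<Lambda> f k \<delta> = (\<Sum>\<alpha>\<in>F (g_rng \<delta>). f \<alpha> * k (g_mult (g_inv \<alpha>) \<delta>))"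
      if "\<delta> \<in> kgroupoid \<Lambda>" for k \<delta>
      by (rule kg_conv_eq_sum[OF f that fin(1)]) (auto simp: F_def)
    have fg_supp: "\<delta> \<in> S (g_rng \<delta>)" if "kg_conv \<Lambda> f g \<delta> \<noteq> 0" for \<delta>
    proof -
      have \<delta>: "\<delta> \<in> kgroupoid \<Lambda>" using that kg_conv_outside by blast
      obtain \<alpha> where \<alpha>: "\<alpha> \<in> F (g_rng \<delta>)" "g (g_mult (g_inv \<alpha>) \<delta>) \<noteq> 0"
        using \<open>kg_conv \<Lambda> f g \<delta> \<noteq> 0\<close> unfolding conv_f[OF \<delta>]
        by (metis (mono_tags, lifting) mult_zero_right sum.neutral)
      then have "g_mult (g_inv \<alpha>) \<delta> \<in> G \<alpha>" by (simp add: G_def grp(2))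
      moreover have "\<delta> = g_mult \<alpha> (g_mult (g_inv \<alpha>) \<delta>)" using \<alpha>(1) mult_inv by (simp add: F_def)
      ultimately show ?thesis using \<alpha>(1) unfolding S_def by (intro image_eqI[of _ _ "(\<alpha>, _)"]) auto
    qed
    have S_rng: "\<delta> \<in> S x \<Longrightarrow> g_rng \<delta> = x \<and> \<delta> \<in> kgroupoid \<Lambda>" for \<delta> x
      using FG by (auto simp: S_def F_def G_def grp intro!: g_mult_kgroupoid)
    have sub: "{\<alpha>. g_rng \<alpha> = x \<and> kg_conv \<Lambda> f g \<alpha> \<noteq> 0} \<subseteq> S x" for x using fg_supp by auto
    have fg: "kg_conv \<Lambda> f g \<in> fibre_finite"
      using finite_subset[OF sub finS] kg_conv_outside unfolding fibre_finite_def by blast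
    have inner: "(\<Sum>\<delta>\<in>S (g_rng \<gamma>). g (g_mult (g_inv \<alpha>) \<delta>) * h (g_mult (g_inv \<delta>) \<gamma>)) =
        kg_conv \<Lambda> g h (g_mult (g_inv \<alpha>) \<gamma>)" if \<alpha>: "\<alpha> \<in> F (g_rng \<gamma>)" for \<alpha>
    proof -
      have "g_mult (g_inv \<alpha>) \<gamma> \<in> kgroupoid \<Lambda>"
        using \<alpha> FG(1)[OF \<alpha>] \<gamma> by (intro g_mult_inv_kgroupoid) (auto simp: F_def)
      then have "kg_conv \<Lambda> g h (g_mult (g_inv \<alpha>) \<gamma>) =
          (\<Sum>\<beta>\<in>G \<alpha>. g \<beta> * h (g_mult (g_inv \<beta>) (g_mult (g_inv \<alpha>) \<gamma>)))"
        by (rule kg_conv_eq_sum[OF g _ fin(2)]) (auto simp: G_def grp(2))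
      \<comment> \<open>Translation by \<alpha> is a bijection from \<open>G \<alpha>\<close> onto
        those \<delta> at which the factor g does not vanish; the excluded \<delta> contribute
        0.\<close>
      also have "\<dots> = (\<Sum>\<delta>\<in>S (g_rng \<gamma>). g (g_mult (g_inv \<alpha>) \<delta>) * h (g_mult (g_inv \<delta>) \<gamma>))"
      proof (rule sum.reindex_bij_witness_not_neutral
          [where S' = "{}" and T' = "{\<delta> \<in> S (g_rng \<gamma>). g (g_mult (g_inv \<alpha>) \<delta>) = 0}"
            and i = "\<lambda>\<delta>. g_mult (g_inv \<alpha>) \<delta>" and j = "\<lambda>\<beta>. g_mult \<alpha> \<beta>"])
        fix \<beta> assume \<beta>: "\<beta> \<in> G \<alpha> - {}"
        then have b: "g_rng \<beta> = snd (snd \<alpha>)" "g \<beta> \<noteq> 0" by (auto simp: G_def)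
        show "g_mult (g_inv \<alpha>) (g_mult \<alpha> \<beta>) = \<beta>" by (rule inv_mult'[OF b(1)])
        show "g_mult \<alpha> \<beta> \<in> S (g_rng \<gamma>) - {\<delta> \<in> S (g_rng \<gamma>). g (g_mult (g_inv \<alpha>) \<delta>) = 0}"
          using \<alpha> \<beta> b by (auto simp: S_def inv_mult')
      next
        fix \<beta> assume "\<beta> \<in> G \<alpha>"
        then have b: "g_rng \<beta> = snd (snd \<alpha>)" by (auto simp: G_def)
        show "g (g_mult (g_inv \<alpha>) (g_mult \<alpha> \<beta>)) * h (g_mult (g_inv (g_mult \<alpha> \<beta>)) \<gamma>) =
            g \<beta> * h (g_mult (g_inv \<beta>) (g_mult (g_inv \<alpha>) \<gamma>))"
          using b by (simp add: inv_mult inv_mult')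
      next
        fix \<delta> assume \<delta>: "\<delta> \<in> S (g_rng \<gamma>) - {\<delta> \<in> S (g_rng \<gamma>). g (g_mult (g_inv \<alpha>) \<delta>) = 0}"
        then have "g_rng \<delta> = g_rng \<gamma>" using S_rng by blast
        then show "g_mult \<alpha> (g_mult (g_inv \<alpha>) \<delta>) = \<delta>" using \<alpha> by (intro mult_inv) (simp add: F_def)
        show "g_mult (g_inv \<alpha>) \<delta> \<in> G \<alpha> - {}" using \<delta> by (auto simp: G_def grp(2))
      qed (auto simp: finS fin)
      finally show ?thesis ..
    qed
    have "kg_conv \<Lambda> (kg_conv \<Lambda> f g) h \<gamma> =
        (\<Sum>\<delta>\<in>S (g_rng \<gamma>). kg_conv \<Lambda> f g \<delta> * h (g_mult (g_inv \<delta>) \<gamma>))"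
      by (rule kg_conv_eq_sum[OF fg \<gamma> finS sub]) (use S_rng in blast)
    also have "\<dots> = (\<Sum>\<delta>\<in>S (g_rng \<gamma>). \<Sum>\<alpha>\<in>F (g_rng \<gamma>).
        f \<alpha> * (g (g_mult (g_inv \<alpha>) \<delta>) * h (g_mult (g_inv \<delta>) \<gamma>)))"
      by (rule sum.cong) (use S_rng conv_f in \<open>simp_all add: sum_distrib_right mult.assoc\<close>)
    also have "\<dots> = (\<Sum>\<alpha>\<in>F (g_rng \<gamma>). f \<alpha> * kg_conv \<Lambda> g h (g_mult (g_inv \<alpha>) \<gamma>))"
      by (subst sum.swap) (simp add: sum_distrib_left[symmetric] inner)
    also have "\<dots> = kg_conv \<Lambda> f (kg_conv \<Lambda> g h) \<gamma>" using conv_f[OF \<gamma>] by simp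
    finally show ?thesis .
  qed (simp add: kg_conv_outside)
qed

end


section \<open>The algebra of the path groupoid\<close>

lemma locally_constant_preimage:
  assumes "locally_constant_map T f"
  shows "openin T {x \<in> topspace T. f x \<in> V}"
proof (subst openin_subopen, intro ballI)
  fix x assume x: "x \<in> {x \<in> topspace T. f x \<in> V}"
  then obtain U where U: "openin T U" "x \<in> U" "\<forall>y\<in>U. f y = f x"
    using assms unfolding locally_constant_map_def by blast
  have "U \<subseteq> {x \<in> topspace T. f x \<in> V}"
  proof
    fix y assume "y \<in> U"
    then have "f y = f x" "y \<in> topspace T" using U openin_subset by blast+
    then show "y \<in> {x \<in> topspace T. f x \<in> V}" using x by simp
  qed
  then show "\<exists>U. openin T U \<and> x \<in> U \<and> U \<subseteq> {x \<in> topspace T. f x \<in> V}" using U by blast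
qed

lemma locally_constant_continuous: "locally_constant_map T f \<Longrightarrow> continuous_map T euclidean f"
  unfolding continuous_map_def by (auto intro: locally_constant_preimage)

text \<open>The zero set is a preimage, hence open. The compactness demanded of the closure in
  \<open>Cc\<close> is thus compactness of the support itself.\<close>

lemma locally_constant_closed_support:
  assumes "locally_constant_map T f" "{x. f x \<noteq> 0} \<subseteq> topspace T"
  shows "closedin T {x. f x \<noteq> 0}"
proof -
  have "topspace T - {x. f x \<noteq> 0} = {x \<in> topspace T. f x \<in> {0}}" by auto
  with locally_constant_preimage[OF assms(1), of "{0}"] assms(2) show ?thesis
    by (simp add: closedin_def)
qed

context source_free_k_graph
begin

definition ind :: "'a \<times> 'a \<Rightarrow> ('a, 'k) gpd \<Rightarrow> complex" where
  "ind p = indicator (Z p)"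

lemma ind_apply: "ind (a, b) \<gamma> = (if \<gamma> \<in> cylinder \<Lambda> a b then 1 else 0)"
  by (simp add: ind_def indicator_def)

text \<open>The range map is injective on a cylinder, so each fibre meets it in at most one point,
  which the choice operator names.\<close>

lemma ind_fibre_finite:
  assumes "p \<in> pairs"
  shows "ind p \<in> fibre_finite"
proof -
  obtain a b where p: "p = (a, b)" by (cases p)
  have "{\<alpha>. g_rng \<alpha> = x \<and> ind p \<alpha> \<noteq> 0} \<subseteq> {SOME \<alpha>. \<alpha> \<in> cylinder \<Lambda> a b \<and> g_rng \<alpha> = x}" for x
  proof
    fix \<alpha> assume "\<alpha> \<in> {\<alpha>. g_rng \<alpha> = x \<and> ind p \<alpha> \<noteq> 0}"
    then have \<alpha>: "\<alpha> \<in> cylinder \<Lambda> a b" "g_rng \<alpha> = x" by (auto simp: p ind_apply split: if_splits)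
    show "\<alpha> \<in> {SOME \<alpha>. \<alpha> \<in> cylinder \<Lambda> a b \<and> g_rng \<alpha> = x}"
      using someI[of "\<lambda>\<alpha>. \<alpha> \<in> cylinder \<Lambda> a b \<and> g_rng \<alpha> = x", OF conjI[OF \<alpha>]]
        cylinder_inj_rng[OF assms[unfolded p] \<alpha>(1)] \<alpha>(2) by simp
  qed
  then have "finite {\<alpha>. g_rng \<alpha> = x \<and> ind p \<alpha> \<noteq> 0}" for x
    by (rule finite_subset) simp
  moreover have "\<gamma> \<in> kgroupoid \<Lambda>" if "ind p \<gamma> \<noteq> 0" for \<gamma>
    using that cylinder_subset_kgroupoid[OF assms[unfolded p]]
    by (auto simp: p ind_apply split: if_splits)
  ultimately show ?thesis unfolding fibre_finite_def by blast
qed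

text \<open>Exactly one piece contains a given point: the left degrees agree, so two such pieces
  have equal left labels, and \<open>a\<close> cancels. On the algebra side
  \<open>unit_elt_refine\<close> is the matching identity.\<close>

lemma ind_refine:
  assumes "(a, b) \<in> pairs"
  shows "ind (a, b) = (\<Sum>l\<in>extensions a m. ind (a \<cdot> l, b \<cdot> l))"
proof
  fix \<gamma>
  have fin: "finite (extensions a m)" using pairsD[OF assms] by (simp add: finite_extensions)
  show "ind (a, b) \<gamma> = (\<Sum>l\<in>extensions a m. ind (a \<cdot> l, b \<cdot> l)) \<gamma>"
  proof (cases "\<gamma> \<in> cylinder \<Lambda> a b")
    case True
    then obtain l where l: "l \<in> extensions a m" "\<gamma> \<in> cylinder \<Lambda> (a \<cdot> l) (b \<cdot> l)"
      using cylinder_refine_ex[OF assms] by blast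
    have uniq: "l' = l" if "l' \<in> extensions a m" "\<gamma> \<in> cylinder \<Lambda> (a \<cdot> l') (b \<cdot> l')" for l'
    proof -
      have a: "a \<in> mor \<Lambda>" using pairsD[OF assms] by simp
      note e = extensionsD[OF a l(1)] and e' = extensionsD[OF a that(1)]
      have "a \<cdot> l' = a \<cdot> l"
        using cylinder_eqI[OF pairs_ext[OF assms that(1)] pairs_ext[OF assms l(1)] _ that(2) l(2)] e e'
        by simp
      then show ?thesis using comp_inject(2)[OF a e'(1,2) a e(1,2)] by simp
    qed
    have "(\<Sum>l\<in>extensions a m. ind (a \<cdot> l, b \<cdot> l) \<gamma>) = (\<Sum>l'\<in>extensions a m. if l' = l then 1 else 0)"
      by (rule sum.cong[OF refl]) (use l(2) in \<open>auto simp: ind_apply dest: uniq\<close>)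
    then show ?thesis using True l(1) fin by (simp add: sum_fun_eq ind_apply)
  next
    case False
    then have "\<gamma> \<notin> cylinder \<Lambda> (a \<cdot> l) (b \<cdot> l)" if "l \<in> extensions a m" for l
      using cylinder_ext_subset[OF assms that] by blast
    then show ?thesis using False by (simp add: sum_fun_eq ind_apply)
  qed
qed

lemma kg_conv_ind_apply:
  assumes "p \<in> pairs" "\<gamma> \<in> kgroupoid \<Lambda>"
  shows "kg_conv \<Lambda> (ind p) g \<gamma> = (\<Sum>\<alpha> | g_rng \<alpha> = g_rng \<gamma> \<and> \<alpha> \<in> Z p. g (g_mult (g_inv \<alpha>) \<gamma>))"
proof -
  have "{\<alpha>. g_rng \<alpha> = g_rng \<gamma> \<and> ind p \<alpha> \<noteq> 0} = {\<alpha>. g_rng \<alpha> = g_rng \<gamma> \<and> \<alpha> \<in> Z p}"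
    by (simp add: ind_def indicator_def)
  with fibre_finite_fibre[OF ind_fibre_finite[OF assms(1)], of "g_rng \<gamma>"]
  have "finite {\<alpha>. g_rng \<alpha> = g_rng \<gamma> \<and> \<alpha> \<in> Z p}" by simp
  from kg_conv_eq_sum[OF ind_fibre_finite[OF assms(1)] assms(2) this, of g]
  show ?thesis by (force simp: ind_def indicator_def intro: sum.cong)
qed

text \<open>The matrix unit relation. All products in the algebra reduce to it, since cylinder
  sets can be refined until the degrees match.\<close>

lemma ind_mult:
  assumes ab: "(a, b) \<in> pairs" and cd: "(c, d) \<in> pairs" and deg: "deg \<Lambda> b = deg \<Lambda> c"
  shows "kg_conv \<Lambda> (ind (a, b)) (ind (c, d)) = (if b = c then ind (a, d) else 0)"
proof
  fix \<gamma>
  show "kg_conv \<Lambda> (ind (a, b)) (ind (c, d)) \<gamma> = (if b = c then ind (a, d) else 0) \<gamma>"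
  proof (cases "\<gamma> \<in> kgroupoid \<Lambda>")
    case \<gamma>: True
    obtain x n y where g: "\<gamma> = (x, n, y)" by (cases \<gamma>)
    let ?S = "{\<alpha>. g_rng \<alpha> = g_rng \<gamma> \<and> \<alpha> \<in> cylinder \<Lambda> a b}"
    have conv: "kg_conv \<Lambda> (ind (a, b)) (ind (c, d)) \<gamma> = (\<Sum>\<alpha>\<in>?S. ind (c, d) (g_mult (g_inv \<alpha>) \<gamma>))"
      using kg_conv_ind_apply[OF ab \<gamma>] by simp
    \<comment> \<open>A nonzero term makes \<open>b\<close> and \<open>c\<close> initial segments of
      equal degree of the middle path \<open>w\<close>, so they coincide.\<close>
    have fwd: "b = c \<and> \<gamma> \<in> cylinder \<Lambda> a d" if \<alpha>: "\<alpha> \<in> ?S" "g_mult (g_inv \<alpha>) \<gamma> \<in> cylinder \<Lambda> c d" for \<alpha>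
    proof -
      obtain m w where \<alpha>_eq: "\<alpha> = (x, m, w)" using \<alpha>(1) g by (cases \<alpha>) (simp add: g_rng_def)
      note A = conjunct2[OF \<alpha>(1)[unfolded mem_Collect_eq], unfolded \<alpha>_eq mem_cylinder[OF ab]]
      have "(w, - m + n, y) \<in> cylinder \<Lambda> c d" using \<alpha>(2) by (simp add: \<alpha>_eq g g_inv_def g_mult_def)
      note B = this[unfolded mem_cylinder[OF cd]]
      have bc: "b = c" using A B deg by metis
      then have ad: "(a, d) \<in> pairs" using pairsD[OF ab] pairsD[OF cd] by (simp add: pairs_def)
      \<comment> \<open>The cocycle values d(a) - d(b) and d(c) - d(d) telescope because d(b) =
        d(c).\<close>
      have "n = m + (- m + n)" by simp
      also have "\<dots> = zdiff (deg \<Lambda> a) (deg \<Lambda> d)" using A B deg zdiff_add by metis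
      finally show ?thesis
        using bc A B unfolding g mem_cylinder[OF ad] by metis
    qed
    show ?thesis
    proof (cases "b = c \<and> \<gamma> \<in> cylinder \<Lambda> a d")
      case True
      then have bc: "b = c" and gad: "(x, n, y) \<in> cylinder \<Lambda> a d" by (auto simp: g)
      have ad: "(a, d) \<in> pairs" using pairsD[OF ab] pairsD[OF cd] bc by (simp add: pairs_def)
      note A = gad[unfolded mem_cylinder[OF ad]]
      \<comment> \<open>The middle path has to be \<open>b\<close> followed by the tail of x after
        \<open>a\<close>; it yields the only term of the sum.\<close>
      let ?z = "shift (deg \<Lambda> a) x" let ?w = "prepend \<Lambda> b ?z"
      have x: "x \<in> inf_paths \<Lambda>" "x (0, deg \<Lambda> a) = a" using A by auto
      have "ip_rng ?z = src \<Lambda> b"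
        using inf_path_init(4)[OF x(1), of "deg \<Lambda> a"] x(2) pairsD[OF ab] by (simp add: ip_rng_def shift_init)
      note w = prepend[OF _ shift_inf_path[OF x(1)] this]
      let ?\<alpha> = "(x, zdiff (deg \<Lambda> a) (deg \<Lambda> b), ?w)"
      have \<alpha>_mem: "?\<alpha> \<in> cylinder \<Lambda> a b"
        unfolding mem_cylinder[OF ab] using w x pairsD[OF ab] by simp
      then have \<alpha>: "?\<alpha> \<in> ?S" by (simp add: g g_rng_def)
      have "\<beta> = ?\<alpha>" if "\<beta> \<in> ?S" for \<beta>
        by (rule cylinder_inj_rng[OF ab _ \<alpha>_mem]) (use that in \<open>simp_all add: g g_rng_def\<close>)
      with \<alpha> have S: "?S = {?\<alpha>}" by blast
      have "- zdiff (deg \<Lambda> a) (deg \<Lambda> b) + n = zdiff (deg \<Lambda> c) (deg \<Lambda> d)"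
        using A bc by (simp add: zdiff_swap zdiff_add)
      then have "(?w, - zdiff (deg \<Lambda> a) (deg \<Lambda> b) + n, y) \<in> cylinder \<Lambda> c d"
        unfolding mem_cylinder[OF cd] using w A bc pairsD[OF ab] by simp
      moreover have "g_mult (g_inv ?\<alpha>) \<gamma> = (?w, - zdiff (deg \<Lambda> a) (deg \<Lambda> b) + n, y)"
        by (simp add: g g_inv_def g_mult_def)
      ultimately have "kg_conv \<Lambda> (ind (a, b)) (ind (c, d)) \<gamma> = 1"
        unfolding conv S by (simp add: ind_apply)
      then show ?thesis using True by (simp add: ind_apply)
    next
      case False
      then have "ind (c, d) (g_mult (g_inv \<alpha>) \<gamma>) = 0" if "\<alpha> \<in> ?S" for \<alpha>
        using fwd[OF that] by (auto simp: ind_apply)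
      then show ?thesis using False by (simp add: conv ind_apply)
    qed
  next
    case False
    then have "\<gamma> \<notin> cylinder \<Lambda> a d" if "b = c"
      using cylinder_subset_kgroupoid[of a d] pairsD[OF ab] pairsD[OF cd] that by (auto simp: pairs_def)
    then show ?thesis using False by (simp add: kg_conv_outside ind_apply)
  qed
qed

text \<open>Refining the first factor by d(c) equalises the middle degrees, and of all refined terms
  only l = c survives the matrix unit relation. This yields the products of (KP2), where the degrees
  differ.\<close>

lemma ind_mult_ext_right:
  assumes ab: "(a, b) \<in> pairs" and cd: "(b \<cdot> c, d) \<in> pairs" and c: "c \<in> mor \<Lambda>" "src \<Lambda> b = rng \<Lambda> c"
  shows "kg_conv \<Lambda> (ind (a, b)) (ind (b \<cdot> c, d)) = ind (a \<cdot> c, d)"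
proof -
  let ?E = "extensions a (deg \<Lambda> c)"
  have m: "a \<in> mor \<Lambda>" "b \<in> mor \<Lambda>" "src \<Lambda> a = src \<Lambda> b" using pairsD[OF ab] by auto
  have cE: "c \<in> ?E" using c m by (simp add: paths_from_def)
  have e: "(a \<cdot> l, b \<cdot> l) \<in> pairs" if "l \<in> ?E" for l by (rule pairs_ext[OF ab that])
  have "kg_conv \<Lambda> (ind (a, b)) (ind (b \<cdot> c, d)) =
      (\<Sum>l\<in>?E. kg_conv \<Lambda> (ind (a \<cdot> l, b \<cdot> l)) (ind (b \<cdot> c, d)))"
    unfolding ind_refine[OF ab, of "deg \<Lambda> c"] by (rule kg_conv_sum_left) (rule ind_fibre_finite[OF e])
  also have "\<dots> = (\<Sum>l\<in>?E. if l = c then ind (a \<cdot> c, d) else 0)"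
  proof (rule sum.cong[OF refl])
    fix l assume l: "l \<in> ?E"
    then have lb: "l \<in> extensions b (deg \<Lambda> c)" using m by simp
    note L = extensionsD[OF m(2) lb]
    have "b \<cdot> l = b \<cdot> c \<longleftrightarrow> l = c"
      using comp_inject(2)[OF m(2) L(1,2) m(2) c] by auto
    moreover have "deg \<Lambda> (b \<cdot> l) = deg \<Lambda> (b \<cdot> c)" using L deg_comp[OF m(2) c] by simp
    ultimately show "kg_conv \<Lambda> (ind (a \<cdot> l, b \<cdot> l)) (ind (b \<cdot> c, d)) = (if l = c then ind (a \<cdot> c, d) else 0)"
      using ind_mult[OF e[OF l] cd] by simp
  qed
  also have "\<dots> = ind (a \<cdot> c, d)" using cE finite_extensions[OF m(1)] by simp
  finally show ?thesis .
qed

text \<open>The mirror image, in which the second factor is refined.\<close>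

lemma ind_mult_ext_left:
  assumes ab: "(a, b \<cdot> c) \<in> pairs" and cd: "(b, d) \<in> pairs" and c: "c \<in> mor \<Lambda>" "src \<Lambda> b = rng \<Lambda> c"
  shows "kg_conv \<Lambda> (ind (a, b \<cdot> c)) (ind (b, d)) = ind (a, d \<cdot> c)"
proof -
  let ?E = "extensions b (deg \<Lambda> c)"
  have m: "b \<in> mor \<Lambda>" "d \<in> mor \<Lambda>" "src \<Lambda> b = src \<Lambda> d" using pairsD[OF cd] by auto
  have cE: "c \<in> ?E" using c m by (simp add: paths_from_def)
  have e: "(b \<cdot> l, d \<cdot> l) \<in> pairs" if "l \<in> ?E" for l by (rule pairs_ext[OF cd that])
  have "kg_conv \<Lambda> (ind (a, b \<cdot> c)) (ind (b, d)) =
      (\<Sum>l\<in>?E. kg_conv \<Lambda> (ind (a, b \<cdot> c)) (ind (b \<cdot> l, d \<cdot> l)))"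
    unfolding ind_refine[OF cd, of "deg \<Lambda> c"] by (rule kg_conv_sum_right[OF ind_fibre_finite[OF ab]])
  also have "\<dots> = (\<Sum>l\<in>?E. if l = c then ind (a, d \<cdot> c) else 0)"
  proof (rule sum.cong[OF refl])
    fix l assume l: "l \<in> ?E"
    note L = extensionsD[OF m(1) l]
    have "b \<cdot> c = b \<cdot> l \<longleftrightarrow> l = c"
      using comp_inject(2)[OF m(1) L(1,2) m(1) c] by auto
    moreover have "deg \<Lambda> (b \<cdot> c) = deg \<Lambda> (b \<cdot> l)" using L deg_comp[OF m(1) c] by simp
    ultimately show "kg_conv \<Lambda> (ind (a, b \<cdot> c)) (ind (b \<cdot> l, d \<cdot> l)) = (if l = c then ind (a, d \<cdot> c) else 0)"
      using ind_mult[OF ab e[OF l]] by simp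
  qed
  also have "\<dots> = ind (a, d \<cdot> c)" using cE finite_extensions[OF m(1)] by simp
  finally show ?thesis .
qed

section \<open>The groupoid algebra as the span of the indicators\<close>

definition cyl_span :: "(('a, 'k) gpd \<Rightarrow> complex) set" where
  "cyl_span = fun_space.span (ind ` pairs)"

lemma cyl_span_fibre_finite: "f \<in> cyl_span \<Longrightarrow> f \<in> fibre_finite"
proof -
  have "ind ` pairs \<subseteq> fibre_finite" using ind_fibre_finite by blast
  from fun_space.span_minimal[OF this subspace_fibre_finite]
  show "f \<in> cyl_span \<Longrightarrow> f \<in> fibre_finite" unfolding cyl_span_def by blast
qed

lemma ind_span_deg:
  assumes "(a, b) \<in> pairs"
  shows "ind (a, b) \<in> fun_space.span (ind ` {p \<in> pairs. deg \<Lambda> (snd p) = deg \<Lambda> b + m})"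
    and "ind (a, b) \<in> fun_space.span (ind ` {p \<in> pairs. deg \<Lambda> (fst p) = deg \<Lambda> a + m})"
proof -
  have "(a \<cdot> l, b \<cdot> l) \<in> pairs \<and> deg \<Lambda> (a \<cdot> l) = deg \<Lambda> a + m \<and> deg \<Lambda> (b \<cdot> l) = deg \<Lambda> b + m"
    if "l \<in> extensions a m" for l
    using pairs_ext[OF assms that] extensionsD(7)[of a l m] extensionsD(7)[of b l m] that pairsD[OF assms]
    by simp
  then show "ind (a, b) \<in> fun_space.span (ind ` {p \<in> pairs. deg \<Lambda> (snd p) = deg \<Lambda> b + m})"
    "ind (a, b) \<in> fun_space.span (ind ` {p \<in> pairs. deg \<Lambda> (fst p) = deg \<Lambda> a + m})"
    unfolding ind_refine[OF assms, of m]
    by (intro fun_space.span_sum fun_space.span_base imageI; simp)+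
qed

text \<open>Separate index sets for the two factors allow two uses: for arbitrary labels, and again
  after each factor has been refined to a prescribed middle degree.\<close>

lemma kg_conv_span:
  assumes "f \<in> fun_space.span (ind ` D)" "g \<in> fun_space.span (ind ` D')"
    and D: "D \<subseteq> pairs" "D' \<subseteq> pairs"
    and prod: "\<And>p q. p \<in> D \<Longrightarrow> q \<in> D' \<Longrightarrow> kg_conv \<Lambda> (ind p) (ind q) \<in> cyl_span"
  shows "kg_conv \<Lambda> f g \<in> cyl_span"
proof -
  have sub: "fun_space.subspace cyl_span" unfolding cyl_span_def by (rule fun_space.subspace_span)
  have 1: "kg_conv \<Lambda> (ind p) g \<in> cyl_span" if p: "p \<in> D" for p
    using assms(2)
  proof (rule fun_space.span_induct)
    have ff: "ind p \<in> fibre_finite" using p D by (blast intro: ind_fibre_finite)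
    show "fun_space.subspace {g. kg_conv \<Lambda> (ind p) g \<in> cyl_span}"
      unfolding fun_space.subspace_def mem_Collect_eq kg_conv_zero kg_conv_add_right[OF ff] kg_conv_scale_right[OF ff]
      using sub unfolding fun_space.subspace_def by blast
    show "kg_conv \<Lambda> (ind p) x \<in> cyl_span" if "x \<in> ind ` D'" for x using prod p that by blast
  qed
  \<comment> \<open>Additivity in the left argument holds on \<open>fibre_finite\<close>, so
    membership there is carried through the induction.\<close>
  have "f \<in> fibre_finite \<and> kg_conv \<Lambda> f g \<in> cyl_span"
    using assms(1)
  proof (rule fun_space.span_induct)
    show "fun_space.subspace {f. f \<in> fibre_finite \<and> kg_conv \<Lambda> f g \<in> cyl_span}"
      using sub subspace_fibre_finite unfolding fun_space.subspace_def
      by (simp add: kg_conv_zero kg_conv_add_left kg_conv_scale_left)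
    show "x \<in> fibre_finite \<and> kg_conv \<Lambda> x g \<in> cyl_span" if "x \<in> ind ` D" for x
      using that D(1) 1 ind_fibre_finite by blast
  qed
  then show ?thesis by simp
qed

lemma kg_conv_cyl_span:
  assumes "f \<in> cyl_span" "g \<in> cyl_span"
  shows "kg_conv \<Lambda> f g \<in> cyl_span"
proof (rule kg_conv_span[OF assms[unfolded cyl_span_def] subset_refl subset_refl])
  fix p q assume p: "p \<in> pairs" and q: "q \<in> pairs"
  obtain a b c d where e: "p = (a, b)" "q = (c, d)" by (cases p, cases q)
  \<comment> \<open>Both middle degrees are raised to d(b) + d(c), after which
    \<open>ind_mult\<close> applies to each pair of terms.\<close>
  let ?D = "{p \<in> pairs. deg \<Lambda> (snd p) = deg \<Lambda> b + deg \<Lambda> c}" 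
  let ?D' = "{p \<in> pairs. deg \<Lambda> (fst p) = deg \<Lambda> c + deg \<Lambda> b}"
  show "kg_conv \<Lambda> (ind p) (ind q) \<in> cyl_span"
  proof (rule kg_conv_span)
    show "ind p \<in> fun_space.span (ind ` ?D)" using ind_span_deg(1) p unfolding e by blast
    show "ind q \<in> fun_space.span (ind ` ?D')" using ind_span_deg(2) q unfolding e by blast
  next
    fix p q assume "p \<in> ?D" "q \<in> ?D'"
    moreover obtain a b c d where e: "p = (a, b)" "q = (c, d)" by (cases p, cases q)
    ultimately have pq: "(a, b) \<in> pairs" "(c, d) \<in> pairs" "deg \<Lambda> b = deg \<Lambda> c"
      by (auto simp: add.commute)
    have "(a, d) \<in> pairs" if "b = c" using pairsD[OF pq(1)] pairsD[OF pq(2)] that by (simp add: pairs_def)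
    then show "kg_conv \<Lambda> (ind p) (ind q) \<in> cyl_span"
      unfolding e ind_mult[OF pq] cyl_span_def
      by (auto intro: fun_space.span_base fun_space.span_zero)
  qed auto
qed

text \<open>The cylinder is open, closed and compact, and the cocycle is constant on it.\<close>

lemma ind_A_homog:
  assumes p: "(a, b) \<in> pairs"
  shows "ind (a, b) \<in> A_homog \<Lambda> (zdiff (deg \<Lambda> a) (deg \<Lambda> b))"
proof -
  have supp: "{\<gamma>. ind (a, b) \<gamma> \<noteq> 0} = cylinder \<Lambda> a b" by (auto simp: ind_apply)
  have lc: "\<exists>U. openin top_G U \<and> \<gamma> \<in> U \<and> (\<forall>\<delta>\<in>U. ind (a, b) \<delta> = ind (a, b) \<gamma>)"
    if g: "\<gamma> \<in> kgroupoid \<Lambda>" for \<gamma>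
  proof (cases "\<gamma> \<in> cylinder \<Lambda> a b")
    case True
    then show ?thesis using openin_cylinder[OF p] by (intro exI[of _ "cylinder \<Lambda> a b"]) (simp add: ind_apply)
  next
    case False
    then obtain U where "openin top_G U" "\<gamma> \<in> U" "U \<inter> cylinder \<Lambda> a b = {}"
      using closed_cylinder[OF p g] by blast
    then show ?thesis using False by (intro exI[of _ U]) (auto simp: ind_apply)
  qed
  then have lcm: "locally_constant_map top_G (ind (a, b))"
    unfolding locally_constant_map_def topspace_kgroupoid by blast
  then have "continuous_map top_G euclidean (ind (a, b))"
    by (rule locally_constant_continuous)
  moreover have "closedin top_G (cylinder \<Lambda> a b)"
    using locally_constant_closed_support[OF lcm] cylinder_subset_kgroupoid[OF p]
    unfolding supp topspace_kgroupoid by blast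
  then have "compactin top_G (top_G closure_of cylinder \<Lambda> a b)"
    using compactin_cylinder[OF p] by (simp add: closure_of_closedin)
  ultimately have "ind (a, b) \<in> Cc \<Lambda>"
    using cylinder_subset_kgroupoid[OF p] unfolding Cc_def mem_Collect_eq supp by blast
  moreover have "cylinder \<Lambda> a b \<subseteq> {\<gamma>. g_cocycle \<gamma> = zdiff (deg \<Lambda> a) (deg \<Lambda> b)}"
    by (auto simp: cylinder_def g_cocycle_def)
  ultimately show ?thesis using lcm unfolding A_homog_def mem_Collect_eq supp by blast
qed

text \<open>Compactness covers the support by finitely many cylinders on which f is constant. They
  may overlap, so all are refined to one first degree, where distinct ones are disjoint and each
  contributes its value of f.\<close>

lemma A_homog_cyl_span:
  assumes f: "f \<in> A_homog \<Lambda> n"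
  shows "f \<in> cyl_span"
proof -
  let ?supp = "{\<gamma>. f \<gamma> \<noteq> 0}"
  have supp: "?supp \<subseteq> kgroupoid \<Lambda>" and comp: "compactin top_G (top_G closure_of ?supp)"
    and lcm: "locally_constant_map top_G f"
    using f unfolding A_homog_def Cc_def by blast+
  note lc = lcm[unfolded locally_constant_map_def topspace_kgroupoid, rule_format]
  have "closedin top_G ?supp"
    using locally_constant_closed_support[OF lcm supp[folded topspace_kgroupoid]] .
  then have comp: "compactin top_G ?supp" using comp by (simp add: closure_of_closedin)
  \<comment> \<open>The constant is required to be nonzero so that no good cylinder leaves the
    support.\<close>
  define good where "good = {p \<in> pairs. \<exists>c. c \<noteq> 0 \<and> (\<forall>\<gamma>\<in>Z p. f \<gamma> = c)}"
  have "?supp \<subseteq> \<Union>(Z ` good)"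
  proof
    fix \<gamma> assume g: "\<gamma> \<in> ?supp"
    then have "\<gamma> \<in> kgroupoid \<Lambda>" using supp by blast
    from lc[OF this] obtain U where U: "openin top_G U" "\<gamma> \<in> U" "\<forall>\<delta>\<in>U. f \<delta> = f \<gamma>"
        by (elim exE conjE) (rule that)
    obtain a b where ab: "(a, b) \<in> pairs" "\<gamma> \<in> cylinder \<Lambda> a b" "cylinder \<Lambda> a b \<subseteq> U"
      using U(1,2) by (rule open_contains_cylinder)
    then have "(a, b) \<in> good" using U(3) g by (auto simp: good_def simp del: split_paired_All)
    then show "\<gamma> \<in> \<Union>(Z ` good)" using ab(2) by (intro UN_I[of "(a, b)"]) simp_all
  qed
  moreover have "Ball (Z ` good) (openin top_G)" using openin_cylinder by (auto simp: good_def)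
  ultimately obtain \<F> where \<F>: "finite \<F>" "\<F> \<subseteq> Z ` good" "?supp \<subseteq> \<Union>\<F>"
    using comp unfolding compactin_def by (metis (no_types, lifting))
  obtain F where F: "finite F" "F \<subseteq> good" "\<F> = Z ` F" using finite_subset_image[OF \<F>(1,2)] by blast
  \<comment> \<open>In N^k the sum of finitely many degrees is a convenient upper bound for all of
    them.\<close>
  define N where "N = (\<Sum>p\<in>F. deg \<Lambda> (fst p))"
  have N: "deg \<Lambda> (fst p) \<le> N" if "p \<in> F" for p
    unfolding N_def using F(1) that by (simp add: sum.remove[of F p] vec_nat_le_add(1))
  \<comment> \<open>As a set of labels, \<open>R\<close> lists a piece shared by overlapping
    cylinders only once, so its value is not counted twice.\<close>
  define R where "R = (\<Union>p\<in>F. (\<lambda>l. (fst p \<cdot> l, snd p \<cdot> l)) ` extensions (fst p) (N - deg \<Lambda> (fst p)))"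
  have Fp: "p \<in> F \<Longrightarrow> p \<in> pairs" for p using F(2) by (auto simp: good_def)
  have finR: "finite R"
    unfolding R_def using F(1) Fp by (intro finite_UN_I finite_imageI finite_extensions) (auto simp: pairs_def)
  have R: "q \<in> pairs \<and> deg \<Lambda> (fst q) = N \<and> (\<exists>c. c \<noteq> 0 \<and> (\<forall>\<gamma>\<in>Z q. f \<gamma> = c))" if "q \<in> R" for q
  proof -
    obtain a b l where p: "(a, b) \<in> F" and l: "l \<in> extensions a (N - deg \<Lambda> a)" and q: "q = (a \<cdot> l, b \<cdot> l)"
      using \<open>q \<in> R\<close> unfolding R_def by auto
    have "deg \<Lambda> (a \<cdot> l) = N"
      using extensionsD(7)[OF _ l] pairsD[OF Fp[OF p]] vec_nat_le_diff[OF N[OF p]] by simp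
    moreover have "Z q \<subseteq> Z (a, b)" using cylinder_ext_subset[OF Fp[OF p] l] by (simp add: q)
    moreover obtain c where "c \<noteq> 0" "\<forall>\<gamma>\<in>Z (a, b). f \<gamma> = c" using p F(2) by (auto simp: good_def)
    ultimately show ?thesis using pairs_ext[OF Fp[OF p] l] unfolding q by auto
  qed
  then have "\<forall>q\<in>R. \<exists>c. c \<noteq> 0 \<and> (\<forall>\<gamma>\<in>Z q. f \<gamma> = c)" by blast
  from bchoice[OF this] obtain c where c: "\<And>q. q \<in> R \<Longrightarrow> c q \<noteq> 0 \<and> (\<forall>\<gamma>\<in>Z q. f \<gamma> = c q)" by blast
  have "f = (\<Sum>q\<in>R. (\<lambda>\<gamma>. c q * ind q \<gamma>))"
  proof
    fix \<gamma>
    show "f \<gamma> = (\<Sum>q\<in>R. (\<lambda>\<gamma>. c q * ind q \<gamma>)) \<gamma>"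
    proof (cases "f \<gamma> = 0")
      case True
      then have "ind q \<gamma> = 0" if "q \<in> R" for q using c[OF that] by (auto simp: ind_def indicator_def)
      then show ?thesis using True by (simp add: sum_fun_eq)
    next
      case False
      then have "\<gamma> \<in> \<Union>(Z ` F)" using \<F>(3) F(3) by blast
      then obtain a b where p: "(a, b) \<in> F" "\<gamma> \<in> cylinder \<Lambda> a b" by auto
      then obtain l where l: "l \<in> extensions a (N - deg \<Lambda> a)" "\<gamma> \<in> cylinder \<Lambda> (a \<cdot> l) (b \<cdot> l)"
        using cylinder_refine_ex[OF Fp] by blast
      define r where "r = (a \<cdot> l, b \<cdot> l)"
      have r: "r \<in> R" "\<gamma> \<in> Z r" using p l by (force simp: r_def R_def)+
      have uniq: "q = r" if "q \<in> R" "\<gamma> \<in> Z q" for q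
        using cylinder_eqI[of "fst q" "snd q" "fst r" "snd r"] R[OF that(1)] R[OF r(1)] that(2) r(2) by simp
      have "(\<Sum>q\<in>R. c q * ind q \<gamma>) = (\<Sum>q\<in>R. if q = r then c q else 0)"
        by (rule sum.cong[OF refl]) (use r(2) in \<open>auto simp: ind_def indicator_def dest: uniq\<close>)
      then show ?thesis using finR r c by (simp add: sum_fun_eq)
    qed
  qed
  also have "\<dots> \<in> cyl_span"
    unfolding cyl_span_def using R
    by (intro fun_space.span_sum fun_space.span_scale fun_space.span_base) auto
  finally show ?thesis .
qed

lemma carrier_groupoid_algebra: "carrier (groupoid_algebra \<Lambda>) = cyl_span"
proof -
  have "carrier (groupoid_algebra \<Lambda>) = fun_space.span (\<Union>n. A_homog \<Lambda> n)"
    by (auto simp: groupoid_algebra_def fun_space.span_explicit sum_fun_eq)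
  moreover have "fun_space.span (\<Union>n. A_homog \<Lambda> n) \<subseteq> cyl_span"
    unfolding cyl_span_def
    by (rule fun_space.span_minimal) (use A_homog_cyl_span cyl_span_def fun_space.subspace_span in auto)
  moreover have "cyl_span \<subseteq> fun_space.span (\<Union>n. A_homog \<Lambda> n)"
    unfolding cyl_span_def by (rule fun_space.span_mono) (use ind_A_homog in force)
  ultimately show ?thesis by blast
qed

lemma groupoid_algebra_simps:
  "mult (groupoid_algebra \<Lambda>) = kg_conv \<Lambda>" "zero (groupoid_algebra \<Lambda>) = 0"
  "add (groupoid_algebra \<Lambda>) = (+)" "smult (groupoid_algebra \<Lambda>) = (\<lambda>c f \<gamma>. c * f \<gamma>)"
  by (auto simp: groupoid_algebra_def fun_eq_iff)

lemma complex_algebra_groupoid: "complex_algebra (groupoid_algebra \<Lambda>)"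
proof (rule complex_algebraI)
  let ?A = "groupoid_algebra \<Lambda>"
  have sub: "fun_space.subspace cyl_span" unfolding cyl_span_def by (rule fun_space.subspace_span)
  note simps = groupoid_algebra_simps carrier_groupoid_algebra
  note ff = cyl_span_fibre_finite
  show "abelian_group ?A"
  proof (rule abelian_groupI)
    fix f assume "f \<in> carrier ?A"
    then have "(\<lambda>\<gamma>. (-1) * f \<gamma>) \<in> carrier ?A" using fun_space.subspace_scale[OF sub] unfolding simps by blast
    moreover have "(\<lambda>\<gamma>. (-1) * f \<gamma>) + f = 0" by (simp add: fun_eq_iff)
    ultimately show "\<exists>g\<in>carrier ?A. g \<oplus>\<^bsub>?A\<^esub> f = \<zero>\<^bsub>?A\<^esub>" unfolding simps by blast
  qed (use fun_space.subspace_add[OF sub] fun_space.subspace_0[OF sub] in \<open>auto simp: simps algebra_simps\<close>)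
  show "c \<odot>\<^bsub>?A\<^esub> f \<in> carrier ?A" if "f \<in> carrier ?A" for c f
    using that fun_space.subspace_scale[OF sub] unfolding simps by blast
  show "complex_algebra_axioms ?A"
    by standard
      (simp_all add: simps kg_conv_cyl_span kg_conv_assoc ff kg_conv_add_left kg_conv_add_right
        kg_conv_scale_left kg_conv_scale_right)
  show "(c + d) \<odot>\<^bsub>?A\<^esub> f = c \<odot>\<^bsub>?A\<^esub> f \<oplus>\<^bsub>?A\<^esub> d \<odot>\<^bsub>?A\<^esub> f" for c d f
    by (rule ext) (simp add: groupoid_algebra_simps distrib_right)
  show "c \<odot>\<^bsub>?A\<^esub> (f \<oplus>\<^bsub>?A\<^esub> g) = c \<odot>\<^bsub>?A\<^esub> f \<oplus>\<^bsub>?A\<^esub> c \<odot>\<^bsub>?A\<^esub> g" for c f g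
    by (rule ext) (simp add: groupoid_algebra_simps distrib_left)
  show "(c * d) \<odot>\<^bsub>?A\<^esub> f = c \<odot>\<^bsub>?A\<^esub> (d \<odot>\<^bsub>?A\<^esub> f)" for c d f
    by (simp add: groupoid_algebra_simps)
  show "1 \<odot>\<^bsub>?A\<^esub> f = f" for f
    by (rule ext) (simp add: groupoid_algebra_simps)
qed

lemma finsum_groupoid_algebra:
  assumes "f \<in> I \<rightarrow> cyl_span" "finite I"
  shows "(\<Oplus>\<^bsub>groupoid_algebra \<Lambda>\<^esub>i\<in>I. f i) = (\<Sum>i\<in>I. f i)"
proof -
  interpret A: complex_algebra "groupoid_algebra \<Lambda>" by (rule complex_algebra_groupoid)
  show ?thesis using assms(2,1)
    by (induction I) (simp_all add: carrier_groupoid_algebra groupoid_algebra_simps Pi_def)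
qed

text \<open>(KP1) and (KP3) are matrix unit relations, (KP4) is the refinement of Z(v,v), and the
  compositions in (KP2) are the extension lemmas with the vertex s(a) as common prefix.\<close>

lemma groupoid_KP_family:
  "KP_family \<Lambda> (groupoid_algebra \<Lambda>) (\<lambda>v. ind (v, v)) (\<lambda>a. ind (a, src \<Lambda> a)) (\<lambda>a. ind (src \<Lambda> a, a))"
proof -
  have P: "(v, v) \<in> pairs" if "v \<in> verts \<Lambda>" for v using that by (simp add: pairs_def verts_def)
  have S: "(a, src \<Lambda> a) \<in> pairs" "(src \<Lambda> a, a) \<in> pairs" if "a \<in> mor \<Lambda>" for a
    using that by (simp_all add: pairs_def src_mor src_src)
  have R: "(rng \<Lambda> a, rng \<Lambda> a) \<in> pairs" if "a \<in> mor \<Lambda>" for a using P rng_verts that by blast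
  have carr: "ind p \<in> carrier (groupoid_algebra \<Lambda>)" if "p \<in> pairs" for p
    unfolding carrier_groupoid_algebra cyl_span_def using that by (intro fun_space.span_base imageI)
  have pos: "a \<in> mor \<Lambda>" if "a \<in> pos_paths \<Lambda>" for a using that by (simp add: pos_paths_def)
  show ?thesis
    unfolding KP_family_def groupoid_algebra_simps
  proof (intro conjI ballI allI impI)
    fix v w assume vw: "v \<in> verts \<Lambda>" "w \<in> verts \<Lambda>"
    then show "kg_conv \<Lambda> (ind (v, v)) (ind (w, w)) = (if v = w then ind (v, v) else 0)"
      using ind_mult[OF P[OF vw(1)] P[OF vw(2)]] by (simp add: verts_def)
  next
    fix a b assume "a \<in> pos_paths \<Lambda>" "b \<in> pos_paths \<Lambda>" and s: "src \<Lambda> a = rng \<Lambda> b"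
    then have m: "a \<in> mor \<Lambda>" "b \<in> mor \<Lambda>" using pos by auto
    \<comment> \<open>Writing b as s(a) followed by b gives it the shape that the extension lemmas
      expect.\<close>
    have b: "src \<Lambda> a \<cdot> b = b" using comp_rng[OF m(2)] s by simp
    have sb: "src \<Lambda> (src \<Lambda> a) = rng \<Lambda> b" using s src_src[OF m(1)] by simp
    show "kg_conv \<Lambda> (ind (a, src \<Lambda> a)) (ind (b, src \<Lambda> b)) = ind (a \<cdot> b, src \<Lambda> (a \<cdot> b))"
      using ind_mult_ext_right[OF S(1)[OF m(1)] _ m(2) sb] S(1)[OF m(2)] src_comp[OF m s] by (simp add: b)
    show "kg_conv \<Lambda> (ind (src \<Lambda> b, b)) (ind (src \<Lambda> a, a)) = ind (src \<Lambda> (a \<cdot> b), a \<cdot> b)"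
      using ind_mult_ext_left[OF _ S(2)[OF m(1)] m(2) sb] S(2)[OF m(2)] src_comp[OF m s] by (simp add: b)
  next
    fix a assume "a \<in> pos_paths \<Lambda>"
    then have a: "a \<in> mor \<Lambda>" by (rule pos)
    note ra = comp_rng[OF a] and sr = src_rng[OF a]
    show "kg_conv \<Lambda> (ind (rng \<Lambda> a, rng \<Lambda> a)) (ind (a, src \<Lambda> a)) = ind (a, src \<Lambda> a)"
      using ind_mult_ext_right[OF R[OF a] _ a sr] S(1)[OF a] by (simp add: ra)
    show "kg_conv \<Lambda> (ind (src \<Lambda> a, a)) (ind (rng \<Lambda> a, rng \<Lambda> a)) = ind (src \<Lambda> a, a)"
      using ind_mult_ext_left[OF _ R[OF a] a sr] S(2)[OF a] by (simp add: ra)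
    show "kg_conv \<Lambda> (ind (a, src \<Lambda> a)) (ind (src \<Lambda> a, src \<Lambda> a)) = ind (a, src \<Lambda> a)"
      "kg_conv \<Lambda> (ind (src \<Lambda> a, src \<Lambda> a)) (ind (src \<Lambda> a, a)) = ind (src \<Lambda> a, a)"
      using ind_mult S[OF a] P[OF src_verts[OF a]] by simp_all
  next
    fix a b assume "a \<in> pos_paths \<Lambda>" "b \<in> pos_paths \<Lambda>" and d: "deg \<Lambda> a = deg \<Lambda> b"
    then have m: "a \<in> mor \<Lambda>" "b \<in> mor \<Lambda>" using pos by auto
    show "kg_conv \<Lambda> (ind (src \<Lambda> a, a)) (ind (b, src \<Lambda> b)) = (if a = b then ind (src \<Lambda> a, src \<Lambda> a) else 0)"
      using ind_mult[OF S(2)[OF m(1)] S(1)[OF m(2)] d] by simp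
  next
    fix v and n :: "nat^'k" assume v: "v \<in> verts \<Lambda>" and "n \<noteq> 0"
    have vm: "v \<in> mor \<Lambda>" "deg \<Lambda> v = 0" using v by (auto simp: verts_def)
    have ext: "extensions v n = paths_from \<Lambda> v n" using src_vertex[OF vm] by simp
    note E = extensionsD[OF vm(1), of _ n, unfolded ext]
    have fin: "finite (paths_from \<Lambda> v n)" using finite_extensions[OF vm(1), of n] ext by simp
    have prod: "kg_conv \<Lambda> (ind (a, src \<Lambda> a)) (ind (src \<Lambda> a, a)) = ind (a, a)"
      if "a \<in> mor \<Lambda>" for a
      using ind_mult S[OF that] by simp
    have "ind (v, v) = (\<Sum>a\<in>paths_from \<Lambda> v n. ind (a, a))"
      unfolding ind_refine[OF P[OF v], of n] ext
      by (rule sum.cong) (use E comp_rng src_vertex[OF vm] in metis)+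
    also have "\<dots> = (\<Sum>a\<in>paths_from \<Lambda> v n. kg_conv \<Lambda> (ind (a, src \<Lambda> a)) (ind (src \<Lambda> a, a)))"
      by (rule sum.cong) (use E prod in auto)
    also have "\<dots> = (\<Oplus>\<^bsub>groupoid_algebra \<Lambda>\<^esub>a\<in>paths_from \<Lambda> v n.
        kg_conv \<Lambda> (ind (a, src \<Lambda> a)) (ind (src \<Lambda> a, a)))"
      using carr[unfolded carrier_groupoid_algebra] S E fin
      by (intro finsum_groupoid_algebra[symmetric]) (auto intro!: kg_conv_cyl_span)
    finally show "ind (v, v) = (\<Oplus>\<^bsub>groupoid_algebra \<Lambda>\<^esub>a\<in>paths_from \<Lambda> v n.
        kg_conv \<Lambda> (ind (a, src \<Lambda> a)) (ind (src \<Lambda> a, a)))" .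
  qed (use carr P S pos in auto)
qed

end


section \<open>Spanning sets of complex algebras\<close>

context complex_algebra
begin

lemma mult_zero_right: "x \<in> carrier A \<Longrightarrow> x \<otimes> \<zero> = \<zero>"
  using smult_mult_right[of x \<zero> 0] smult_l_null[of "x \<otimes> \<zero>"] smult_l_null[of \<zero>] mult_closed[of x \<zero>]
  by simp

lemma mult_zero_left: "x \<in> carrier A \<Longrightarrow> \<zero> \<otimes> x = \<zero>"
  using smult_mult_left[of \<zero> x 0] smult_l_null[of "\<zero> \<otimes> x"] smult_l_null[of \<zero>] mult_closed[of \<zero> x]
  by simp

lemma finsum_mult_right:
  assumes "f \<in> I \<rightarrow> carrier A" "x \<in> carrier A" "finite I"
  shows "x \<otimes> (\<Oplus>i\<in>I. f i) = (\<Oplus>i\<in>I. x \<otimes> f i)"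
  using assms(3,1)
proof (induction I)
  case (insert i I)
  then have f: "f i \<in> carrier A" "f \<in> I \<rightarrow> carrier A" by auto
  moreover from this have "(\<lambda>i. x \<otimes> f i) \<in> I \<rightarrow> carrier A" "x \<otimes> f i \<in> carrier A"
    using assms(2) mult_closed by auto
  ultimately show ?case
    using insert assms(2) by (simp add: mult_distr_right)
qed (simp add: mult_zero_right assms(2))

lemma finsum_mult_left:
  assumes "f \<in> I \<rightarrow> carrier A" "x \<in> carrier A" "finite I"
  shows "(\<Oplus>i\<in>I. f i) \<otimes> x = (\<Oplus>i\<in>I. f i \<otimes> x)"
  using assms(3,1)
proof (induction I)
  case (insert i I)
  then have f: "f i \<in> carrier A" "f \<in> I \<rightarrow> carrier A" by auto
  moreover from this have "(\<lambda>i. f i \<otimes> x) \<in> I \<rightarrow> carrier A" "f i \<otimes> x \<in> carrier A"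
    using assms(2) mult_closed by auto
  ultimately show ?case
    using insert assms(2) by (simp add: mult_distr_left)
qed (simp add: mult_zero_left assms(2))

text \<open>Generated one term at a time, which gives a direct induction for closure under products
  and changes of degree; \<open>lin_span_finsumE\<close> recovers finite sums.\<close>

inductive_set lin_span :: "'b set \<Rightarrow> 'b set" for X where
  zero: "\<zero> \<in> lin_span X"
| step: "\<lbrakk>b \<in> X; x \<in> lin_span X\<rbrakk> \<Longrightarrow> c \<odot> b \<oplus> x \<in> lin_span X"

lemma lin_span_carrier:
  assumes "X \<subseteq> carrier A" "x \<in> lin_span X"
  shows "x \<in> carrier A"
  using assms(2) by induction (use assms(1) in \<open>auto intro!: a_closed smult_closed\<close>)

lemma lin_span_add:
  assumes X: "X \<subseteq> carrier A" and "x \<in> lin_span X" "y \<in> lin_span X"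
  shows "x \<oplus> y \<in> lin_span X"
  using assms(2)
proof induction
  case zero
  then show ?case using assms lin_span_carrier by simp
next
  case (step b x c)
  have "c \<odot> b \<oplus> x \<oplus> y = c \<odot> b \<oplus> (x \<oplus> y)"
    using step X assms(3) lin_span_carrier by (intro a_assoc) (auto intro!: smult_closed)
  then show ?case using lin_span.step[OF step(1) step.IH] by simp
qed

lemma lin_span_smult:
  assumes X: "X \<subseteq> carrier A" and "x \<in> lin_span X"
  shows "d \<odot> x \<in> lin_span X"
  using assms(2)
proof induction
  case zero
  then show ?case using smult_r_null[of d] lin_span.zero by simp
next
  case (step b x c)
  then have c: "b \<in> carrier A" "x \<in> carrier A" using X lin_span_carrier by auto
  have "d \<odot> (c \<odot> b \<oplus> x) = (d * c) \<odot> b \<oplus> d \<odot> x"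
    using c smult_r_distr[of d "c \<odot> b" x] smult_assoc1[of d c b] smult_closed[of c b] by simp
  then show ?case using lin_span.step[OF step(1) step.IH] by simp
qed

lemma lin_span_base:
  assumes "X \<subseteq> carrier A" "b \<in> X"
  shows "b \<in> lin_span X"
  using lin_span.step[OF assms(2) lin_span.zero, of 1] assms smult_one[of b] by auto

lemma lin_span_finsum:
  assumes X: "X \<subseteq> carrier A" and f: "\<And>i. i \<in> I \<Longrightarrow> f i \<in> lin_span X" and "finite I"
  shows "(\<Oplus>i\<in>I. f i) \<in> lin_span X"
  using assms(3,2)
proof (induction I)
  case (insert i I)
  then have "f \<in> I \<rightarrow> carrier A" "f i \<in> carrier A" using lin_span_carrier[OF X] by auto
  then show ?case using insert by (auto intro: lin_span_add[OF X])
qed (simp add: lin_span.zero)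

lemma lin_span_mult:
  assumes X: "X \<subseteq> carrier A" and Y: "Y \<subseteq> carrier A" and y: "y \<in> carrier A"
    and prod: "\<And>b. b \<in> X \<Longrightarrow> y \<otimes> b \<in> lin_span Y" and "x \<in> lin_span X"
  shows "y \<otimes> x \<in> lin_span Y"
  using assms(5)
proof induction
  case zero
  then show ?case using mult_zero_right[OF y] lin_span.zero by simp
next
  case (step b x c)
  then have c: "b \<in> carrier A" "x \<in> carrier A" using X lin_span_carrier by auto
  have "y \<otimes> (c \<odot> b \<oplus> x) = c \<odot> (y \<otimes> b) \<oplus> y \<otimes> x"
    using c y smult_closed[of c b] mult_distr_right[of "c \<odot> b" x y] smult_mult_right[OF y c(1)] by simp
  then show ?case using lin_span_add[OF Y lin_span_smult[OF Y prod[OF step(1)]] step.IH] by simp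
qed

text \<open>Repeated terms are merged so that the sum runs over distinct labels, which is what
  comparing coefficients in the injectivity proof requires.\<close>

lemma lin_span_finsumE:
  assumes E: "E \<in> D \<rightarrow> carrier A" and "x \<in> lin_span (E ` D)"
  shows "\<exists>F c. finite F \<and> F \<subseteq> D \<and> x = (\<Oplus>p\<in>F. c p \<odot> E p)"
  using assms(2)
proof induction
  case zero
  show ?case by (intro exI[of _ "{}"]) simp
next
  case (step b x d)
  obtain F c where F: "finite F" "F \<subseteq> D" "x = (\<Oplus>p\<in>F. c p \<odot> E p)" using step.IH by blast
  obtain q where q: "q \<in> D" "b = E q" using step(1) by blast
  have Ec: "k \<odot> E p \<in> carrier A" if "p \<in> D" for k p
    using that E by (intro smult_closed) auto
  \<comment> \<open>The label \<open>q\<close> of the new term may already occur; it is split off,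
    and its old coefficient is added to \<open>d\<close>.\<close>
  define F' where "F' = F - {q}"
  let ?c = "\<lambda>p. if p = q then d + (if q \<in> F then c q else 0) else c p"
  have F': "finite F'" "q \<notin> F'" "F' \<subseteq> D" using F by (auto simp: F'_def)
  have Fc: "(\<lambda>p. c p \<odot> E p) \<in> F' \<rightarrow> carrier A" using Ec F'(3) by blast
  then have sc: "(\<Oplus>p\<in>F'. c p \<odot> E p) \<in> carrier A" by (rule finsum_closed)
  have Eq: "E q \<in> carrier A" using E q(1) by auto
  have "x = (if q \<in> F then c q else 0) \<odot> E q \<oplus> (\<Oplus>p\<in>F'. c p \<odot> E p)"
  proof (cases "q \<in> F")
    case True
    then have "F = insert q F'" by (auto simp: F'_def)
    then have "x = (\<Oplus>p\<in>insert q F'. c p \<odot> E p)" using F(3) by simp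
    also have "\<dots> = c q \<odot> E q \<oplus> (\<Oplus>p\<in>F'. c p \<odot> E p)"
      by (rule finsum_insert[OF F'(1,2) Fc Ec[OF q(1)]])
    finally show ?thesis using True by simp
  next
    case False
    then have "F' = F" by (auto simp: F'_def)
    then show ?thesis using False F(3) sc smult_l_null[OF Eq] by simp
  qed
  then have "d \<odot> b \<oplus> x = (d + (if q \<in> F then c q else 0)) \<odot> E q \<oplus> (\<Oplus>p\<in>F'. c p \<odot> E p)"
    using sc Ec[OF q(1)] smult_l_distr[OF _ _ Eq, of d "if q \<in> F then c q else 0"]
    by (simp add: q(2) a_assoc)
  also have "(\<Oplus>p\<in>F'. c p \<odot> E p) = (\<Oplus>p\<in>F'. ?c p \<odot> E p)"
    using F'(2) Ec F'(3) by (intro finsum_cong') auto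
  also have "(d + (if q \<in> F then c q else 0)) \<odot> E q \<oplus> (\<Oplus>p\<in>F'. ?c p \<odot> E p) =
      (\<Oplus>p\<in>insert q F'. ?c p \<odot> E p)"
    by (subst finsum_insert[OF F'(1,2)]) (use Ec F'(3) q(1) in auto)
  finally show ?case
    using F' q(1) by (intro exI[of _ "insert q F'"] exI[of _ ?c]) auto
qed

end


section \<open>Normal forms in Kumjian--Pask families\<close>

locale KP_representation = source_free_k_graph \<Lambda> + B: complex_algebra B
  for \<Lambda> :: "('a, 'k::finite) kgraph" and B :: "(complex, 'b) module" +
  fixes P S T :: "'a \<Rightarrow> 'b"
  assumes family: "KP_family \<Lambda> B P S T"
begin

text \<open>Vertices count as paths of degree 0, so that no case distinctions are needed below.\<close>

definition real_elt :: "'a \<Rightarrow> 'b" where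
  "real_elt a = (if deg \<Lambda> a = 0 then P a else S a)"

definition ghost_elt :: "'a \<Rightarrow> 'b" where
  "ghost_elt a = (if deg \<Lambda> a = 0 then P a else T a)"

lemma vertex_elt: "v \<in> verts \<Lambda> \<Longrightarrow> real_elt v = P v" "v \<in> verts \<Lambda> \<Longrightarrow> ghost_elt v = P v"
  by (simp_all add: real_elt_def ghost_elt_def verts_def)

lemma vertI: "a \<in> mor \<Lambda> \<Longrightarrow> deg \<Lambda> a = 0 \<Longrightarrow> a \<in> verts \<Lambda>"
  by (simp add: verts_def)

lemma posI: "a \<in> mor \<Lambda> \<Longrightarrow> deg \<Lambda> a \<noteq> 0 \<Longrightarrow> a \<in> pos_paths \<Lambda>"
  by (simp add: pos_paths_def)

lemma P_closed: "v \<in> verts \<Lambda> \<Longrightarrow> P v \<in> carrier B"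
  using family unfolding KP_family_def by (elim conjE funcset_mem)

lemma P_mult: "\<lbrakk>v \<in> verts \<Lambda>; w \<in> verts \<Lambda>\<rbrakk> \<Longrightarrow> P v \<otimes>\<^bsub>B\<^esub> P w = (if v = w then P v else \<zero>\<^bsub>B\<^esub>)"
proof -
  have "\<forall>v\<in>verts \<Lambda>. \<forall>w\<in>verts \<Lambda>. P v \<otimes>\<^bsub>B\<^esub> P w = (if v = w then P v else \<zero>\<^bsub>B\<^esub>)"
    using family unfolding KP_family_def by (elim conjE)
  then show "\<lbrakk>v \<in> verts \<Lambda>; w \<in> verts \<Lambda>\<rbrakk> \<Longrightarrow> P v \<otimes>\<^bsub>B\<^esub> P w = (if v = w then P v else \<zero>\<^bsub>B\<^esub>)"
    by blast
qed

lemma elt_closed: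
  assumes "a \<in> mor \<Lambda>"
  shows "real_elt a \<in> carrier B" "ghost_elt a \<in> carrier B"
  using family vertI[OF assms] posI[OF assms] P_closed
  unfolding real_elt_def ghost_elt_def KP_family_def by auto

lemma elt_unit:
  assumes "a \<in> mor \<Lambda>"
  shows "P (rng \<Lambda> a) \<otimes>\<^bsub>B\<^esub> real_elt a = real_elt a" "real_elt a \<otimes>\<^bsub>B\<^esub> P (src \<Lambda> a) = real_elt a"
    "P (src \<Lambda> a) \<otimes>\<^bsub>B\<^esub> ghost_elt a = ghost_elt a" "ghost_elt a \<otimes>\<^bsub>B\<^esub> P (rng \<Lambda> a) = ghost_elt a"
proof -
  have "P (rng \<Lambda> a) \<otimes>\<^bsub>B\<^esub> real_elt a = real_elt a \<and> real_elt a \<otimes>\<^bsub>B\<^esub> P (src \<Lambda> a) = real_elt a \<and>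
    P (src \<Lambda> a) \<otimes>\<^bsub>B\<^esub> ghost_elt a = ghost_elt a \<and> ghost_elt a \<otimes>\<^bsub>B\<^esub> P (rng \<Lambda> a) = ghost_elt a"
  proof (cases "deg \<Lambda> a = 0")
    case True
    then show ?thesis
      using rng_vertex[OF assms True] src_vertex[OF assms True] P_mult[of a a] vertI[OF assms True]
      by (simp add: real_elt_def ghost_elt_def)
  next
    case False
    then show ?thesis
      using family posI[OF assms False] unfolding KP_family_def real_elt_def ghost_elt_def by simp
  qed
  then show "P (rng \<Lambda> a) \<otimes>\<^bsub>B\<^esub> real_elt a = real_elt a" "real_elt a \<otimes>\<^bsub>B\<^esub> P (src \<Lambda> a) = real_elt a"
    "P (src \<Lambda> a) \<otimes>\<^bsub>B\<^esub> ghost_elt a = ghost_elt a" "ghost_elt a \<otimes>\<^bsub>B\<^esub> P (rng \<Lambda> a) = ghost_elt a"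
    by blast+
qed

lemma elt_comp:
  assumes a: "a \<in> mor \<Lambda>" and b: "b \<in> mor \<Lambda>" and ab: "src \<Lambda> a = rng \<Lambda> b"
  shows "real_elt a \<otimes>\<^bsub>B\<^esub> real_elt b = real_elt (a \<cdot> b)"
    and "ghost_elt b \<otimes>\<^bsub>B\<^esub> ghost_elt a = ghost_elt (a \<cdot> b)"
proof -
  have "real_elt a \<otimes>\<^bsub>B\<^esub> real_elt b = real_elt (a \<cdot> b) \<and> ghost_elt b \<otimes>\<^bsub>B\<^esub> ghost_elt a = ghost_elt (a \<cdot> b)"
  proof (cases "deg \<Lambda> a = 0 \<or> deg \<Lambda> b = 0")
    case True
    then show ?thesis
    proof
      assume d: "deg \<Lambda> a = 0"
      then have "a = rng \<Lambda> b" using src_vertex[OF a d] ab by simp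
      then show ?thesis
        using elt_unit[OF b] comp_rng[OF b] vertex_elt[OF vertI[OF a d]] by simp
    next
      assume d: "deg \<Lambda> b = 0"
      then have "b = src \<Lambda> a" using rng_vertex[OF b d] ab by simp
      then show ?thesis
        using elt_unit[OF a] comp_src[OF a] vertex_elt[OF vertI[OF b d]] by simp
    qed
  next
    case False
    then have "deg \<Lambda> (a \<cdot> b) \<noteq> 0" using deg_comp[OF a b ab] by (auto simp: vec_eq_iff)
    then show ?thesis
      using False family posI[OF a] posI[OF b] ab unfolding KP_family_def real_elt_def ghost_elt_def
      by simp
  qed
  then show "real_elt a \<otimes>\<^bsub>B\<^esub> real_elt b = real_elt (a \<cdot> b)"
    "ghost_elt b \<otimes>\<^bsub>B\<^esub> ghost_elt a = ghost_elt (a \<cdot> b)" by blast+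
qed

lemma ghost_real:
  assumes a: "a \<in> mor \<Lambda>" and b: "b \<in> mor \<Lambda>" and d: "deg \<Lambda> a = deg \<Lambda> b"
  shows "ghost_elt a \<otimes>\<^bsub>B\<^esub> real_elt b = (if a = b then P (src \<Lambda> a) else \<zero>\<^bsub>B\<^esub>)"
proof (cases "deg \<Lambda> a = 0")
  case True
  then show ?thesis
    using P_mult[of a b] vertI[OF a] vertI[OF b] d src_vertex[OF a] src_vertex[OF b]
    by (simp add: real_elt_def ghost_elt_def)
next
  case False
  then have "a \<in> pos_paths \<Lambda>" "b \<in> pos_paths \<Lambda>" using posI a b d by auto
  moreover have "\<forall>a\<in>pos_paths \<Lambda>. \<forall>b\<in>pos_paths \<Lambda>. deg \<Lambda> a = deg \<Lambda> b \<longrightarrow>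
      T a \<otimes>\<^bsub>B\<^esub> S b = (if a = b then P (src \<Lambda> a) else \<zero>\<^bsub>B\<^esub>)"
    using family unfolding KP_family_def by blast
  ultimately show ?thesis using False d by (simp add: real_elt_def ghost_elt_def)
qed

text \<open>Extends (KP4) to n = 0, where it is the idempotence of P_v; refinement by an arbitrary
  degree then needs no exception.\<close>

lemma vertex_sum:
  assumes v: "v \<in> verts \<Lambda>"
  shows "P v = (\<Oplus>\<^bsub>B\<^esub>l\<in>paths_from \<Lambda> v n. real_elt l \<otimes>\<^bsub>B\<^esub> ghost_elt l)"
proof (cases "n = 0")
  case True
  have "paths_from \<Lambda> v 0 = {v}"
    using v rng_vertex by (auto simp: paths_from_def verts_def)
  then show ?thesis using True P_mult[OF v v] P_closed[OF v] vertex_elt[OF v] by simp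
next
  case False
  have "\<forall>v\<in>verts \<Lambda>. \<forall>n. n \<noteq> 0 \<longrightarrow> P v = (\<Oplus>\<^bsub>B\<^esub>a\<in>paths_from \<Lambda> v n. S a \<otimes>\<^bsub>B\<^esub> T a)"
    using family unfolding KP_family_def by blast
  then have "P v = (\<Oplus>\<^bsub>B\<^esub>a\<in>paths_from \<Lambda> v n. S a \<otimes>\<^bsub>B\<^esub> T a)" using v False by blast
  also have "\<dots> = (\<Oplus>\<^bsub>B\<^esub>a\<in>paths_from \<Lambda> v n. real_elt a \<otimes>\<^bsub>B\<^esub> ghost_elt a)"
  proof (rule B.finsum_cong')
    show "(\<lambda>a. real_elt a \<otimes>\<^bsub>B\<^esub> ghost_elt a) \<in> paths_from \<Lambda> v n \<rightarrow> carrier B"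
      using elt_closed by (auto simp: paths_from_def intro!: B.mult_closed)
    show "S a \<otimes>\<^bsub>B\<^esub> T a = real_elt a \<otimes>\<^bsub>B\<^esub> ghost_elt a" if "a \<in> paths_from \<Lambda> v n" for a
      using that False by (simp add: paths_from_def real_elt_def ghost_elt_def)
  qed simp
  finally show ?thesis .
qed

section \<open>Refinement and multiplication of the spanning elements\<close>

definition unit_elt :: "'a \<times> 'a \<Rightarrow> 'b" where
  "unit_elt p = real_elt (fst p) \<otimes>\<^bsub>B\<^esub> ghost_elt (snd p)"

lemma unit_elt_closed: "p \<in> pairs \<Longrightarrow> unit_elt p \<in> carrier B"
  using pairsD[of "fst p" "snd p"] elt_closed by (simp add: unit_elt_def B.mult_closed)

text \<open>Insert P at the common source between the real and the ghost factor, expand it by (KP4),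
  and absorb the pieces on both sides by (KP2).\<close>

lemma unit_elt_refine:
  assumes p: "(a, b) \<in> pairs"
  shows "unit_elt (a, b) = (\<Oplus>\<^bsub>B\<^esub>l\<in>extensions a m. unit_elt (a \<cdot> l, b \<cdot> l))"
proof -
  have ab: "a \<in> mor \<Lambda>" "b \<in> mor \<Lambda>" "src \<Lambda> a = src \<Lambda> b" using pairsD[OF p] by auto
  let ?E = "extensions a m"
  note e = extensionsD[OF ab(1), of _ m]
  note c = elt_closed B.mult_closed
  have fin: "finite ?E" by (rule finite_extensions[OF ab(1)])
  have rl: "(\<lambda>l. real_elt l \<otimes>\<^bsub>B\<^esub> ghost_elt l) \<in> ?E \<rightarrow> carrier B" using e c by auto
  have "unit_elt (a, b) = real_elt a \<otimes>\<^bsub>B\<^esub> (P (src \<Lambda> a) \<otimes>\<^bsub>B\<^esub> ghost_elt b)"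
    using elt_unit(3)[OF ab(2)] ab(3) by (simp add: unit_elt_def)
  also have "P (src \<Lambda> a) = (\<Oplus>\<^bsub>B\<^esub>l\<in>?E. real_elt l \<otimes>\<^bsub>B\<^esub> ghost_elt l)"
    by (rule vertex_sum[OF src_verts[OF ab(1)]])
  also have "real_elt a \<otimes>\<^bsub>B\<^esub> ((\<Oplus>\<^bsub>B\<^esub>l\<in>?E. real_elt l \<otimes>\<^bsub>B\<^esub> ghost_elt l) \<otimes>\<^bsub>B\<^esub> ghost_elt b) =
      (\<Oplus>\<^bsub>B\<^esub>l\<in>?E. real_elt a \<otimes>\<^bsub>B\<^esub> ((real_elt l \<otimes>\<^bsub>B\<^esub> ghost_elt l) \<otimes>\<^bsub>B\<^esub> ghost_elt b))"
    using B.finsum_mult_left[OF rl elt_closed(2)[OF ab(2)] fin]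
      B.finsum_mult_right[of "\<lambda>l. (real_elt l \<otimes>\<^bsub>B\<^esub> ghost_elt l) \<otimes>\<^bsub>B\<^esub> ghost_elt b" ?E "real_elt a"]
      fin e c ab by simp
  also have "\<dots> = (\<Oplus>\<^bsub>B\<^esub>l\<in>?E. unit_elt (a \<cdot> l, b \<cdot> l))"
  proof (rule B.finsum_cong')
    show "(\<lambda>l. unit_elt (a \<cdot> l, b \<cdot> l)) \<in> ?E \<rightarrow> carrier B"
      using pairs_ext[OF p] unit_elt_closed by blast
    fix l assume l: "l \<in> ?E"
    note L = e[OF l]
    have "real_elt a \<otimes>\<^bsub>B\<^esub> ((real_elt l \<otimes>\<^bsub>B\<^esub> ghost_elt l) \<otimes>\<^bsub>B\<^esub> ghost_elt b) =
        (real_elt a \<otimes>\<^bsub>B\<^esub> real_elt l) \<otimes>\<^bsub>B\<^esub> (ghost_elt l \<otimes>\<^bsub>B\<^esub> ghost_elt b)"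
      using c L(1) ab by (simp add: B.mult_assoc)
    then show "real_elt a \<otimes>\<^bsub>B\<^esub> ((real_elt l \<otimes>\<^bsub>B\<^esub> ghost_elt l) \<otimes>\<^bsub>B\<^esub> ghost_elt b) = unit_elt (a \<cdot> l, b \<cdot> l)"
      using elt_comp(1)[OF ab(1) L(1,2)] elt_comp(2)[OF ab(2) L(1)] L(2) ab(3) by (simp add: unit_elt_def)
  qed simp
  finally show ?thesis .
qed

definition unit_span :: "('a \<times> 'a) set \<Rightarrow> 'b set" where
  "unit_span D = B.lin_span (unit_elt ` D)"

lemma unit_image_closed: "D \<subseteq> pairs \<Longrightarrow> unit_elt ` D \<subseteq> carrier B"
  using unit_elt_closed by blast

lemma real_mult_unit:
  assumes c: "c \<in> mor \<Lambda>" and p: "(a, b) \<in> pairs"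
  shows "real_elt c \<otimes>\<^bsub>B\<^esub> unit_elt (a, b) = (if src \<Lambda> c = rng \<Lambda> a then unit_elt (c \<cdot> a, b) else \<zero>\<^bsub>B\<^esub>)"
proof -
  have ab: "a \<in> mor \<Lambda>" "b \<in> mor \<Lambda>" using pairsD[OF p] by auto
  note cl = elt_closed[OF c] elt_closed[OF ab(1)] elt_closed[OF ab(2)] B.mult_closed
    P_closed[OF src_verts[OF c]] P_closed[OF rng_verts[OF ab(1)]]
  have "real_elt c \<otimes>\<^bsub>B\<^esub> unit_elt (a, b) = (real_elt c \<otimes>\<^bsub>B\<^esub> real_elt a) \<otimes>\<^bsub>B\<^esub> ghost_elt b"
    using cl by (simp add: unit_elt_def B.mult_assoc)
  \<comment> \<open>Both factors absorb their vertex idempotents, and these are orthogonal when the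
    vertices differ.\<close>
  moreover have "real_elt c \<otimes>\<^bsub>B\<^esub> real_elt a = \<zero>\<^bsub>B\<^esub>" if "src \<Lambda> c \<noteq> rng \<Lambda> a"
  proof -
    have "real_elt c \<otimes>\<^bsub>B\<^esub> real_elt a =
        (real_elt c \<otimes>\<^bsub>B\<^esub> P (src \<Lambda> c)) \<otimes>\<^bsub>B\<^esub> (P (rng \<Lambda> a) \<otimes>\<^bsub>B\<^esub> real_elt a)"
      using elt_unit[OF c] elt_unit[OF ab(1)] by simp
    also have "\<dots> = real_elt c \<otimes>\<^bsub>B\<^esub> ((P (src \<Lambda> c) \<otimes>\<^bsub>B\<^esub> P (rng \<Lambda> a)) \<otimes>\<^bsub>B\<^esub> real_elt a)"
      using cl by (simp add: B.mult_assoc)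
    also have "\<dots> = \<zero>\<^bsub>B\<^esub>"
      using that P_mult[OF src_verts[OF c] rng_verts[OF ab(1)]] cl
      by (simp add: B.mult_zero_left B.mult_zero_right)
    finally show ?thesis .
  qed
  ultimately show ?thesis
    using elt_comp(1)[OF c ab(1)] B.mult_zero_left[OF elt_closed(2)[OF ab(2)]] by (simp add: unit_elt_def)
qed

text \<open>Stability under left multiplication by generators is enough, since words in the free
  algebra are built up from the left.\<close>

lemma real_mult_span:
  assumes c: "c \<in> mor \<Lambda>" and x: "x \<in> unit_span pairs"
  shows "real_elt c \<otimes>\<^bsub>B\<^esub> x \<in> unit_span pairs"
proof -
  note X = unit_image_closed[OF subset_refl]
  show ?thesis
    unfolding unit_span_def
  proof (rule B.lin_span_mult[OF X X elt_closed(1)[OF c] _ x[unfolded unit_span_def]])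
    fix y assume "y \<in> unit_elt ` pairs"
    then obtain a b where p: "(a, b) \<in> pairs" "y = unit_elt (a, b)" by auto
    have "(c \<cdot> a, b) \<in> pairs" if "src \<Lambda> c = rng \<Lambda> a"
      using pairsD[OF p(1)] c that by (simp add: pairs_def comp_mor src_comp)
    then show "real_elt c \<otimes>\<^bsub>B\<^esub> y \<in> B.lin_span (unit_elt ` pairs)"
      unfolding p(2) real_mult_unit[OF c p(1)]
      using B.lin_span_base[OF X] B.lin_span.zero by auto
  qed
qed

text \<open>After refinement by d(c) the real factor begins with a piece of degree d(c). (KP3) turns
  the ghost of \<open>c\<close> times that piece into a vertex or 0, and the rest is again a real
  factor times a ghost.\<close>

lemma ghost_mult_span:
  assumes c: "c \<in> mor \<Lambda>" and x: "x \<in> unit_span pairs"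
  shows "ghost_elt c \<otimes>\<^bsub>B\<^esub> x \<in> unit_span pairs"
proof -
  note X = unit_image_closed[OF subset_refl]
  note cl = elt_closed B.mult_closed
  show ?thesis
    unfolding unit_span_def
  proof (rule B.lin_span_mult[OF X X elt_closed(2)[OF c] _ x[unfolded unit_span_def]])
    fix y assume "y \<in> unit_elt ` pairs"
    then obtain a b where p: "(a, b) \<in> pairs" "y = unit_elt (a, b)" by auto
    let ?E = "extensions a (deg \<Lambda> c)"
    have ab: "a \<in> mor \<Lambda>" "b \<in> mor \<Lambda>" using pairsD[OF p(1)] by auto
    have fin: "finite ?E" by (rule finite_extensions[OF ab(1)])
    have "ghost_elt c \<otimes>\<^bsub>B\<^esub> y = (\<Oplus>\<^bsub>B\<^esub>l\<in>?E. ghost_elt c \<otimes>\<^bsub>B\<^esub> unit_elt (a \<cdot> l, b \<cdot> l))"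
      unfolding p(2) unit_elt_refine[OF p(1), of "deg \<Lambda> c"]
      by (rule B.finsum_mult_right[OF _ elt_closed(2)[OF c] fin])
        (use pairs_ext[OF p(1)] unit_elt_closed in blast)
    also have "\<dots> \<in> B.lin_span (unit_elt ` pairs)"
    proof (rule B.lin_span_finsum[OF X _ fin])
      fix l assume l: "l \<in> ?E"
      note L = extensionsD[OF ab(1) l]
      have bl: "b \<cdot> l \<in> mor \<Lambda>" "src \<Lambda> (a \<cdot> l) = src \<Lambda> (b \<cdot> l)"
        using pairsD[OF pairs_ext[OF p(1) l]] by auto
      \<comment> \<open>The degree is read as d(c) + d(a) so that the factorisation property cuts
        off a first piece of degree d(c).\<close>
      have "deg \<Lambda> (a \<cdot> l) = deg \<Lambda> c + deg \<Lambda> a" using L by (simp add: add.commute)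
      from factor_ex[OF L(4) this]
      obtain d e where d: "d \<in> mor \<Lambda>" "e \<in> mor \<Lambda>" "deg \<Lambda> d = deg \<Lambda> c" "src \<Lambda> d = rng \<Lambda> e" "a \<cdot> l = d \<cdot> e"
        by metis
      have eb: "(e, b \<cdot> l) \<in> pairs"
        using bl d src_comp[OF d(1,2,4)] by (simp add: pairs_def)
      have "ghost_elt c \<otimes>\<^bsub>B\<^esub> unit_elt (a \<cdot> l, b \<cdot> l) =
          (ghost_elt c \<otimes>\<^bsub>B\<^esub> real_elt d) \<otimes>\<^bsub>B\<^esub> (real_elt e \<otimes>\<^bsub>B\<^esub> ghost_elt (b \<cdot> l))"
        using cl c d(1,2) bl(1)
        by (simp add: unit_elt_def d(5) elt_comp(1)[OF d(1,2,4), symmetric] B.mult_assoc)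
      also have "\<dots> = (if c = d then real_elt (src \<Lambda> c) \<otimes>\<^bsub>B\<^esub> unit_elt (e, b \<cdot> l) else \<zero>\<^bsub>B\<^esub>)"
        using ghost_real[OF c d(1)] d(3) vertex_elt[OF src_verts[OF c]] vertex_elt[OF src_verts[OF d(1)]]
          unit_elt_closed[OF eb]
        by (simp add: unit_elt_def B.mult_zero_left)
      also have "\<dots> \<in> B.lin_span (unit_elt ` pairs)"
        using real_mult_span[OF src_mor[OF c]] B.lin_span_base[OF X imageI[OF eb]] B.lin_span.zero
        unfolding unit_span_def by auto
      finally show "ghost_elt c \<otimes>\<^bsub>B\<^esub> unit_elt (a \<cdot> l, b \<cdot> l) \<in> B.lin_span (unit_elt ` pairs)" .
    qed
    finally show "ghost_elt c \<otimes>\<^bsub>B\<^esub> y \<in> B.lin_span (unit_elt ` pairs)" .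
  qed
qed

lemma elt_in_span:
  assumes a: "a \<in> mor \<Lambda>"
  shows "real_elt a \<in> unit_span pairs" "ghost_elt a \<in> unit_span pairs"
proof -
  have "(a, src \<Lambda> a) \<in> pairs" "(src \<Lambda> a, a) \<in> pairs" using a by (simp_all add: pairs_def src_mor src_src)
  moreover have "unit_elt (a, src \<Lambda> a) = real_elt a" "unit_elt (src \<Lambda> a, a) = ghost_elt a"
    using elt_unit[OF a] vertex_elt[OF src_verts[OF a]] by (simp_all add: unit_elt_def)
  ultimately show "real_elt a \<in> unit_span pairs" "ghost_elt a \<in> unit_span pairs"
    unfolding unit_span_def using B.lin_span_base[OF unit_image_closed[OF subset_refl]] by (metis imageI)+
qed

text \<open>Claiming all N above a bound, rather than one N, lets the induction combine the bounds
  of a sum and of its new term.\<close>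

lemma unit_span_common_degree:
  assumes "x \<in> unit_span pairs"
  shows "\<exists>M. \<forall>N\<ge>M. x \<in> unit_span {p \<in> pairs. deg \<Lambda> (fst p) = N}"
  using assms unfolding unit_span_def
proof (induction)
  case zero
  then show ?case using B.lin_span.zero by blast
next
  case (step y x c)
  obtain M where M: "\<And>N. N \<ge> M \<Longrightarrow> x \<in> B.lin_span (unit_elt ` {p \<in> pairs. deg \<Lambda> (fst p) = N})"
    using step.IH by blast
  obtain a b where p: "(a, b) \<in> pairs" "y = unit_elt (a, b)" using step(1) by auto
  have "c \<odot>\<^bsub>B\<^esub> y \<oplus>\<^bsub>B\<^esub> x \<in> B.lin_span (unit_elt ` {p \<in> pairs. deg \<Lambda> (fst p) = N})"
    if N: "M + deg \<Lambda> a \<le> N" for N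
  proof -
    have X: "unit_elt ` {p \<in> pairs. deg \<Lambda> (fst p) = N} \<subseteq> carrier B" by (rule unit_image_closed) auto
    have a: "a \<in> mor \<Lambda>" using pairsD[OF p(1)] by simp
    have le: "M \<le> N" "deg \<Lambda> a \<le> N"
      using N vec_nat_le_add(1)[of M "deg \<Lambda> a"] vec_nat_le_add(2)[of "deg \<Lambda> a" M] by (auto intro: order_trans)
    have "y \<in> B.lin_span (unit_elt ` {p \<in> pairs. deg \<Lambda> (fst p) = N})"
      unfolding p(2) unit_elt_refine[OF p(1), of "N - deg \<Lambda> a"]
    proof (rule B.lin_span_finsum[OF X B.lin_span_base[OF X imageI] finite_extensions[OF a]])
      show "(a \<cdot> l, b \<cdot> l) \<in> {p \<in> pairs. deg \<Lambda> (fst p) = N}" if "l \<in> extensions a (N - deg \<Lambda> a)" for l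
        using pairs_ext[OF p(1) that] extensionsD(7)[OF a that] vec_nat_le_diff[OF le(2)] by simp
    qed
    then show ?thesis
      by (intro B.lin_span_add[OF X] B.lin_span_smult[OF X] M[OF le(1)])
  qed
  then show ?case by blast
qed

end


section \<open>The isomorphism\<close>

text \<open>The universal property yields a map out of the Kumjian-Pask algebra, whereas the
  isomorphism is wanted in the other direction.\<close>

lemma calg_isomorphic_sym:
  assumes A: "complex_algebra A" and iso: "calg_isomorphic A B"
  shows "calg_isomorphic B A"
proof -
  interpret A: complex_algebra A by fact
  obtain h where h: "h \<in> calg_hom A B" and bij: "bij_betw h (carrier A) (carrier B)"
    using iso unfolding calg_isomorphic_def by blast
  define g where "g = inv_into (carrier A) h"
  have g: "g y \<in> carrier A" "h (g y) = y" if "y \<in> carrier B" for y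
    using that bij inv_into_into[of y h "carrier A"] f_inv_into_f[of y h "carrier A"]
    by (simp_all add: g_def bij_betw_def)
  have gh: "g (h x) = x" if "x \<in> carrier A" for x
    using that bij by (simp add: g_def bij_betw_def)
  have hom: "h (x \<oplus>\<^bsub>A\<^esub> y) = h x \<oplus>\<^bsub>B\<^esub> h y" "h (x \<otimes>\<^bsub>A\<^esub> y) = h x \<otimes>\<^bsub>B\<^esub> h y"
    "h (c \<odot>\<^bsub>A\<^esub> x) = c \<odot>\<^bsub>B\<^esub> h x" if "x \<in> carrier A" "y \<in> carrier A" for x y c
    using h that by (simp_all add: calg_hom_def)
  have "g \<in> calg_hom B A"
    unfolding calg_hom_def
  proof (intro CollectI conjI ballI allI)
    fix x y assume xy: "x \<in> carrier B" "y \<in> carrier B"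
    show "g (x \<oplus>\<^bsub>B\<^esub> y) = g x \<oplus>\<^bsub>A\<^esub> g y"
      using hom(1)[OF g(1)[OF xy(1)] g(1)[OF xy(2)]] gh[of "g x \<oplus>\<^bsub>A\<^esub> g y"] g xy by simp
    show "g (x \<otimes>\<^bsub>B\<^esub> y) = g x \<otimes>\<^bsub>A\<^esub> g y"
      using hom(2)[OF g(1)[OF xy(1)] g(1)[OF xy(2)]] gh[of "g x \<otimes>\<^bsub>A\<^esub> g y"] g xy
      by (simp add: A.mult_closed)
  next
    fix c x assume x: "x \<in> carrier B"
    show "g (c \<odot>\<^bsub>B\<^esub> x) = c \<odot>\<^bsub>A\<^esub> g x"
      using hom(3)[OF g(1)[OF x] g(1)[OF x], of c] gh[of "c \<odot>\<^bsub>A\<^esub> g x"] g[OF x] A.smult_closed[of c "g x"]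
      by simp
  qed (use g in auto)
  moreover have "bij_betw g (carrier B) (carrier A)"
    unfolding g_def using bij by (rule bij_betw_inv_into)
  ultimately show ?thesis unfolding calg_isomorphic_def by blast
qed

text \<open>Every element is the class of a combination of words, and left multiplication by the
  class of a generator preserves the span.\<close>

lemma (in source_free_k_graph) kumjian_pask_spanned:
  assumes "X \<in> carrier (kumjian_pask \<Lambda>)"
  shows "X \<in> KP_representation.unit_span \<Lambda> (kumjian_pask \<Lambda>)
    (\<lambda>v. kp_ideal \<Lambda> +>\<^bsub>kp_free \<Lambda>\<^esub> free_gen (Vertex v))
    (\<lambda>a. kp_ideal \<Lambda> +>\<^bsub>kp_free \<Lambda>\<^esub> free_gen (Path a))
    (\<lambda>a. kp_ideal \<Lambda> +>\<^bsub>kp_free \<Lambda>\<^esub> free_gen (Ghost a)) pairs"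
proof -
  let ?F = "kp_free \<Lambda>" and ?q = "\<lambda>x. kp_ideal \<Lambda> +>\<^bsub>kp_free \<Lambda>\<^esub> x"
  interpret Q: calg_quotient ?F "kp_ideal \<Lambda>"
    by (intro calg_quotient.intro complex_algebra_free calg_quotient_axioms.intro kp_ideal_ideal)
  interpret R: KP_representation \<Lambda> "kumjian_pask \<Lambda>" "\<lambda>v. ?q (free_gen (Vertex v))"
    "\<lambda>a. ?q (free_gen (Path a))" "\<lambda>a. ?q (free_gen (Ghost a))"
    by (intro KP_representation.intro source_free_k_graph_axioms complex_algebra_kumjian_pask
        KP_representation_axioms.intro kumjian_pask_family)
  note quot = Q.quot_simps[folded kumjian_pask_def]
  note span = R.unit_image_closed[OF subset_refl]
  have gen: "(\<exists>a\<in>mor \<Lambda>. ?q (free_gen x) = R.real_elt a) \<or> (\<exists>a\<in>mor \<Lambda>. ?q (free_gen x) = R.ghost_elt a)"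
    if x: "x \<in> kp_symbols \<Lambda>" for x
  proof -
    consider v where "v \<in> verts \<Lambda>" "x = Vertex v" | a where "a \<in> pos_paths \<Lambda>" "x = Path a"
      | a where "a \<in> pos_paths \<Lambda>" "x = Ghost a"
      using x unfolding kp_symbols_def by blast
    then show ?thesis
    proof cases
      case 1
      then have "v \<in> mor \<Lambda>" "?q (free_gen x) = R.real_elt v"
        using R.vertex_elt(1)[OF 1(1)] by (simp_all add: verts_def)
      then show ?thesis by blast
    next
      case 2
      then have "a \<in> mor \<Lambda>" "?q (free_gen x) = R.real_elt a"
        by (simp_all add: pos_paths_def R.real_elt_def)
      then show ?thesis by blast
    next
      case 3
      then have "a \<in> mor \<Lambda>" "?q (free_gen x) = R.ghost_elt a"
        by (simp_all add: pos_paths_def R.ghost_elt_def)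
      then show ?thesis by blast
    qed
  qed
  have word: "?q (word w) \<in> R.unit_span pairs" if "w \<in> lists (kp_symbols \<Lambda>) - {[]}" for w
    using that
  proof (induction w)
    case (Cons x w)
    have x: "x \<in> kp_symbols \<Lambda>" using Cons.prems by simp
    show ?case
    proof (cases "w = []")
      case True
      have "?q (free_gen x) \<in> R.unit_span pairs" using gen[OF x] R.elt_in_span by metis
      then show ?thesis using True by (simp add: free_gen_word)
    next
      case False
      then have w: "w \<in> lists (kp_symbols \<Lambda>) - {[]}" using Cons.prems by simp
      have "?q (word (x # w)) = ?q (free_gen x) \<otimes>\<^bsub>kumjian_pask \<Lambda>\<^esub> ?q (word w)"
        using quot(4)[OF free_gen_carrier[OF x] word_carrier[OF w]] by (simp add: free_gen_word word_mult)
      then show ?thesis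
        using gen[OF x] R.real_mult_span[OF _ Cons.IH[OF w]] R.ghost_mult_span[OF _ Cons.IH[OF w]] by metis
    qed
  qed simp
  obtain f where f: "f \<in> carrier ?F" "X = ?q f" using assms by (auto simp: quot)
  have "?q f \<in> R.unit_span pairs" using f(1)
  proof (induction rule: free_lin_induct)
    case zero
    then show ?case using R.B.lin_span.zero by (simp add: quot(2)[symmetric] R.unit_span_def)
  next
    case (word c w)
    then show ?case
      using R.B.lin_span_smult[OF span, of "?q (word w)" c] \<open>w \<in> _ \<Longrightarrow> ?q (word w) \<in> _\<close>
        quot(5)[OF word_carrier[OF word]] by (simp add: R.unit_span_def)
  next
    case (add f g)
    then show ?case
      using R.B.lin_span_add[OF span, of "?q f" "?q g"] quot(3)[OF add(1,2)]
      unfolding R.unit_span_def by metis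
  qed
  then show ?thesis using f(2) by simp
qed

theorem (in source_free_k_graph) kumjian_pask_isomorphic:
  "calg_isomorphic (kumjian_pask \<Lambda>) (groupoid_algebra \<Lambda>)"
proof -
  let ?K = "kumjian_pask \<Lambda>" and ?A = "groupoid_algebra \<Lambda>"
  let ?P = "\<lambda>v. kp_ideal \<Lambda> +>\<^bsub>kp_free \<Lambda>\<^esub> free_gen (Vertex v)"
  let ?S = "\<lambda>v. kp_ideal \<Lambda> +>\<^bsub>kp_free \<Lambda>\<^esub> free_gen (Path v)"
  let ?T = "\<lambda>v. kp_ideal \<Lambda> +>\<^bsub>kp_free \<Lambda>\<^esub> free_gen (Ghost v)"
  interpret R: KP_representation \<Lambda> ?K ?P ?S ?T
    by (intro KP_representation.intro source_free_k_graph_axioms complex_algebra_kumjian_pask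
        KP_representation_axioms.intro kumjian_pask_family)
  interpret A: complex_algebra ?A by (rule complex_algebra_groupoid)
  obtain h where h: "h \<in> calg_hom ?K ?A"
    and hP: "\<And>v. v \<in> verts \<Lambda> \<Longrightarrow> h (?P v) = ind (v, v)"
    and hS: "\<And>a. a \<in> pos_paths \<Lambda> \<Longrightarrow> h (?S a) = ind (a, src \<Lambda> a)"
    and hT: "\<And>a. a \<in> pos_paths \<Lambda> \<Longrightarrow> h (?T a) = ind (src \<Lambda> a, a)"
    using ex1_implies_ex[OF kumjian_pask_universal[OF complex_algebra_groupoid groupoid_KP_family]] by blast
  have h_closed: "h x \<in> cyl_span" if "x \<in> carrier ?K" for x
    using h that by (auto simp: calg_hom_def carrier_groupoid_algebra)
  have h_simps: "h (x \<oplus>\<^bsub>?K\<^esub> y) = h x + h y" "h (x \<otimes>\<^bsub>?K\<^esub> y) = kg_conv \<Lambda> (h x) (h y)"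
    "h (c \<odot>\<^bsub>?K\<^esub> x) = (\<lambda>\<gamma>. c * h x \<gamma>)" if "x \<in> carrier ?K" "y \<in> carrier ?K" for x y c
    using h that by (simp_all add: calg_hom_def groupoid_algebra_simps)
  \<comment> \<open>The images of the real and the ghost factor meet in the same vertex label, so
    they multiply as matrix units.\<close>
  have h_unit: "h (R.unit_elt (a, b)) = ind (a, b)" if p: "(a, b) \<in> pairs" for a b
  proof -
    have ab: "a \<in> mor \<Lambda>" "b \<in> mor \<Lambda>" "src \<Lambda> a = src \<Lambda> b" using pairsD[OF p] by auto
    have "h (R.real_elt a) = ind (a, src \<Lambda> a)"
      using hP hS ab(1) src_vertex by (simp add: R.real_elt_def R.vertI R.posI)
    moreover have "h (R.ghost_elt b) = ind (src \<Lambda> b, b)"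
      using hP hT ab(2) src_vertex by (simp add: R.ghost_elt_def R.vertI R.posI)
    moreover have "(a, src \<Lambda> a) \<in> pairs" "(src \<Lambda> b, b) \<in> pairs"
      using ab by (simp_all add: pairs_def src_mor src_src)
    ultimately show ?thesis
      using h_simps(2)[OF R.elt_closed(1)[OF ab(1)] R.elt_closed(2)[OF ab(2)]]
        ind_mult[of a "src \<Lambda> a" "src \<Lambda> b" b] ab(3) by (simp add: R.unit_elt_def)
  qed
  have kernel: "x = \<zero>\<^bsub>?K\<^esub>" if x: "x \<in> carrier ?K" "h x = 0" for x
  proof -
    obtain N where N: "x \<in> R.unit_span {p \<in> pairs. deg \<Lambda> (fst p) = N}"
      using R.unit_span_common_degree[OF kumjian_pask_spanned[OF x(1)]] by blast
    let ?D = "{p \<in> pairs. deg \<Lambda> (fst p) = N}"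
    have "R.unit_elt \<in> ?D \<rightarrow> carrier ?K" using R.unit_elt_closed by blast
    from R.B.lin_span_finsumE[OF this N[unfolded R.unit_span_def]]
    obtain F c where F: "finite F" "F \<subseteq> ?D" "x = (\<Oplus>\<^bsub>?K\<^esub>p\<in>F. c p \<odot>\<^bsub>?K\<^esub> R.unit_elt p)" by blast
    have Fc: "(\<lambda>p. c p \<odot>\<^bsub>?K\<^esub> R.unit_elt p) \<in> F \<rightarrow> carrier ?K"
      using F(2) R.unit_elt_closed by (auto intro!: R.B.smult_closed)
    have "h (c p \<odot>\<^bsub>?K\<^esub> R.unit_elt p) = (\<lambda>\<gamma>. c p * ind p \<gamma>)" if "p \<in> F" for p
      using h_simps(3)[of "R.unit_elt p" "R.unit_elt p" "c p"] h_unit[of "fst p" "snd p"]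
        R.unit_elt_closed[of p] F(2) that by auto
    moreover have "h x = (\<Oplus>\<^bsub>?A\<^esub>p\<in>F. h (c p \<odot>\<^bsub>?K\<^esub> R.unit_elt p))"
      unfolding F(3) by (rule hom_finsum[OF complex_algebra_kumjian_pask complex_algebra_groupoid h Fc])
    moreover have "\<dots> = (\<Sum>p\<in>F. h (c p \<odot>\<^bsub>?K\<^esub> R.unit_elt p))"
      using Fc h_closed F(1) by (intro finsum_groupoid_algebra) auto
    ultimately have hx: "h x = (\<Sum>p\<in>F. (\<lambda>\<gamma>. c p * ind p \<gamma>))" by simp
    have "c p = 0" if p: "p \<in> F" for p
    proof -
      have pD: "(fst p, snd p) \<in> pairs" "deg \<Lambda> (fst p) = N" using p F(2) by auto
      \<comment> \<open>A point of this cylinder lies in no other cylinder of the sum, as all first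
        labels have degree N; evaluating there isolates the coefficient \<open>c p\<close>.\<close>
      obtain \<gamma> where \<gamma>: "\<gamma> \<in> Z p" using cylinder_nonempty[OF pD(1)] by blast
      have "c q * ind q \<gamma> = (if q = p then c p else 0)" if q: "q \<in> F" for q
      proof -
        have qD: "(fst q, snd q) \<in> pairs" "deg \<Lambda> (fst q) = deg \<Lambda> (fst p)" using q F(2) pD(2) by auto
        show ?thesis
        proof (cases "\<gamma> \<in> Z q")
          case True
          have "q = p" using cylinder_eqI[OF qD(1) pD(1) qD(2) True \<gamma>] by (simp add: prod_eq_iff)
          then show ?thesis using \<gamma> by (simp add: ind_def)
        next
          case False
          then have "q \<noteq> p" using \<gamma> by blast
          then show ?thesis using False by (simp add: ind_def)
        qed
      qed
      then have "h x \<gamma> = (\<Sum>q\<in>F. if q = p then c p else 0)" by (simp add: hx sum_fun_eq)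
      then show ?thesis using x(2) F(1) p by simp
    qed
    then have "x = (\<Oplus>\<^bsub>?K\<^esub>p\<in>F. \<zero>\<^bsub>?K\<^esub>)"
      unfolding F(3) using F(2) R.B.smult_l_null[OF R.unit_elt_closed]
      by (intro R.B.finsum_cong') auto
    then show ?thesis by (simp add: R.B.finsum_zero)
  qed
  have "inj_on h (carrier ?K)"
  proof (rule inj_onI)
    fix x y assume xy: "x \<in> carrier ?K" "y \<in> carrier ?K" "h x = h y"
    have decomp: "x = (x \<ominus>\<^bsub>?K\<^esub> y) \<oplus>\<^bsub>?K\<^esub> y"
      using xy by (simp add: R.B.minus_eq R.B.a_assoc R.B.l_neg)
    then have "h x = h (x \<ominus>\<^bsub>?K\<^esub> y) + h y"
      using h_simps(1)[of "x \<ominus>\<^bsub>?K\<^esub> y" y] xy by (metis R.B.minus_closed)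
    then have "h (x \<ominus>\<^bsub>?K\<^esub> y) = 0" using xy(3) by simp
    from kernel[OF R.B.minus_closed[OF xy(1,2)] this] show "x = y"
      using decomp R.B.l_zero[OF xy(2)] by simp
  qed
  moreover have "h ` carrier ?K = carrier ?A"
    unfolding carrier_groupoid_algebra
  proof
    show "h ` carrier ?K \<subseteq> cyl_span" using h_closed by blast
    \<comment> \<open>Since the image of \<open>h\<close> is a subspace, it suffices that it
      contains the indicators, which are the images of the spanning elements.\<close>
    show "cyl_span \<subseteq> h ` carrier ?K"
      unfolding cyl_span_def
    proof (rule fun_space.span_minimal)
      show "ind ` pairs \<subseteq> h ` carrier ?K"
      proof
        fix f assume "f \<in> ind ` pairs"
        then obtain a b where p: "(a, b) \<in> pairs" "f = ind (a, b)" by auto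
        then show "f \<in> h ` carrier ?K" using h_unit[OF p(1)] R.unit_elt_closed[OF p(1)] by (metis imageI)
      qed
      show "fun_space.subspace (h ` carrier ?K)"
      proof (rule fun_space.subspaceI)
        have "h \<zero>\<^bsub>?K\<^esub> = 0"
          using hom_zero[OF complex_algebra_kumjian_pask complex_algebra_groupoid h]
          by (simp add: groupoid_algebra_simps)
        then show "0 \<in> h ` carrier ?K" using R.B.zero_closed by (metis imageI)
      next
        fix f g assume "f \<in> h ` carrier ?K" "g \<in> h ` carrier ?K"
        then obtain x y where x: "x \<in> carrier ?K" "f = h x" and y: "y \<in> carrier ?K" "g = h y" by blast
        have "f + g = h (x \<oplus>\<^bsub>?K\<^esub> y)" using h_simps(1)[OF x(1) y(1)] x(2) y(2) by simp
        then show "f + g \<in> h ` carrier ?K" using R.B.a_closed[OF x(1) y(1)] by blast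
      next
        fix c f assume "f \<in> h ` carrier ?K"
        then obtain x where x: "x \<in> carrier ?K" "f = h x" by blast
        have "c \<odot>\<^bsub>?K\<^esub> x \<in> carrier ?K" using R.B.smult_closed x(1) by simp
        moreover have "(\<lambda>\<gamma>. c * f \<gamma>) = h (c \<odot>\<^bsub>?K\<^esub> x)" using h_simps(3)[OF x(1) x(1)] x(2) by simp
        ultimately show "(\<lambda>\<gamma>. c * f \<gamma>) \<in> h ` carrier ?K" by blast
      qed
    qed
  qed
  ultimately show ?thesis using h unfolding calg_isomorphic_def bij_betw_def by blast
qed

theorem proposition4p3:
  fixes \<Lambda> :: "('a, 'k::finite) kgraph"
  assumes "k_graph \<Lambda>"
    and "row_finite \<Lambda>"
    and "no_sources \<Lambda>"
  shows "calg_isomorphic (groupoid_algebra \<Lambda>) (kumjian_pask \<Lambda>)"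
proof -
  interpret k_graph \<Lambda> by fact
  interpret source_free_k_graph \<Lambda> by standard fact+
  show ?thesis
    by (rule calg_isomorphic_sym[OF complex_algebra_kumjian_pask kumjian_pask_isomorphic])
qed

end
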